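(* Let $K$ be a connected sum of finitely many (at least one) knots, each of which is the figure-eight knot $E$, a torus knot $T(a,b)$, or the mirror image $\overline{T(a,b)}$ of a torus knot, where $a,b>1$ are coprime integers (which may vary from summand to summand). Let $\Lambda(K):=\{z\in\mathbb{C}\mid\Delta(K;\exp z)=0\}$, where $\Delta(K;t)$ is the Alexander polynomial of $K$, and let $c\in\Lambda(K)$ be such that $|c|=\min\{|z|\mid z\in\Lambda(K)\}$. Then the sequence $\{J_N(K;\exp(c/N))\}_{N=2,3,\dots}$ of values of the colored Jones polynomials grows polynomially, and $$\lim_{N\to\infty}J_N\left(K;\exp\left(\frac{tc}{N}\right)\right)=\frac{1}{\Delta\bigl(K;\exp(tc)\bigr)}\qquad\text{for } 0\le t<1.$$
   Context: A sequence $\{A_N\}$ "grows polynomially" if there are a real $\alpha>0$ and a constant $C\ne0$ with $\lim_{N\to\infty}A_N/(C N^{\alpha})=1$. The Alexander polynomial is normalized so that $\Delta(K;t)=\Delta(K;t^{-1})$ and $\Delta(K;1)=1$; it is multiplicative under connected sum and invariant under mirror image, with $\Delta(E;t)=-t+3-t^{-1}$ and $$\Delta(T(a,b);t)=\frac{(t^{ab/2}-t^{-ab/2})(t^{1/2}-t^{-1/2})}{(t^{a/2}-t^{-a/2})(t^{b/2}-t^{-b/2})}.$$ $J_N(K;q)$ denotes the (0-framed) colored Jones polynomial of a knot $K$ associated with the $N$-dimensional irreducible representation of $sl(2;\mathbb{C})$, normalized so that $J_N(\text{unknot};q)=1$. It satisfies $J_N(K_1\sharp K_2;q)=J_N(K_1;q)J_N(K_2;q)$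 for connected sums and $J_N(\overline{K};q)=J_N(K;q^{-1})$ for the mirror image $\overline{K}$. For the knots involved it is given explicitly (and may be taken to be defined) by $$J_N(E;q)=\sum_{k=0}^{N-1}\prod_{j=1}^{k}\left(q^{(N+j)/2}-q^{-(N+j)/2}\right)\left(q^{(N-j)/2}-q^{-(N-j)/2}\right),$$ $$J_N(T(a,b);q)=\frac{q^{-ab(N^2-1)/4}}{q^{N/2}-q^{-N/2}}\sum_{k=-(N-1)/2}^{(N-1)/2}q^{abk^2+bk}\left(q^{ak+1/2}-q^{-ak-1/2}\right),$$ where $k$ in the second sum runs in steps of $1$; both are Laurent polynomials in $q$. For $q=\exp(c/N)$, $q^{s}$ means $\exp(sc/N)$. *)

theory Defs
  imports "HOL-Complex_Analysis.Complex_Analysis"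
begin

definition grows_polynomially :: "(nat \<Rightarrow> complex) \<Rightarrow> bool" where
  "grows_polynomially A \<longleftrightarrow>
     (\<exists>\<alpha>::real. \<exists>C::complex. \<alpha> > 0 \<and> C \<noteq> 0 \<and>
        (\<lambda>N. A N / (C * of_real (real N powr \<alpha>))) \<longlonglongrightarrow> 1)"

(* Knots are represented by expressions built from the figure-eight knot and the torus knots
   by mirror image and connected sum. The two invariants below are given by their explicit
   values on the generators and by their behaviour under these two operations. *)

datatype knot =
    Figure_Eight
  | Torus nat nat
  | Mirror knot
  | Connected_Sum knot knot

inductive fig8_torus_sum :: "knot \<Rightarrow> bool" where
  "fig8_torus_sum Figure_Eight"
| "a > 1 \<Longrightarrow> b > 1 \<Longrightarrow> coprime a b \<Longrightarrow> fig8_torus_sum (Torus a b)"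
| "a > 1 \<Longrightarrow> b > 1 \<Longrightarrow> coprime a b \<Longrightarrow> fig8_torus_sum (Mirror (Torus a b))"
| "fig8_torus_sum K \<Longrightarrow> fig8_torus_sum L \<Longrightarrow> fig8_torus_sum (Connected_Sum K L)"

(* Both invariants are Laurent polynomials, written with fractional powers of their variable.
   They are therefore evaluated at exp h as functions of the exponent h, with the convention
   that the s-th power of exp h is exp (s * h). *)

definition epow :: "complex \<Rightarrow> complex \<Rightarrow> complex" where
  "epow h s = exp (s * h)"

(* For torus knots the defining formulas are quotients whose denominators vanish at some
   points (in particular at h = 0), where division would return the junk value 0. The value of
   the Laurent polynomial at such a point is the limit of the quotient, which is what
   remove_sings takes; elsewhere the quotient is continuous and remove_sings does not
   change it. *)

definition torus_alexander :: "nat \<Rightarrow> nat \<Rightarrow> complex \<Rightarrow> complex" where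
  "torus_alexander a b =
     remove_sings (\<lambda>z.
       ((epow z (of_nat a * of_nat b / 2) - epow z (- (of_nat a * of_nat b / 2))) *
        (epow z (1 / 2) - epow z (- (1 / 2)))) /
       ((epow z (of_nat a / 2) - epow z (- (of_nat a / 2))) *
        (epow z (of_nat b / 2) - epow z (- (of_nat b / 2)))))"

(* The value of the Alexander polynomial at t = exp z. *)
primrec alexander_exp :: "knot \<Rightarrow> complex \<Rightarrow> complex" where
  "alexander_exp Figure_Eight z = - exp z + 3 - exp (- z)"
| "alexander_exp (Torus a b) z = torus_alexander a b z"
| "alexander_exp (Mirror K) z = alexander_exp K z"
| "alexander_exp (Connected_Sum K L) z = alexander_exp K z * alexander_exp L z"

definition Lambda_set :: "knot \<Rightarrow> complex set" where
  "Lambda_set K = {z. alexander_exp K z = 0}"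

definition fig8_jones :: "nat \<Rightarrow> complex \<Rightarrow> complex" where
  "fig8_jones N h =
     (\<Sum>k<N. \<Prod>j=1..k.
        (epow h ((of_nat N + of_nat j) / 2) - epow h (- ((of_nat N + of_nat j) / 2))) *
        (epow h ((of_nat N - of_nat j) / 2) - epow h (- ((of_nat N - of_nat j) / 2))))"

(* The summation index k = i - (N - 1) / 2 runs from -(N - 1) / 2 to (N - 1) / 2
   in steps of 1. *)
definition torus_jones :: "nat \<Rightarrow> nat \<Rightarrow> nat \<Rightarrow> complex \<Rightarrow> complex" where
  "torus_jones a b N =
     remove_sings (\<lambda>h.
       epow h (- (of_nat a * of_nat b * (of_nat N ^ 2 - 1) / 4)) /
       (epow h (of_nat N / 2) - epow h (- (of_nat N / 2))) *
       (\<Sum>i<N. let k = of_nat i - (of_nat N - 1) / 2 in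
          epow h (of_nat a * of_nat b * k ^ 2 + of_nat b * k) *
          (epow h (of_nat a * k + 1 / 2) - epow h (- (of_nat a * k) - 1 / 2))))"

(* The value of the N-dimensional colored Jones polynomial at q = exp h, normalized to be 1
   for the unknot; inverting q means negating h. *)
primrec colored_jones_exp :: "nat \<Rightarrow> knot \<Rightarrow> complex \<Rightarrow> complex" where
  "colored_jones_exp N Figure_Eight h = fig8_jones N h"
| "colored_jones_exp N (Torus a b) h = torus_jones a b N h"
| "colored_jones_exp N (Mirror K) h = colored_jones_exp N K (- h)"
| "colored_jones_exp N (Connected_Sum K L) h = colored_jones_exp N K h * colored_jones_exp N L h"

end

(* The zeros of Delta closest to 0 are +-2 pi i / (a b) for T(a,b) and +-arcosh(3/2) for the
   figure-eight knot. So either c is imaginary, or c is real and every torus summand is a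
   trefoil, because 2 pi / (a b) < arcosh(3/2) as soon as a b >= 10. It remains to follow each
   summand along these two lines.

   For the figure-eight knot the factors are 2 cosh z - 2 cosh (z j / N); below the zero they
   are bounded by a constant < 1, which gives a geometric series, and at the zero the products
   behave like exp (- xi^2 k^3 / (3 N^2)), which gives N^(2/3).

   At z = i theta the sum for T(a,b) is a quadratic exponential sum over |k| < N/2 whose weight
   vanishes at the stationary point k = 0. Summation by parts leaves the two end points, which
   produce 1 / Delta. When theta = 2 pi / (a b) the end points become stationary and produce a
   quadratic Gauss sum of order N^(1/2); its limit is nonzero because its modulus is known
   exactly.

   For the trefoil at real z the sum is a partial pentagonal series in q = exp (z / N). For
   z > 0 its ends dominate; for z < 0 the full series is exponentially small by Euler's product
   and only the tails matter. *)
theory Submission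
  imports Defs "HOL-Real_Asymp.Real_Asymp"
begin

subsection \<open>The invariants of torus knots\<close>

text \<open>Both invariants multiply over the summands and the zero sets unite, so each summand only
  sees a point c that is no farther from 0 than its own nearest zero. It contributes an exponent 0,
  1/2 or 2/3, a positive one as soon as c is its zero. The delicate case is the trefoil at z = - y
  with 0 < y <= arcosh(3/2). The full pentagonal series at q = exp (- y / N) has size exp (- pi^2 N
  / (6 y)) and stands against a prefactor exp (3 N y / 2), so this comparison requires y < pi / 3 =
  1.047..., while arcosh(3/2) = 0.962... leaves little room. Keeping k powers in the logarithm of
  Euler's product replaces pi^2 / 6 by 1 + 1/4 + ... + 1/k^2. Three powers give 49/36 and reach only
  y < 0.953; four give 205/144 and reach y < 0.974. This is the origin of the four powers of q, of
  the bound 97/100 for \<open>fig8_root\<close> and of 205/216 = 2/3 * 205/144.\<close>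

lemma epow_minus_epow: "epow h s - epow h (- s) = 2 * sinh (s * h)"
  by (simp add: epow_def sinh_field_def)

lemma sinh_analytic [analytic_intros]:
  "f analytic_on A \<Longrightarrow> (\<lambda>z. sinh (f z)) analytic_on A"
  unfolding sinh_field_def by (auto intro!: analytic_intros)

lemma torus_alexander_eq:
  assumes "sinh (of_nat a / 2 * z) \<noteq> 0" "sinh (of_nat b / 2 * z) \<noteq> 0"
  shows "torus_alexander a b z = sinh (of_nat a * of_nat b / 2 * z) * sinh (z / 2) /
    (sinh (of_nat a / 2 * z) * sinh (of_nat b / 2 * z))"
  unfolding torus_alexander_def epow_minus_epow
  using assms by (subst remove_sings_at_analytic) (auto intro!: analytic_intros)

lemma sinh_quotient_tendsto_0:
  fixes p r :: complex
  assumes "r \<noteq> 0"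
  shows "(\<lambda>z. sinh (p * z) / sinh (r * z)) \<midarrow>0\<rightarrow> p / r"
  by (rule lhopital_complex_simple[where f' = p and g' = r])
     (use assms in \<open>auto intro!: derivative_eq_intros\<close>)

lemma torus_alexander_0:
  assumes "a > 0" "b > 0"
  shows "torus_alexander a b 0 = 1"
  unfolding torus_alexander_def epow_minus_epow
proof (rule remove_sings_eqI)
  have "(\<lambda>z::complex. sinh (of_nat a * of_nat b / 2 * z) / sinh (of_nat a / 2 * z) *
          (sinh (1 / 2 * z) / sinh (of_nat b / 2 * z)))
        \<midarrow>0\<rightarrow> (of_nat a * of_nat b / 2) / (of_nat a / 2) * ((1 / 2) / (of_nat b / 2))"
    by (intro tendsto_mult sinh_quotient_tendsto_0) (use assms in auto)
  then show "(\<lambda>z::complex. 2 * sinh (of_nat a * of_nat b / 2 * z) * (2 * sinh (1 / 2 * z)) /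
        (2 * sinh (of_nat a / 2 * z) * (2 * sinh (of_nat b / 2 * z)))) \<midarrow>0\<rightarrow> 1"
    using assms by (simp add: field_simps)
qed

abbreviation jones_index :: "nat \<Rightarrow> nat \<Rightarrow> real" where
  "jones_index N i \<equiv> real i - (real N - 1) / 2"

lemma jones_index_reflect: "i < N \<Longrightarrow> jones_index N (N - Suc i) = - jones_index N i"
  by (simp add: of_nat_diff field_simps)

lemma sum_jones_index_reflect:
  "(\<Sum>i<N. f (jones_index N i)) = (\<Sum>i<N. f (- jones_index N i))"
proof -
  have "(\<Sum>i<N. f (jones_index N i)) = (\<Sum>i<N. f (jones_index N (N - Suc i)))"
    by (rule sum.nat_diff_reindex [symmetric])
  also have "\<dots> = (\<Sum>i<N. f (- jones_index N i))"
    by (rule sum.cong) (simp_all only: jones_index_reflect lessThan_iff)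
  finally show ?thesis .
qed

text \<open>The sum in the numerator of \<open>torus_jones\<close> with its two factors multiplied
  out. It is entire in h, so the only singularities left are those of the sinh in the
  prefactor.\<close>

definition torus_sum :: "nat \<Rightarrow> nat \<Rightarrow> nat \<Rightarrow> complex \<Rightarrow> complex" where
  "torus_sum a b N h = (\<Sum>i<N. let k = complex_of_real (jones_index N i) in
     exp ((of_nat a * of_nat b * k ^ 2 + (of_nat a + of_nat b) * k + 1 / 2) * h) -
     exp ((of_nat a * of_nat b * k ^ 2 + (of_nat b - of_nat a) * k - 1 / 2) * h))"

lemma torus_jones_unfold:
  "torus_jones a b N = remove_sings (\<lambda>h. 
     exp (- (of_nat a * of_nat b * (of_nat N ^ 2 - 1) / 4) * h) * torus_sum a b N h /
     (2 * sinh (of_nat N / 2 * h)))"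
  unfolding torus_jones_def epow_minus_epow
  by (rule arg_cong[where f = remove_sings])
     (simp add: fun_eq_iff torus_sum_def Let_def epow_def right_diff_distrib 
        exp_add [symmetric] algebra_simps)

lemma torus_sum_analytic: "torus_sum a b N analytic_on A"
  unfolding torus_sum_def Let_def by (intro analytic_intros)

lemma torus_jones_eq:
  assumes "sinh (of_nat N / 2 * h) \<noteq> 0"
  shows "torus_jones a b N h =
     exp (- (of_nat a * of_nat b * (of_nat N ^ 2 - 1) / 4) * h) * torus_sum a b N h /
     (2 * sinh (of_nat N / 2 * h))"
  unfolding torus_jones_unfold
proof (rule remove_sings_at_analytic)
  show "(\<lambda>h. exp (- (of_nat a * of_nat b * (of_nat N ^ 2 - 1) / 4) * h) * torus_sum a b N h /
     (2 * sinh (of_nat N / 2 * h))) analytic_on {h}"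
    using assms by (auto intro!: analytic_intros torus_sum_analytic)
qed

lemma sum_jones_index: "(\<Sum>i<N. jones_index N i) = 0"
proof -
  have "(\<Sum>i<N. jones_index N i) = (\<Sum>i<N. - jones_index N i)"
    by (rule sum_jones_index_reflect[of "\<lambda>x. x"])
  then show ?thesis by (simp only: sum_negf)
qed

lemma torus_sum_has_derivative_0:
  "(torus_sum a b N has_field_derivative of_nat N) (at 0)"
proof -
  have "(torus_sum a b N has_field_derivative 
          (\<Sum>i<N. 2 * of_nat a * complex_of_real (jones_index N i) + 1)) (at 0)"
    unfolding torus_sum_def Let_def
  proof (rule DERIV_sum)
    fix i
    show "((\<lambda>h. exp ((of_nat a * of_nat b * k ^ 2 + (of_nat a + of_nat b) * k + 1 / 2) * h) -
      exp ((of_nat a * of_nat b * k ^ 2 + (of_nat b - of_nat a) * k - 1 / 2) * h))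
      has_field_derivative (2 * of_nat a * k + 1)) (at 0)" for k :: complex
      by (rule derivative_eq_intros refl)+ (simp add: algebra_simps)
  qed
  moreover have "(\<Sum>i<N. 2 * of_nat a * complex_of_real (jones_index N i) + 1) = of_nat N"
  proof -
    have "(\<Sum>i<N. 2 * of_nat a * complex_of_real (jones_index N i) + 1) =
       2 * of_nat a * complex_of_real (\<Sum>i<N. jones_index N i) + of_nat N"
      unfolding of_real_sum sum_distrib_left by (simp add: sum.distrib)
    then show ?thesis unfolding sum_jones_index by simp
  qed
  ultimately show ?thesis by simp
qed

text \<open>Needed for t = 0. Numerator and denominator of the defining quotient both vanish at 0
  with derivative N: in the sum the contributions linear in k cancel and each of the N terms leaves
  1.\<close>

lemma torus_jones_0:
  assumes "N > 0"
  shows "torus_jones a b N 0 = 1"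
  unfolding torus_jones_unfold
proof (rule remove_sings_eqI, rule lhopital_complex_simple[where f' = "of_nat N" and g' = "of_nat N"])
  have [simp]: "torus_sum a b N 0 = 0" by (simp add: torus_sum_def)
  then show "exp (- (of_nat a * of_nat b * (of_nat N ^ 2 - 1) / 4) * 0) * torus_sum a b N 0 = 0"
    by simp
  show "((\<lambda>h. exp (- (of_nat a * of_nat b * (of_nat N ^ 2 - 1) / 4) * h) * torus_sum a b N h)
     has_field_derivative of_nat N) (at 0)"
    by (auto intro!: derivative_eq_intros torus_sum_has_derivative_0)
  show "((\<lambda>h. 2 * sinh (of_nat N / 2 * h)) has_field_derivative complex_of_nat N) (at 0)"
    by (auto intro!: derivative_eq_intros)
qed (use assms in auto)

text \<open>Averages the terms at k and - k, which the symmetric index range permits. The result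
  shows the symmetry in a and b, and on the imaginary axis the hyperbolic cosines become real
  cosines.\<close>

lemma torus_sum_symmetric:
  "torus_sum a b N h = (\<Sum>i<N. let k = complex_of_real (jones_index N i) in
     exp (of_nat a * of_nat b * k ^ 2 * h) *
     (exp (h / 2) * cosh ((of_nat a + of_nat b) * k * h) -
      exp (- (h / 2)) * cosh ((of_nat a - of_nat b) * k * h)))"
proof -
  define F where "F x = (let k = complex_of_real x in
     exp ((of_nat a * of_nat b * k ^ 2 + (of_nat a + of_nat b) * k + 1 / 2) * h) -
     exp ((of_nat a * of_nat b * k ^ 2 + (of_nat b - of_nat a) * k - 1 / 2) * h))" for x
  have F: "torus_sum a b N h = (\<Sum>i<N. F (jones_index N i))"
    by (simp only: torus_sum_def F_def)
  have "2 * torus_sum a b N h = (\<Sum>i<N. F (jones_index N i) + F (- jones_index N i))"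
    unfolding sum.distrib sum_jones_index_reflect[of F, symmetric] F by simp
  also have "\<dots> = (\<Sum>i<N. 2 * (let k = complex_of_real (jones_index N i) in
     exp (of_nat a * of_nat b * k ^ 2 * h) *
     (exp (h / 2) * cosh ((of_nat a + of_nat b) * k * h) -
      exp (- (h / 2)) * cosh ((of_nat a - of_nat b) * k * h))))"
  proof (intro sum.cong refl)
    fix i
    define k where "k = complex_of_real (jones_index N i)"
    have "F (jones_index N i) + F (- jones_index N i) =
      2 * (exp (of_nat a * of_nat b * k ^ 2 * h) *
       (exp (h / 2) * cosh ((of_nat a + of_nat b) * k * h) -
        exp (- (h / 2)) * cosh ((of_nat a - of_nat b) * k * h)))"
      unfolding F_def Let_def of_real_minus k_def [symmetric] cosh_field_def
      by (simp add: algebra_simps exp_add [symmetric] add_divide_distrib)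
    then show "F (jones_index N i) + F (- jones_index N i) =
      2 * (let k = complex_of_real (jones_index N i) in
       exp (of_nat a * of_nat b * k ^ 2 * h) *
       (exp (h / 2) * cosh ((of_nat a + of_nat b) * k * h) -
        exp (- (h / 2)) * cosh ((of_nat a - of_nat b) * k * h)))"
      by (simp only: Let_def k_def)
  qed
  finally show ?thesis unfolding sum_distrib_left [symmetric] by simp
qed

lemma torus_sum_commute: "torus_sum a b N h = torus_sum b a N h"
proof -
  have "cosh ((of_nat a - of_nat b) * k * h) = cosh ((of_nat b - of_nat a) * k * h)" for k :: complex
    using cosh_minus[of "(of_nat a - of_nat b) * k * h"] by (simp add: algebra_simps)
  then show ?thesis
    by (simp add: torus_sum_symmetric Let_def ac_simps)
qed

lemma torus_jones_commute: "torus_jones a b N h = torus_jones b a N h"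
  unfolding torus_jones_unfold torus_sum_commute[of a b]
  by (simp add: ac_simps)

lemma torus_alexander_commute: "torus_alexander a b z = torus_alexander b a z"
  unfolding torus_alexander_def by (simp add: ac_simps)

subsection \<open>Riemann sums and limits of truncated sums\<close>

text \<open>An interchange of limits in which neither limit is known in advance: h M is the part of
  a up to a cut-off M, and e M bounds the rest for all large N. The value l exists because a is
  Cauchy. It serves for improper integrals over [0, infinity), whose truncations are the X
  M.\<close>

lemma convergent_of_approximations:
  fixes a :: "nat \<Rightarrow> complex"
  assumes head: "\<And>M. (\<lambda>N. h M N) \<longlonglongrightarrow> X M"
    and tail: "\<And>M. eventually (\<lambda>N. norm (a N - h M N) \<le> e M) sequentially"
    and e: "e \<longlonglongrightarrow> (0::real)"
  obtains l where "a \<longlonglongrightarrow> l" "(X::nat \<Rightarrow> complex) \<longlonglongrightarrow> l"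
proof -
  have near: "eventually (\<lambda>N. norm (a N - X M) < e M + \<epsilon>) sequentially" if "\<epsilon> > 0" for M \<epsilon>
  proof -
    have "eventually (\<lambda>N. norm (h M N - X M) < \<epsilon>) sequentially"
      using head[of M] that by (auto simp: tendsto_iff dist_norm)
    with tail[of M] show ?thesis
    proof eventually_elim
      case (elim N)
      then show ?case using norm_triangle_ineq[of "a N - h M N" "h M N - X M"] by simp
    qed
  qed
  have "Cauchy a"
  proof (rule metric_CauchyI)
    fix \<epsilon> :: real assume "\<epsilon> > 0"
    then have "eventually (\<lambda>M. e M < \<epsilon> / 4) sequentially"
      using order_tendstoD(2)[OF e, of "\<epsilon> / 4"] by simp
    then obtain M where M: "e M < \<epsilon> / 4" by (auto simp: eventually_sequentially)
    obtain N0 where N0: "\<And>N. N \<ge> N0 \<Longrightarrow> norm (a N - X M) < e M + \<epsilon> / 4"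
      using near[of "\<epsilon> / 4" M] \<open>\<epsilon> > 0\<close> by (auto simp: eventually_sequentially)
    have "dist (a m) (a n) < \<epsilon>" if "m \<ge> N0" "n \<ge> N0" for m n
    proof -
      have "dist (a m) (a n) \<le> dist (a m) (X M) + dist (a n) (X M)"
        by (rule dist_triangle2)
      then show ?thesis using N0[OF that(1)] N0[OF that(2)] M by (simp add: dist_norm)
    qed
    then show "\<exists>N0. \<forall>m\<ge>N0. \<forall>n\<ge>N0. dist (a m) (a n) < \<epsilon>" by blast
  qed
  then obtain l where l: "a \<longlonglongrightarrow> l" by (auto simp: Cauchy_convergent_iff convergent_def)
  have "norm (l - X M) \<le> e M" for M
  proof (rule field_le_epsilon)
    fix \<epsilon> :: real assume "\<epsilon> > 0"
    show "norm (l - X M) \<le> e M + \<epsilon>"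
    proof (rule tendsto_upperbound)
      show "(\<lambda>N. norm (a N - X M)) \<longlonglongrightarrow> norm (l - X M)" by (intro tendsto_intros l)
      show "eventually (\<lambda>N. norm (a N - X M) \<le> e M + \<epsilon>) sequentially"
        using near[OF \<open>\<epsilon> > 0\<close>, of M] by eventually_elim simp
    qed simp
  qed
  then have "(\<lambda>M. X M - l) \<longlonglongrightarrow> 0"
    by (intro Lim_null_comparison[OF _ e]) (simp add: norm_minus_commute)
  then have "X \<longlonglongrightarrow> l" by (simp add: LIM_zero_iff)
  with l show ?thesis by (rule that)
qed

text \<open>f and its first two derivatives are bounded on the compact set S; B is the sum of the
  three bounds, so that one constant serves all estimates. Convexity lets the mean value bound and
  Taylor's formula run along segments in S.\<close>

lemma holomorphic_first_order_bound:
  fixes f :: "complex \<Rightarrow> complex"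
  assumes "open A" "f holomorphic_on A" "convex S" "compact S" "S \<subseteq> A"
  obtains B where "B \<ge> 0" "\<And>x. x \<in> S \<Longrightarrow> norm (f x) \<le> B"
    "\<And>x y. x \<in> S \<Longrightarrow> y \<in> S \<Longrightarrow> norm (f y - f x) \<le> B * norm (y - x)"
    "\<And>x y. x \<in> S \<Longrightarrow> y \<in> S \<Longrightarrow> norm (f y - f x - deriv f x * (y - x)) \<le> B * (norm (y - x))\<^sup>2"
proof -
  define g where "g i = (deriv ^^ i) f" for i :: nat
  have hol: "g i holomorphic_on A" for i
    unfolding g_def using assms by (intro holomorphic_higher_deriv) auto
  have der: "(g i has_field_derivative g (Suc i) x) (at x within S)" if "x \<in> S" for i x
    using holomorphic_derivI[OF hol[of i] assms(1)] that assms(5)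
    by (auto simp: g_def intro: DERIV_subset)
  have "bounded (g i ` S)" for i
    using assms(4,5) hol[of i]
    by (intro compact_imp_bounded compact_continuous_image holomorphic_on_imp_continuous_on)
       (auto intro: holomorphic_on_subset)
  then have "\<exists>b. \<forall>x\<in>S. norm (g i x) \<le> b" for i
    by (simp add: bounded_iff)
  then obtain b where b: "\<And>i x. x \<in> S \<Longrightarrow> norm (g i x) \<le> b i" by metis
  define B where "B = \<bar>b 0\<bar> + \<bar>b 1\<bar> + \<bar>b 2\<bar>"
  have le: "norm (g i x) \<le> B" if "x \<in> S" "i \<le> 2" for i x
  proof -
    have "i = 0 \<or> i = 1 \<or> i = 2" using that(2) by arith
    then consider "i = 0" | "i = 1" | "i = 2" by blast
    then show ?thesis using b[OF that(1), of i] by cases (auto simp: B_def)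
  qed
  show ?thesis
  proof (rule that)
    show "B \<ge> 0" by (simp add: B_def)
    show "norm (f x) \<le> B" if "x \<in> S" for x using le[OF that, of 0] by (simp add: g_def)
    show "norm (f y - f x) \<le> B * norm (y - x)" if "x \<in> S" "y \<in> S" for x y
      using field_differentiable_bound[OF assms(3) der[of _ 0] le[of _ "Suc 0"] that(2,1)]
      by (simp add: g_def)
    show "norm (f y - f x - deriv f x * (y - x)) \<le> B * (norm (y - x))\<^sup>2"
      if "x \<in> S" "y \<in> S" for x y
    proof -
      have "norm (g 0 y - (\<Sum>i\<le>1. g i x * (y - x) ^ i / fact i)) \<le> B * norm (y - x) ^ Suc 1 / fact 1"
        by (rule complex_Taylor[where S = S])
           (use assms(3) der le[of _ 2] that in \<open>auto simp: numeral_2_eq_2\<close>)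
      then show ?thesis by (simp add: g_def diff_diff_eq power2_eq_square)
    qed
  qed
qed

text \<open>By Taylor's formula for the primitive F each cell of width 1/s has an error of at most
  B/s^2, and the n cells together B (n/s) (1/s), which tends to 0. Mesh and number of cells are
  separate sequences because the cut-off n will be a rounded multiple of s.\<close>

lemma riemann_sum_tendsto:
  fixes f F :: "complex \<Rightarrow> complex" and s :: "nat \<Rightarrow> real" and n :: "nat \<Rightarrow> nat"
  assumes F: "\<And>z. (F has_field_derivative f z) (at z)"
    and s: "filterlim s at_top sequentially"
    and n: "(\<lambda>N. real (n N) / s N) \<longlonglongrightarrow> M"
  shows "(\<lambda>N. (\<Sum>j<n N. f (of_real (real j / s N))) / of_real (s N)) \<longlonglongrightarrow> F (of_real M) - F 0"
proof -
  \<comment> \<open>The end n/s only tends to M and may exceed it, so the segment gets one unit of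
    room.\<close>
  define S where "S = closed_segment 0 (complex_of_real (M + 1))"
  have hol: "F holomorphic_on UNIV"
    using F by (meson DERIV_subset field_differentiable_def field_differentiable_at_within holomorphic_onI)
  have "deriv F = f" using DERIV_imp_deriv[OF F] by auto
  obtain B where B0: "B \<ge> 0" and B: "\<And>x y. x \<in> S \<Longrightarrow> y \<in> S \<Longrightarrow>
      norm (F y - F x - f x * (y - x)) \<le> B * (norm (y - x))\<^sup>2"
  proof (rule holomorphic_first_order_bound[of UNIV F S])
    show "convex S" "compact S" by (simp_all add: S_def)
    fix B assume "B \<ge> 0" "\<And>x y. x \<in> S \<Longrightarrow> y \<in> S \<Longrightarrow>
      norm (F y - F x - deriv F x * (y - x)) \<le> B * (norm (y - x))\<^sup>2"
    then show thesis unfolding \<open>deriv F = f\<close> by (rule that)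
  qed (use hol in auto)
  have M0: "M \<ge> 0"
  proof (rule tendsto_lowerbound[OF n])
    show "eventually (\<lambda>N. 0 \<le> real (n N) / s N) sequentially"
      using filterlim_at_top_dense[THEN iffD1, OF s, rule_format, of 0] by eventually_elim simp
  qed simp
  have inS: "of_real x \<in> S" if "0 \<le> x" "x \<le> M + 1" for x
    unfolding S_def closed_segment_of_real[of 0, simplified]
    using that M0 by (auto simp: closed_segment_eq_real_ivl)
  have step: "norm (F (of_real y) - F (of_real x) - f (of_real x) * of_real (y - x)) \<le> B * (y - x)\<^sup>2"
    if "0 \<le> x" "x \<le> y" "y \<le> M + 1" for x y
  proof -
    have "of_real x \<in> S" "of_real y \<in> S" using that by (auto intro!: inS)
    from B[OF this] show ?thesis
      by (simp add: norm_of_real del: of_real_diff flip: of_real_diff)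
  qed
  have main: "eventually (\<lambda>N. norm ((F (of_real (real (n N) / s N)) - F 0) - 
      (\<Sum>j<n N. f (of_real (real j / s N))) / of_real (s N)) \<le>
      B * (real (n N) / s N) * (1 / s N)) sequentially"
    using filterlim_at_top_dense[THEN iffD1, OF s, rule_format, of 0]
      order_tendstoD(2)[OF n, of "M + 1", simplified]
  proof eventually_elim
    case (elim N)
    let ?x = "\<lambda>j. real j / s N"
    have "(F (of_real (?x (n N))) - F 0) - (\<Sum>j<n N. f (of_real (?x j))) / of_real (s N) =
      (\<Sum>j<n N. F (of_real (?x (Suc j))) - F (of_real (?x j)) -
          f (of_real (?x j)) * of_real (?x (Suc j) - ?x j))"
      unfolding sum_subtractf
      using sum_lessThan_telescope[of "\<lambda>j. F (of_real (?x j))" "n N"]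
      by (simp add: sum_divide_distrib sum_subtractf add_divide_distrib)
    also have "norm \<dots> \<le> (\<Sum>j<n N. B * (1 / s N)\<^sup>2)"
    proof (rule sum_norm_le)
      fix j assume "j \<in> {..<n N}"
      then have "real (Suc j) / s N \<le> real (n N) / s N"
        using elim by (intro divide_right_mono) auto
      moreover have "real j / s N \<le> real (Suc j) / s N"
        using elim by (intro divide_right_mono) auto
      ultimately have "norm (F (of_real (?x (Suc j))) - F (of_real (?x j)) -
          f (of_real (?x j)) * of_real (?x (Suc j) - ?x j)) \<le> B * (?x (Suc j) - ?x j)\<^sup>2"
        using elim by (intro step) auto
      then show "norm (F (of_real (?x (Suc j))) - F (of_real (?x j)) -
          f (of_real (?x j)) * of_real (?x (Suc j) - ?x j)) \<le> B * (1 / s N)\<^sup>2"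
        by (simp only: diff_divide_distrib [symmetric]) simp
    qed
    also have "\<dots> = B * (real (n N) / s N) * (1 / s N)" by (simp add: power2_eq_square)
    finally show ?case .
  qed
  have inv: "(\<lambda>N. 1 / s N) \<longlonglongrightarrow> 0"
    using tendsto_inverse_0_at_top[OF s] by (simp add: inverse_eq_divide)
  have "(\<lambda>N. B * (real (n N) / s N) * (1 / s N)) \<longlonglongrightarrow> B * M * 0"
    by (intro tendsto_intros n inv)
  then have "(\<lambda>N. (F (of_real (real (n N) / s N)) - F 0) - 
      (\<Sum>j<n N. f (of_real (real j / s N))) / of_real (s N)) \<longlonglongrightarrow> 0"
    by (intro Lim_null_comparison[OF main]) simp
  moreover have "(\<lambda>N. F (of_real (real (n N) / s N)) - F 0) \<longlonglongrightarrow> F (of_real M) - F 0"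
    by (intro tendsto_intros isCont_tendsto_compose[of _ F] DERIV_isCont[OF F] n)
  ultimately show ?thesis using tendsto_diff by fastforce
qed

lemma nat_ceiling_ratio_tendsto:
  fixes s :: "nat \<Rightarrow> real"
  assumes s: "filterlim s at_top sequentially" and M: "M \<ge> 0"
  shows "(\<lambda>N. real (nat \<lceil>M * s N\<rceil>) / s N) \<longlonglongrightarrow> M"
proof (rule tendsto_sandwich)
  have pos: "eventually (\<lambda>N. s N > 0) sequentially"
    using s by (simp add: filterlim_at_top_dense)
  show "(\<lambda>_. M) \<longlonglongrightarrow> M" by simp
  show "eventually (\<lambda>N. M \<le> real (nat \<lceil>M * s N\<rceil>) / s N) sequentially"
    using pos
  proof eventually_elim
    case (elim N)
    have "M * s N \<le> real (nat \<lceil>M * s N\<rceil>)" by linarith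
    then show ?case using elim by (simp add: field_simps)
  qed
  show "eventually (\<lambda>N. real (nat \<lceil>M * s N\<rceil>) / s N \<le> M + 1 / s N) sequentially"
    using pos
  proof eventually_elim
    case (elim N)
    have "real (nat \<lceil>M * s N\<rceil>) \<le> M * s N + 1"
      using elim M mult_nonneg_nonneg[of M "s N"] by linarith
    then show ?case using elim by (simp add: field_simps)
  qed
  have "(\<lambda>N. 1 / s N) \<longlonglongrightarrow> 0"
    using tendsto_inverse_0_at_top[OF s] by (simp add: inverse_eq_divide)
  from tendsto_add[OF tendsto_const this] show "(\<lambda>N. M + 1 / s N) \<longlonglongrightarrow> M" by simp
qed

lemma entire_primitive:
  fixes f :: "complex \<Rightarrow> complex"
  assumes "f holomorphic_on UNIV"
  obtains F where "\<And>z. (F has_field_derivative f z) (at z)"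
  using holomorphic_convex_primitive'[of UNIV f] assms by auto

subsection \<open>The figure-eight knot\<close>

text \<open>4 sinh x sinh y is 2 cosh (x + y) - 2 cosh (x - y). In this form the evenness in h is
  immediate, which reflects that the knot equals its mirror image.\<close>

lemma fig8_jones_eq:
  "fig8_jones N h = (\<Sum>k<N. \<Prod>j=1..k. 2 * cosh (of_nat N * h) - 2 * cosh (of_nat j * h))"
  unfolding fig8_jones_def epow_minus_epow
proof (intro sum.cong prod.cong refl)
  fix j :: nat
  define x y where "x = (of_nat N + of_nat j) / 2 * h" and "y = (of_nat N - of_nat j) / 2 * h"
  have "of_nat N * h = x + y" "of_nat j * h = x - y"
    by (simp_all add: x_def y_def field_simps)
  then have "2 * cosh (of_nat N * h) - 2 * cosh (of_nat j * h) = 2 * sinh x * (2 * sinh y)"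
    by (simp add: cosh_add cosh_diff)
  then show "2 * sinh ((of_nat N + of_nat j) / 2 * h) * (2 * sinh ((of_nat N - of_nat j) / 2 * h)) =
    2 * cosh (of_nat N * h) - 2 * cosh (of_nat j * h)" by (simp add: x_def y_def)
qed

lemma fig8_jones_minus: "fig8_jones N (- h) = fig8_jones N h"
  by (simp add: fig8_jones_eq)

text \<open>The power series of sinh has nonnegative coefficients.\<close>

lemma norm_sinh_le: "norm (sinh z) \<le> sinh (norm z)" for z :: complex
proof -
  have "norm (suminf (\<lambda>n. if even n then 0 else z ^ n /\<^sub>R fact n)) \<le>
     suminf (\<lambda>n. if even n then 0 else norm z ^ n /\<^sub>R fact n)"
    by (rule norm_suminf_le)
       (use sinh_converges[of "norm z"] in \<open>auto simp: norm_power sums_iff\<close>)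
  then show ?thesis
    using sinh_converges[of "norm z"] sinh_converges[of z] by (simp add: sums_iff)
qed

text \<open>The difference is a product of two hyperbolic sines, so \<open>norm_sinh_le\<close>
  reduces it to the real argument \<open>norm z\<close>, and there t = 0 is the worst case.\<close>

lemma norm_cosh_diff_le:
  fixes z :: complex
  assumes "0 \<le> t" "t \<le> 1"
  shows "norm (2 * cosh z - 2 * cosh (of_real t * z)) \<le> 2 * cosh (norm z) - 2"
proof -
  define x y where "x = of_real ((1 + t) / 2) * z" and "y = of_real ((1 - t) / 2) * z"
  define u v where "u = (1 + t) / 2 * norm z" and "v = (1 - t) / 2 * norm z"
  have "z = x + y" "of_real t * z = x - y"
    by (simp_all add: x_def y_def field_simps)
  then have "2 * cosh z - 2 * cosh (of_real t * z) = 4 * (sinh x * sinh y)"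
    by (simp add: cosh_add cosh_diff)
  then have "norm (2 * cosh z - 2 * cosh (of_real t * z)) = 4 * (norm (sinh x) * norm (sinh y))"
    by (simp add: norm_mult)
  also have "\<dots> \<le> 4 * (sinh (norm x) * sinh (norm y))"
    by (intro mult_left_mono mult_mono norm_sinh_le) auto
  also have "norm x = u"
    using assms by (simp only: x_def u_def norm_mult norm_of_real) auto
  also have "norm y = v"
    using assms by (simp only: y_def v_def norm_mult norm_of_real) auto
  also have "4 * (sinh u * sinh v) = 2 * cosh (u + v) - 2 * cosh (u - v)"
    by (simp add: cosh_add cosh_diff)
  also have "u + v = norm z" by (simp add: u_def v_def field_simps)
  also have "2 * cosh (norm z) - 2 * cosh (u - v) \<le> 2 * cosh (norm z) - 2"
    using cosh_real_ge_1[of "u - v"] by simp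
  finally show ?thesis .
qed

text \<open>With w = 2 cosh z - 2 the Alexander polynomial is 1 - w. For fixed k the k-th product
  tends to w^k, and \<open>norm_cosh_diff_le\<close> bounds it by r^k for all N; the hypothesis is
  exactly r < 1. Tannery's theorem then gives the geometric sum 1 / (1 - w).\<close>

lemma fig8_jones_tendsto:
  assumes z: "cosh (norm z) < 3 / 2"
  shows "(\<lambda>N. fig8_jones N (z / of_nat N)) \<longlonglongrightarrow> 1 / alexander_exp Figure_Eight z"
    and "alexander_exp Figure_Eight z \<noteq> 0"
proof -
  define r where "r = 2 * cosh (norm z) - 2"
  have r: "0 \<le> r" "r < 1" using z cosh_real_ge_1[of "norm z"] by (auto simp: r_def)
  define w where "w = 2 * cosh z - 2"
  have alex: "alexander_exp Figure_Eight z = 1 - w"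
    by (simp add: w_def cosh_field_def field_simps)
  have w: "norm w \<le> r" using norm_cosh_diff_le[of 0 z] by (simp add: w_def r_def)
  then have "w \<noteq> 1" using r by auto
  then show "alexander_exp Figure_Eight z \<noteq> 0" unfolding alex by simp
  \<comment> \<open>Extended by 0 beyond k = N - 1, so that the finite sums become series over all k
    with a common majorant.\<close>
  define a where "a k N = (if k < N then \<Prod>j=1..k. 2 * cosh z - 2 * cosh (of_real (real j / real N) * z) else 0)"
    for k N
  have "(\<lambda>N. suminf (\<lambda>k. a k N)) \<longlonglongrightarrow> suminf (\<lambda>k. w ^ k)"
  proof (rule tannerys_theorem[THEN conjunct2, THEN conjunct2])
    show "(a k \<longlonglongrightarrow> w ^ k)" for k
    proof -
      have "(\<lambda>N. \<Prod>j=1..k. 2 * cosh z - 2 * cosh (of_real (real j / real N) * z)) \<longlonglongrightarrow>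
         (\<Prod>j=1..k. 2 * cosh z - 2 * cosh (of_real 0 * z))"
        by (intro tendsto_intros isCont_tendsto_compose[of _ cosh] tendsto_of_real
              real_tendsto_divide_at_top[OF tendsto_const] filterlim_real_sequentially)
      also have "(\<Prod>j=1..k. 2 * cosh z - 2 * cosh (of_real 0 * z)) = w ^ k"
        by (simp add: w_def)
      finally show ?thesis
        by (rule Lim_transform_eventually)
           (use eventually_gt_at_top[of k] in eventually_elim, simp add: a_def)
    qed
    show "eventually (\<lambda>(k, N). norm (a k N) \<le> r ^ k) (at_top \<times>\<^sub>F sequentially)"
    proof (intro always_eventually allI, clarify)
      fix k N
      show "norm (a k N) \<le> r ^ k"
      proof (cases "k < N")
        case True
        then have "norm (a k N) = (\<Prod>j=1..k. norm (2 * cosh z - 2 * cosh (of_real (real j / real N) * z)))"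
          by (simp add: a_def prod_norm)
        also have "\<dots> \<le> (\<Prod>j=1..k. r)"
          unfolding r_def using True by (intro prod_mono conjI norm_cosh_diff_le) auto
        finally show ?thesis by simp
      qed (use r in \<open>auto simp: a_def\<close>)
    qed
    show "summable (\<lambda>k. r ^ k)" using r by (intro summable_geometric) auto
  qed simp
  also have "suminf (\<lambda>k. w ^ k) = 1 / (1 - w)"
    using w r by (intro suminf_geometric) auto
  finally show "(\<lambda>N. fig8_jones N (z / of_nat N)) \<longlonglongrightarrow> 1 / alexander_exp Figure_Eight z"
    unfolding alex
  proof (rule Lim_transform_eventually)
    show "eventually (\<lambda>N. suminf (\<lambda>k. a k N) = fig8_jones N (z / of_nat N)) sequentially"
      using eventually_gt_at_top[of 0]
    proof eventually_elim
      case (elim N)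
      have "suminf (\<lambda>k. a k N) = (\<Sum>k<N. a k N)"
        by (rule suminf_finite) (auto simp: a_def)
      also have "\<dots> = fig8_jones N (z / of_nat N)"
        unfolding fig8_jones_eq using elim
        by (intro sum.cong refl) (auto simp: a_def intro!: prod.cong)
      finally show ?case .
    qed
  qed
qed

section \<open>Growth of the figure-eight knot at its nearest zero\<close>

definition fig8_root :: real where "fig8_root = arcosh (3 / 2)"

lemma cosh_fig8_root: "cosh fig8_root = 3 / 2"
  by (simp add: fig8_root_def)

lemma fig8_root_eq: "fig8_root = ln ((3 + sqrt 5) / 2)"
proof -
  have "sqrt ((3 / 2)\<^sup>2 - 1) = sqrt (5 / 2\<^sup>2)" by (simp add: power2_eq_square)
  also have "\<dots> = sqrt 5 / 2" by (subst real_sqrt_divide) simp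
  finally have "arcosh (3 / 2 :: real) = ln (3 / 2 + sqrt 5 / 2)"
    by (simp only: arcosh_real_def)
  then show ?thesis by (simp add: fig8_root_def add_divide_distrib)
qed

lemma exp_fig8_root: "exp fig8_root = (3 + sqrt 5) / 2"
proof -
  have "0 < (3 + sqrt 5) / 2" by (intro divide_pos_pos add_pos_nonneg) auto
  then show ?thesis unfolding fig8_root_eq by (rule exp_ln)
qed

text \<open>ln 2 is a crude lower bound for the value 0.962...; the constant 2/3 matters in
  \<open>imaginary_root_less\<close>, where it has to exceed 2 pi / 10 = 0.628...\<close>

lemma fig8_root_gt: "fig8_root > 2 / 3"
proof -
  have "2 < (3 + sqrt 5) / 2" using real_less_rsqrt[of 1 5] by simp
  then have "ln 2 < fig8_root" unfolding fig8_root_eq by (subst ln_less_cancel_iff) (auto intro!: add_pos_nonneg)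
  then show ?thesis using ln2_ge_two_thirds by simp
qed

text \<open>The value is 0.9624..., and \<open>fig8_root_square\<close> allows at most sqrt
  (205/216) = 0.9742..., so the bound has to be tight. Five terms of the exponential series at
  97/100 already exceed (3 + sqrt 5) / 2.\<close>

lemma fig8_root_less: "fig8_root < 97 / 100"
proof -
  have "sqrt 5 < 22361 / 10000" by (rule real_less_lsqrt) (auto simp: power2_eq_square)
  then have "exp fig8_root < 26181 / 10000" unfolding exp_fig8_root by simp
  also have "(26181 / 10000 :: real) \<le> (\<Sum>n<5. (97 / 100) ^ n /\<^sub>R fact n)"
    by (simp add: eval_nat_numeral fact_numeral field_simps)
  also have "\<dots> \<le> exp (97 / 100)"
    unfolding exp_def using summable_exp_generic[of "97 / 100 :: real"]
    by (intro sum_le_suminf) auto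
  finally show ?thesis by simp
qed

text \<open>From below, 2 cosh u - 2 = 4 (sinh (u/2))^2. From above, the cubic Taylor polynomials of
  exp at u and - u add up to 2 + u^2, and each remainder is at most exp u * u^4 / 6 with exp u at
  most 3.\<close>

lemma two_cosh_minus_2_bounds:
  fixes u :: real
  assumes "0 \<le> u" "u \<le> 1"
  shows "u\<^sup>2 \<le> 2 * cosh u - 2" "2 * cosh u - 2 \<le> u\<^sup>2 + u ^ 4"
proof -
  have "(u / 2)\<^sup>2 \<le> (sinh (u / 2))\<^sup>2"
  proof (rule power_mono)
    show "u / 2 \<le> sinh (u / 2)"
      using real_le_x_sinh[of "u / 2"] assms by (simp add: sinh_field_def exp_minus)
  qed (use assms in auto)
  moreover have "cosh (2 * (u / 2)) = 2 * (sinh (u / 2))\<^sup>2 + 1"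
    by (simp only: cosh_double cosh_square_eq)
  ultimately show "u\<^sup>2 \<le> 2 * cosh u - 2" by (simp add: power_divide)
  have T: "\<bar>exp v - (1 + v + v\<^sup>2 / 2 + v ^ 3 / 6)\<bar> \<le> exp \<bar>v\<bar> * \<bar>v\<bar> ^ 4 / 6" for v :: real
  proof -
    have "norm (exp (complex_of_real v) - (\<Sum>i\<le>3. complex_of_real v ^ i / fact i))
        \<le> exp \<bar>Re (of_real v)\<bar> * norm (complex_of_real v) ^ Suc 3 / fact 3"
      by (rule Taylor_exp)
    also have "exp (complex_of_real v) - (\<Sum>i\<le>3. complex_of_real v ^ i / fact i) =
      complex_of_real (exp v - (1 + v + v\<^sup>2 / 2 + v ^ 3 / 6))"
      by (simp add: exp_of_real eval_nat_numeral fact_numeral)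
    finally show ?thesis unfolding norm_of_real by (simp add: fact_numeral eval_nat_numeral)
  qed
  have "2 * cosh u - 2 = u\<^sup>2 + (exp u - (1 + u + u\<^sup>2 / 2 + u ^ 3 / 6)) +
    (exp (- u) - (1 + (- u) + (- u)\<^sup>2 / 2 + (- u) ^ 3 / 6))"
    by (simp add: cosh_field_def field_simps)
  also have "\<dots> \<le> u\<^sup>2 + exp u * u ^ 4 / 6 + exp u * u ^ 4 / 6"
  proof (intro add_mono order.refl)
    show "exp u - (1 + u + u\<^sup>2 / 2 + u ^ 3 / 6) \<le> exp u * u ^ 4 / 6"
      using order_trans[OF abs_ge_self T[of u]] assms by simp
    show "exp (- u) - (1 + (- u) + (- u)\<^sup>2 / 2 + (- u) ^ 3 / 6) \<le> exp u * u ^ 4 / 6"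
      using order_trans[OF abs_ge_self T[of "- u"]] assms by simp
  qed
  also have "exp u * u ^ 4 / 6 \<le> 3 * u ^ 4 / 6"
  proof (intro divide_right_mono mult_right_mono)
    have "exp u \<le> exp 1" using assms by simp
    then show "exp u \<le> 3" using exp_le by linarith
  qed auto
  finally show "2 * cosh u - 2 \<le> u\<^sup>2 + u ^ 4" by simp
qed

text \<open>At the zero, 2 cosh z is 3, so the j-th factor 3 - 2 cosh (z j / N) is 1 minus a
  quantity close to (z j / N)^2. It is written in the shape to which exponential estimates
  apply.\<close>

definition fig8_term :: "nat \<Rightarrow> nat \<Rightarrow> real" where
  "fig8_term N k = (\<Prod>j=1..k. 1 - (2 * cosh (fig8_root * (real j / real N)) - 2))"

lemma fig8_jones_root:
  assumes "N > 0"
  shows "fig8_jones N (of_real fig8_root / of_nat N) = of_real (\<Sum>k<N. fig8_term N k)"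
proof -
  have c: "cosh (complex_of_real x) = of_real (cosh x)" for x
    by (simp add: cosh_field_def flip: exp_of_real)
  have 1: "of_nat N * (complex_of_real fig8_root / of_nat N) = of_real fig8_root"
    using assms by simp
  have 2: "of_nat j * (complex_of_real fig8_root / of_nat N) = of_real (fig8_root * (real j / real N))" for j
    by simp
  show ?thesis
    unfolding fig8_jones_eq 1 2 c fig8_term_def of_real_sum of_real_prod
    by (intro sum.cong prod.cong refl) (simp add: cosh_fig8_root)
qed

lemma sum_squares_bounds:
  "(real k) ^ 3 / 3 \<le> (\<Sum>j=1..k. (real j)\<^sup>2)" "(\<Sum>j=1..k. (real j)\<^sup>2) \<le> (real k) ^ 3 / 3 + (real k)\<^sup>2"
  by (induction k) (auto simp: power2_eq_square power3_eq_cube field_simps)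

text \<open>The product of exp (- (r j / N)^2) over j <= k, where r is \<open>fig8_root\<close> and
  the sum of squares is replaced by k^3 / 3. It lives on the scale k = N^(2/3).\<close>

abbreviation fig8_profile :: "nat \<Rightarrow> nat \<Rightarrow> real" where
  "fig8_profile N k \<equiv> exp (- (fig8_root\<^sup>2 * real k ^ 3 / (3 * (real N)\<^sup>2)))"

lemma fig8_term_bounds:
  assumes "k < N"
  shows "0 \<le> fig8_term N k" "fig8_term N k \<le> fig8_profile N k"
proof -
  define u where "u j = fig8_root * (real j / real N)" for j
  have u: "0 \<le> u j" "u j \<le> 1" if "j \<le> k" for j
  proof -
    have "real j / real N \<le> 1" using that assms by simp
    then have "u j \<le> 1 * 1"
      unfolding u_def using fig8_root_less fig8_root_gt by (intro mult_mono) auto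
    then show "u j \<le> 1" by simp
    show "0 \<le> u j" using fig8_root_gt by (simp add: u_def)
  qed
  have nonneg: "0 \<le> 1 - (2 * cosh (u j) - 2)" if "j \<le> k" for j
  proof -
    have "u j \<le> fig8_root * 1"
      unfolding u_def using fig8_root_gt that assms by (intro mult_left_mono) auto
    then have "cosh (u j) \<le> cosh fig8_root"
      using u[OF that] fig8_root_gt by (subst cosh_real_nonneg_le_iff) auto
    then show ?thesis by (simp add: cosh_fig8_root)
  qed
  then show "0 \<le> fig8_term N k"
    unfolding fig8_term_def u_def by (intro prod_nonneg) auto
  have "fig8_term N k \<le> (\<Prod>j=1..k. exp (- (u j)\<^sup>2))"
    unfolding fig8_term_def u_def[symmetric]
  proof (intro prod_mono conjI)
    fix j assume j: "j \<in> {1..k}"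
    show "0 \<le> 1 - (2 * cosh (u j) - 2)" using j nonneg by auto
    have "1 - (2 * cosh (u j) - 2) \<le> 1 + - (u j)\<^sup>2"
      using two_cosh_minus_2_bounds(1)[OF u, of j] j by simp
    also have "\<dots> \<le> exp (- (u j)\<^sup>2)" by (rule exp_ge_add_one_self)
    finally show "1 - (2 * cosh (u j) - 2) \<le> exp (- (u j)\<^sup>2)" .
  qed
  also have "\<dots> = exp (- (fig8_root\<^sup>2 / (real N)\<^sup>2 * (\<Sum>j=1..k. (real j)\<^sup>2)))"
    by (simp add: exp_sum [symmetric] u_def power_mult_distrib power_divide sum_distrib_left sum_negf)
  also have "\<dots> \<le> exp (- (fig8_root\<^sup>2 / (real N)\<^sup>2 * (real k ^ 3 / 3)))"
    unfolding exp_le_cancel_iff neg_le_iff_le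
    by (intro mult_left_mono sum_squares_bounds) auto
  finally show "fig8_term N k \<le> fig8_profile N k" by (simp add: field_simps)
qed

text \<open>ln (1 - y) is at least - y - 2 y^2, and 2 k <= N keeps y small enough for that. For k of
  order N^(2/3) both error terms are of order N^(-2/3): the first is the correction to k^3 / 3 in
  the sum of squares, the second collects the quartic terms.\<close>

lemma fig8_profile_diff_le:
  assumes "2 * k \<le> N" "N > 0"
  shows "fig8_profile N k - fig8_term N k \<le> (real k)\<^sup>2 / (real N)\<^sup>2 + 9 * real k ^ 5 / real N ^ 4"
proof -
  define u where "u j = fig8_root * (real j / real N)" for j
  define A where "A = fig8_root\<^sup>2 * real k ^ 3 / (3 * (real N)\<^sup>2)"
  define d where "d = (real k)\<^sup>2 / (real N)\<^sup>2 + 9 * real k ^ 5 / real N ^ 4"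
  have u: "0 \<le> u j" "u j \<le> 1 / 2" "u j \<le> real j / real N" if "j \<le> k" for j
  proof -
    show "u j \<le> real j / real N"
      unfolding u_def using fig8_root_less fig8_root_gt by (intro mult_left_le_one_le) auto
    also have "real j / real N \<le> 1 / 2" using that assms by (simp add: field_simps)
    finally show "u j \<le> 1 / 2" .
    show "0 \<le> u j" using fig8_root_gt by (simp add: u_def)
  qed
  have "0 \<le> d" unfolding d_def by (intro add_nonneg_nonneg) auto
  have "exp (- (A + d)) \<le> exp (- (\<Sum>j=1..k. (u j)\<^sup>2 + 9 * (u j) ^ 4))"
  proof -
    have "(\<Sum>j=1..k. (u j)\<^sup>2) = fig8_root\<^sup>2 / (real N)\<^sup>2 * (\<Sum>j=1..k. (real j)\<^sup>2)"
      by (simp add: u_def power_mult_distrib power_divide sum_distrib_left)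
    also have "\<dots> \<le> fig8_root\<^sup>2 / (real N)\<^sup>2 * (real k ^ 3 / 3 + (real k)\<^sup>2)"
      by (intro mult_left_mono sum_squares_bounds) auto
    also have "\<dots> = A + fig8_root\<^sup>2 * ((real k)\<^sup>2 / (real N)\<^sup>2)"
      by (simp add: A_def distrib_left)
    also have "fig8_root\<^sup>2 * ((real k)\<^sup>2 / (real N)\<^sup>2) \<le> 1 * ((real k)\<^sup>2 / (real N)\<^sup>2)"
      using fig8_root_gt fig8_root_less by (intro mult_right_mono) (auto simp: power_le_one)
    finally have 1: "(\<Sum>j=1..k. (u j)\<^sup>2) \<le> A + (real k)\<^sup>2 / (real N)\<^sup>2" by simp
    have "(\<Sum>j=1..k. (u j) ^ 4) \<le> (\<Sum>j=1..k. (real k / real N) ^ 4)"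
    proof (intro sum_mono power_mono)
      fix j assume "j \<in> {1..k}"
      then show "u j \<le> real k / real N" "0 \<le> u j"
        using u[of j] assms by (auto intro!: order.trans[OF u(3)] divide_right_mono)
    qed
    also have "\<dots> = real k ^ 5 / real N ^ 4" by (simp add: power_divide eval_nat_numeral)
    finally show ?thesis using 1 by (simp add: d_def sum.distrib sum_distrib_left [symmetric])
  qed
  also have "\<dots> = (\<Prod>j=1..k. exp (- ((u j)\<^sup>2 + 9 * (u j) ^ 4)))"
    by (simp only: exp_sum [symmetric] sum_negf finite_atLeastAtMost)
  also have "\<dots> \<le> fig8_term N k"
    unfolding fig8_term_def u_def[symmetric]
  proof (intro prod_mono conjI)
    fix j assume "j \<in> {1..k}"
    then have j: "0 \<le> u j" "u j \<le> 1 / 2" using u[of j] by auto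
    define y where "y = 2 * cosh (u j) - 2"
    define w where "w = (u j)\<^sup>2"
    have w: "0 \<le> w" "w \<le> 1 / 4"
      using power_mono[OF j(2) j(1), of 2] by (auto simp: w_def power2_eq_square)
    have u4: "(u j) ^ 4 = w\<^sup>2" by (simp add: w_def)
    \<comment> \<open>Origin of the 9: y is at most w + w^2 and y^2 at most 4 w^2, so y + 2 y^2 is
      at most w + 9 w^2.\<close>
    have y: "w \<le> y" "y \<le> w + w\<^sup>2"
      using two_cosh_minus_2_bounds[of "u j"] j by (simp_all add: y_def w_def)
    have w2: "w\<^sup>2 \<le> w / 4" using mult_left_mono[OF w(2) w(1)] by (simp add: power2_eq_square)
    have "y\<^sup>2 \<le> (2 * w)\<^sup>2" using y w w2 by (intro power_mono) auto
    then have "y + 2 * y\<^sup>2 \<le> w + 9 * w\<^sup>2" using y(2) by (simp add: power_mult_distrib)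
    moreover have "- y - 2 * y\<^sup>2 \<le> ln (1 - y)"
      using y w w2 by (intro ln_one_minus_pos_lower_bound) auto
    ultimately have "- (w + 9 * w\<^sup>2) \<le> ln (1 - y)" by simp
    then have "exp (- (w + 9 * w\<^sup>2)) \<le> exp (ln (1 - y))" by simp
    also have "\<dots> = 1 - y" using y w w2 by simp
    finally show "exp (- ((u j)\<^sup>2 + 9 * (u j) ^ 4)) \<le> 1 - (2 * cosh (u j) - 2)"
      unfolding u4 by (simp add: y_def w_def)
  qed auto
  finally have "exp (- A) - fig8_term N k \<le> exp (- A) * (1 - exp (- d))"
    by (simp add: exp_add exp_diff algebra_simps exp_minus divide_inverse)
  also have "\<dots> \<le> 1 * d"
  proof (intro mult_mono)
    show "1 - exp (- d) \<le> d" using exp_ge_add_one_self[of "- d"] by simp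
    show "exp (- A) \<le> 1" by (simp add: A_def)
  next
    show "0 \<le> 1 - exp (- d)" using \<open>0 \<le> d\<close> by simp
  qed auto
  finally show ?thesis by (simp add: A_def d_def)
qed

text \<open>With s = N^(2/3) one has s^3 = N^2, so \<open>fig8_profile\<close> becomes a function of
  k/s and the sum divided by s a Riemann sum. The limit C is the integral of exp (- r^2 x^3 / 3)
  over [0, infinity), where r is \<open>fig8_root\<close>.\<close>

lemma fig8_term_sum_growth:
  obtains C :: complex where "C \<noteq> 0"
    "(\<lambda>N. of_real (\<Sum>k<N. fig8_term N k) / of_real (real N powr (2 / 3))) \<longlonglongrightarrow> C"
proof -
  define s where "s N = real N powr (2 / 3)" for N
  define n where "n M N = nat \<lceil>real (Suc M) * s N\<rceil>" for M N
  have s_pos: "s N > 0" if "N > 0" for N using that by (simp add: s_def)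
  have s3: "s N ^ 3 = (real N)\<^sup>2" for N
  proof (cases "N = 0")
    case False
    then have "s N ^ 3 = s N powr real 3" using s_pos[of N] by (subst powr_realpow) auto
    also have "\<dots> = real N powr 2" by (simp add: s_def powr_powr)
    also have "\<dots> = (real N)\<^sup>2" using False by (subst powr_numeral) auto
    finally show ?thesis .
  qed (simp add: s_def)
  have s_top: "filterlim s at_top sequentially"
    unfolding s_def
    by (rule filterlim_compose[OF real_powr_at_top filterlim_real_sequentially]) simp
  have inv_s: "(\<lambda>N. 1 / s N) \<longlonglongrightarrow> 0"
    using tendsto_inverse_0_at_top[OF s_top] by (simp add: inverse_eq_divide)
  have n_lim: "(\<lambda>N. real (n M N) / s N) \<longlonglongrightarrow> real (Suc M)" for M
    unfolding n_def using s_top by (rule nat_ceiling_ratio_tendsto) simp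
  have s_over_N: "(\<lambda>N. s N / real N) \<longlonglongrightarrow> 0"
  proof -
    have "(\<lambda>N. real N powr (- 1 / 3)) \<longlonglongrightarrow> 0"
      by (intro tendsto_neg_powr filterlim_real_sequentially) auto
    then show ?thesis
    proof (rule Lim_transform_eventually)
      show "eventually (\<lambda>N. real N powr (- 1 / 3) = s N / real N) sequentially"
        using eventually_gt_at_top[of 0]
      proof eventually_elim
        case (elim N)
        have "s N / real N = real N powr (2 / 3) / real N powr 1" using elim by (simp add: s_def)
        also have "\<dots> = real N powr (2 / 3 - 1)" by (rule powr_diff [symmetric])
        finally show ?case by simp
      qed
    qed
  qed
  have n_small: "eventually (\<lambda>N. 2 * n M N \<le> N) sequentially" for M
  proof -
    have "(\<lambda>N. real (n M N) / s N * (s N / real N)) \<longlonglongrightarrow> 0"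
      using tendsto_mult[OF n_lim[of M] s_over_N] by (simp only: mult_zero_right)
    then have "eventually (\<lambda>N. real (n M N) / s N * (s N / real N) < 1 / 2) sequentially"
      by (rule order_tendstoD) simp
    then show ?thesis using eventually_gt_at_top[of 0]
    proof eventually_elim
      case (elim N)
      then have "real (n M N) / real N < 1 / 2" using s_pos[of N] by simp
      then have "real (2 * n M N) < real N" using elim by (simp add: field_simps)
      then show ?case by linarith
    qed
  qed
  define f where "f z = exp (- (of_real (fig8_root\<^sup>2 / 3) * z ^ 3))" for z :: complex
  have "f holomorphic_on UNIV" unfolding f_def by (intro holomorphic_intros)
  then obtain F where F: "\<And>z. (F has_field_derivative f z) (at z)"
    using entire_primitive by blast
  define X where "X M = F (of_real (real (Suc M))) - F 0" for M
  define h where "h M N = complex_of_real ((\<Sum>k<n M N. fig8_term N k) / s N)" for M N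
  define g where "g M N = (\<Sum>j<n M N. f (of_real (real j / s N))) / of_real (s N)" for M N
  have g_lim: "g M \<longlonglongrightarrow> X M" for M
    unfolding g_def X_def by (rule riemann_sum_tendsto[OF F s_top n_lim])
  have f_eq: "f (of_real (real j / s N)) = of_real (fig8_profile N j)" for j N
    unfolding f_def
    by (simp only: of_real_power [symmetric] of_real_mult [symmetric] of_real_minus [symmetric]
        exp_of_real power_divide s3) (simp add: field_simps)
  have head_bound: "eventually (\<lambda>N. norm (h M N - g M N) \<le>
      real (n M N) / s N * ((real (n M N) / s N)\<^sup>2 + 9 * (real (n M N) / s N) ^ 5) * (1 / s N)) sequentially" for M
    using n_small[of M] eventually_gt_at_top[of 0]
  proof eventually_elim
    case (elim N)
    note sN = s_pos[OF elim(2)]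
    let ?n = "n M N"
    define D where "D = (real ?n)\<^sup>2 / (real N)\<^sup>2 + 9 * real ?n ^ 5 / real N ^ 4"
    have "h M N - g M N = of_real ((\<Sum>k<?n. fig8_term N k - fig8_profile N k) / s N)"
      unfolding h_def g_def f_eq by (simp add: sum_subtractf diff_divide_distrib)
    also have "norm \<dots> = \<bar>\<Sum>k<?n. fig8_term N k - fig8_profile N k\<bar> / s N"
      using sN by (simp only: norm_of_real abs_divide; simp)
    also have "\<dots> \<le> (real ?n * D) / s N"
    proof (intro divide_right_mono)
      have "\<bar>\<Sum>k<?n. fig8_term N k - fig8_profile N k\<bar> \<le> (\<Sum>k<?n. \<bar>fig8_term N k - fig8_profile N k\<bar>)"
        by (rule sum_abs)
      also have "\<dots> \<le> (\<Sum>k<?n. D)"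
      proof (rule sum_mono)
        fix k assume "k \<in> {..<?n}"
        then have k: "k < ?n" by simp
        then have "2 * k \<le> N" "k < N" using elim by auto
        from fig8_term_bounds(2)[OF this(2)] fig8_profile_diff_le[OF this(1) elim(2)]
        have "\<bar>fig8_term N k - fig8_profile N k\<bar> \<le> (real k)\<^sup>2 / (real N)\<^sup>2 + 9 * real k ^ 5 / real N ^ 4"
          by linarith
        also have "\<dots> \<le> D"
          unfolding D_def using k by (intro add_mono divide_right_mono mult_left_mono power_mono) auto
        finally show "\<bar>fig8_term N k - fig8_profile N k\<bar> \<le> D" .
      qed
      finally show "\<bar>\<Sum>k<?n. fig8_term N k - fig8_profile N k\<bar> \<le> real ?n * D" by simp
    qed (use sN in auto)
    also have "D = ((real ?n / s N)\<^sup>2 + 9 * (real ?n / s N) ^ 5) * (1 / s N)"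
    proof -
      have "real N ^ 4 = (s N ^ 3)\<^sup>2" by (simp add: s3)
      then show ?thesis
        unfolding D_def s3[of N, symmetric] using sN
        by (simp add: field_simps eval_nat_numeral)
    qed
    finally show ?case by simp
  qed
  have head: "h M \<longlonglongrightarrow> X M" for M
  proof -
    have "(\<lambda>N. real (n M N) / s N * ((real (n M N) / s N)\<^sup>2 + 9 * (real (n M N) / s N) ^ 5) * (1 / s N))
      \<longlonglongrightarrow> real (Suc M) * ((real (Suc M))\<^sup>2 + 9 * real (Suc M) ^ 5) * 0"
      by (intro tendsto_intros n_lim inv_s)
    then have "(\<lambda>N. h M N - g M N) \<longlonglongrightarrow> 0"
      by (intro Lim_null_comparison[OF head_bound]) simp
    then show ?thesis by (rule Lim_transform[OF g_lim])
  qed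
  define a where "a N = complex_of_real ((\<Sum>k<N. fig8_term N k) / s N)" for N
  define e where "e M = 4 / (fig8_root\<^sup>2 * (real (Suc M))\<^sup>2)" for M
  have tail: "eventually (\<lambda>N. norm (a N - h M N) \<le> e M) sequentially" for M
  proof -
    \<comment> \<open>Beyond the cut-off k >= (M + 1) s, so k^3 is at least (M + 1)^2 s^2 k and the
      profile at most exp (- y / s)^k, a geometric series. Its sum divided by s is at most 1/s +
      1/y, and 1/s is eventually below 1/(3 y); together this is 4/(3 y) =
      \<open>e M\<close>.\<close>
    define y where "y = fig8_root\<^sup>2 * (real (Suc M))\<^sup>2 / 3"
    have y: "y > 0" using fig8_root_gt by (simp add: y_def)
    have "eventually (\<lambda>N. 1 / s N < 1 / (3 * y)) sequentially"
      using order_tendstoD(2)[OF inv_s, of "1 / (3 * y)"] y by simp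
    then show ?thesis using n_small[of M] eventually_gt_at_top[of 0]
    proof eventually_elim
      case (elim N)
      note sN = s_pos[OF elim(3)]
      let ?n = "n M N"
      define r where "r = exp (- (y / s N))"
      have r: "0 < r" "r < 1" using y sN by (auto simp: r_def)
      have n_ge: "real (Suc M) * s N \<le> real ?n" unfolding n_def by linarith
      have "a N - h M N = of_real ((\<Sum>k\<in>{?n..<N}. fig8_term N k) / s N)"
      proof -
        have "(\<Sum>k<N. fig8_term N k) - (\<Sum>k<?n. fig8_term N k) = (\<Sum>k\<in>{?n..<N}. fig8_term N k)"
          using elim(2) sum_diff_nat_ivl[of 0 ?n N "fig8_term N"] by (simp add: atLeast0LessThan)
        then show ?thesis
          by (simp only: a_def h_def of_real_diff [symmetric] diff_divide_distrib [symmetric])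
      qed
      also have "norm \<dots> = (\<Sum>k\<in>{?n..<N}. fig8_term N k) / s N"
      proof -
        have "0 \<le> (\<Sum>k\<in>{?n..<N}. fig8_term N k)"
          by (intro sum_nonneg fig8_term_bounds(1)) auto
        then show ?thesis using sN by (simp only: norm_of_real abs_divide; simp)
      qed
      also have "\<dots> \<le> (\<Sum>k\<in>{?n..<N}. r ^ k) / s N"
      proof (intro divide_right_mono sum_mono)
        fix k assume k: "k \<in> {?n..<N}"
        then have "fig8_term N k \<le> fig8_profile N k" by (intro fig8_term_bounds) auto
        also have "\<dots> \<le> exp (real k * (- (y / s N)))"
        proof -
          have "(real (Suc M) * s N)\<^sup>2 \<le> (real k)\<^sup>2"
            using n_ge k sN by (intro power_mono) auto
          then have "fig8_root\<^sup>2 * (real (Suc M) * s N)\<^sup>2 * real k / (3 * (real N)\<^sup>2)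
             \<le> fig8_root\<^sup>2 * (real k)\<^sup>2 * real k / (3 * (real N)\<^sup>2)"
            by (intro divide_right_mono mult_right_mono mult_left_mono) auto
          also have "fig8_root\<^sup>2 * (real (Suc M) * s N)\<^sup>2 * real k / (3 * (real N)\<^sup>2) = real k * (y / s N)"
            unfolding s3[of N, symmetric] y_def using sN by (simp add: field_simps eval_nat_numeral)
          finally show ?thesis by (simp add: eval_nat_numeral mult.assoc)
        qed
        also have "\<dots> = r ^ k" unfolding r_def by (rule exp_of_nat_mult)
        finally show "fig8_term N k \<le> r ^ k" .
      qed (use sN in auto)
      also have "(\<Sum>k\<in>{?n..<N}. r ^ k) \<le> (\<Sum>k. r ^ k)"
        using r by (intro sum_le_suminf summable_geometric) auto
      then have "(\<Sum>k\<in>{?n..<N}. r ^ k) / s N \<le> (\<Sum>k. r ^ k) / s N"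
        using sN by (intro divide_right_mono) auto
      also have "(\<Sum>k. r ^ k) = 1 / (1 - r)" using r by (intro suminf_geometric) auto
      also have "1 / (1 - r) \<le> 1 + s N / y"
      proof -
        have "r * (1 + y / s N) \<le> 1"
        proof -
          have "r * (1 + y / s N) \<le> r * exp (y / s N)"
            using r by (intro mult_left_mono exp_ge_add_one_self) auto
          then show ?thesis by (simp add: r_def flip: exp_add)
        qed
        then have "1 \<le> (1 + s N / y) * (1 - r)"
          using y sN by (simp add: field_simps)
        then show ?thesis using r by (simp add: divide_le_eq)
      qed
      then have "1 / (1 - r) / s N \<le> (1 + s N / y) / s N"
        using sN by (intro divide_right_mono) auto
      also have "\<dots> = 1 / s N + 1 / y" using sN y by (simp add: field_simps)
      also have "\<dots> \<le> 1 / (3 * y) + 1 / y" using elim(1) by simp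
      also have "\<dots> = e M" using y unfolding e_def y_def by (simp add: field_simps)
      finally show ?case .
    qed
  qed
  have e: "e \<longlonglongrightarrow> 0"
  proof -
    have "(\<lambda>M. 4 / fig8_root\<^sup>2 * (1 / real (Suc M))\<^sup>2) \<longlonglongrightarrow> 4 / fig8_root\<^sup>2 * 0\<^sup>2"
      using LIMSEQ_inverse_real_of_nat by (intro tendsto_intros) (simp add: inverse_eq_divide)
    then show ?thesis by (simp add: e_def[abs_def] power_divide field_simps)
  qed
  obtain C where C: "a \<longlonglongrightarrow> C"
    using convergent_of_approximations[OF head tail e] by blast
  \<comment> \<open>C is nonzero because the block k <= s alone keeps it away from 0: there the
    exponent of the profile is at least - 1, and all further terms are nonnegative.\<close>
  have ge: "Re (X 0) \<ge> exp (- 1)"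
  proof (rule tendsto_le)
    show "(\<lambda>N. Re (g 0 N)) \<longlonglongrightarrow> Re (X 0)" by (intro tendsto_intros g_lim)
    show "(\<lambda>N. real (n 0 N) / s N * exp (- 1)) \<longlonglongrightarrow> exp (- 1)"
      using tendsto_mult[OF n_lim[of 0] tendsto_const[of "exp (- 1 :: real)"]] by simp
    show "eventually (\<lambda>N. real (n 0 N) / s N * exp (- 1) \<le> Re (g 0 N)) sequentially"
      using eventually_gt_at_top[of 0]
    proof eventually_elim
      case (elim N)
      note sN = s_pos[OF elim]
      have "real (n 0 N) * exp (- 1) = (\<Sum>j<n 0 N. exp (- 1))" by simp
      also have "\<dots> \<le> (\<Sum>j<n 0 N. fig8_profile N j)"
      proof (rule sum_mono)
        fix j assume "j \<in> {..<n 0 N}"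
        then have "real j \<le> s N" unfolding n_def by simp linarith
        then have "real j ^ 3 \<le> (real N)\<^sup>2" unfolding s3[of N, symmetric] by (intro power_mono) auto
        then have "real j ^ 3 \<le> 3 * (real N)\<^sup>2" by (rule order_trans) simp
        then have "fig8_root\<^sup>2 * real j ^ 3 \<le> 1 * (3 * (real N)\<^sup>2)"
          using fig8_root_gt fig8_root_less by (intro mult_mono) (auto simp: power_le_one)
        then show "exp (- 1) \<le> fig8_profile N j" using elim by (simp add: divide_le_eq)
      qed
      finally have "real (n 0 N) * exp (- 1) / s N \<le> (\<Sum>j<n 0 N. fig8_profile N j) / s N"
        using sN by (intro divide_right_mono) auto
      moreover have "g 0 N = of_real ((\<Sum>j<n 0 N. fig8_profile N j) / s N)"
        unfolding g_def f_eq by simp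
      ultimately show ?case by simp
    qed
  qed simp
  have "Re C \<ge> Re (X 0)"
  proof (rule tendsto_le)
    show "(\<lambda>N. Re (a N)) \<longlonglongrightarrow> Re C" by (intro tendsto_intros C)
    show "(\<lambda>N. Re (h 0 N)) \<longlonglongrightarrow> Re (X 0)" by (intro tendsto_intros head)
    show "eventually (\<lambda>N. Re (h 0 N) \<le> Re (a N)) sequentially"
      using n_small[of 0] eventually_gt_at_top[of 0]
    proof eventually_elim
      case (elim N)
      have "(\<Sum>k<n 0 N. fig8_term N k) \<le> (\<Sum>k<N. fig8_term N k)"
        using elim by (intro sum_mono2) (auto intro: fig8_term_bounds(1))
      then show ?case using s_pos[OF elim(2)] unfolding a_def h_def Re_complex_of_real
        by (intro divide_right_mono) auto
    qed
  qed simp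
  with ge have "exp (- 1) \<le> Re C" by (rule order_trans)
  then have "0 < Re C" by (rule less_le_trans[OF exp_gt_zero])
  then have "C \<noteq> 0" by auto
  moreover have "(\<lambda>N. of_real (\<Sum>k<N. fig8_term N k) / of_real (real N powr (2 / 3))) \<longlonglongrightarrow> C"
    using C unfolding a_def s_def by simp
  ultimately show ?thesis by (rule that)
qed

lemma fig8_jones_growth:
  assumes "c = of_real fig8_root \<or> c = - of_real fig8_root"
  obtains C :: complex where "C \<noteq> 0"
    "(\<lambda>N. fig8_jones N (c / of_nat N) / of_real (real N powr (2 / 3))) \<longlonglongrightarrow> C"
proof -
  obtain C :: complex where C: "C \<noteq> 0"
    "(\<lambda>N. of_real (\<Sum>k<N. fig8_term N k) / of_real (real N powr (2 / 3))) \<longlonglongrightarrow> C"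
    by (rule fig8_term_sum_growth)
  have "(\<lambda>N. fig8_jones N (c / of_nat N) / of_real (real N powr (2 / 3))) \<longlonglongrightarrow> C"
    using C(2)
  proof (rule Lim_transform_eventually)
    show "eventually (\<lambda>N. of_real (\<Sum>k<N. fig8_term N k) / of_real (real N powr (2 / 3)) =
      fig8_jones N (c / of_nat N) / of_real (real N powr (2 / 3))) sequentially"
      using eventually_gt_at_top[of 0]
      by eventually_elim (use assms in \<open>auto simp: fig8_jones_root fig8_jones_minus\<close>)
  qed
  with C(1) show ?thesis by (rule that)
qed

lemma fig8_alexander_root:
  "alexander_exp Figure_Eight (of_real fig8_root) = 0"
proof -
  have "alexander_exp Figure_Eight (of_real fig8_root) = of_real (3 - 2 * cosh fig8_root)"
    by (simp add: cosh_field_def field_simps flip: exp_of_real)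
  then show ?thesis by (simp add: cosh_fig8_root)
qed

text \<open>exp c + exp (- c) = 3 leaves exp c equal to exp r or exp (- r) for r =
  \<open>fig8_root\<close>. Only the real part of c is read off from this; the bound on the norm
  then forces the imaginary part to vanish, which excludes the translates by 2 pi i.\<close>

lemma fig8_alexander_eq_0D:
  assumes "alexander_exp Figure_Eight c = 0" "norm c \<le> fig8_root"
  shows "c = of_real fig8_root \<or> c = - of_real fig8_root"
proof -
  define \<xi> where "\<xi> = complex_of_real fig8_root"
  have "exp \<xi> + exp (- \<xi>) = 3"
    using fig8_alexander_root by (simp add: \<xi>_def algebra_simps)
  moreover have "exp c + exp (- c) = 3" using assms(1) by (simp add: algebra_simps)
  ultimately have "exp c + inverse (exp c) = exp \<xi> + inverse (exp \<xi>)"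
    by (simp add: exp_minus)
  then have "(exp c - exp \<xi>) * (exp c * exp \<xi> - 1) = 0"
    by (simp add: field_simps)
  then have "norm (exp c) = norm (exp \<xi>) \<or> exp (c + \<xi>) = 1"
    by (subst exp_add) force
  then have "Re c = fig8_root \<or> Re c + fig8_root = 0"
  proof (elim disjE)
    assume "exp (c + \<xi>) = 1"
    then have "norm (exp (c + \<xi>)) = 1" by (simp only: norm_one)
    then have "exp (Re (c + \<xi>)) = 1" by (simp only: norm_exp_eq_Re)
    then show ?thesis by (simp add: \<xi>_def)
  qed (simp add: \<xi>_def)
  then have "Re c = fig8_root \<or> Re c = - fig8_root"
    by linarith
  moreover have "(Re c)\<^sup>2 + (Im c)\<^sup>2 \<le> fig8_root\<^sup>2"
    using power_mono[OF assms(2), of 2] by (simp add: cmod_power2)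
  ultimately have "(Re c = fig8_root \<or> Re c = - fig8_root) \<and> Im c = 0"
    by auto
  then show ?thesis by (auto simp: complex_eq_iff)
qed

subsection \<open>Quadratic exponential sums\<close>

definition chirp :: "real \<Rightarrow> real \<Rightarrow> complex" where
  "chirp \<kappa> s = cis (\<kappa> * s\<^sup>2)"

lemma norm_chirp [simp]: "norm (chirp \<kappa> s) = 1"
  by (simp add: chirp_def)

text \<open>The identity that makes summation by parts exact: a centred difference of the quadratic
  phase is the phase times sin (\<kappa> s), the discrete analogue of its derivative. Weights
  divisible by that sine can therefore be summed by parts.\<close>

lemma chirp_telescope:
  "chirp \<kappa> (s + 1 / 2) - chirp \<kappa> (s - 1 / 2) = cis (\<kappa> / 4) * (2 * \<i>) * (chirp \<kappa> s * of_real (sin (\<kappa> * s)))"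
proof -
  have "\<kappa> * (s + 1 / 2)\<^sup>2 = \<kappa> / 4 + \<kappa> * s\<^sup>2 + \<kappa> * s" "\<kappa> * (s - 1 / 2)\<^sup>2 = \<kappa> / 4 + \<kappa> * s\<^sup>2 + - (\<kappa> * s)"
    by (simp_all add: power2_eq_square field_simps)
  then have "chirp \<kappa> (s + 1 / 2) - chirp \<kappa> (s - 1 / 2) =
     cis (\<kappa> / 4) * chirp \<kappa> s * (cis (\<kappa> * s) - cis (- (\<kappa> * s)))"
    unfolding chirp_def by (simp only: cis_mult [symmetric] right_diff_distrib mult.assoc)
  also have "cis (\<kappa> * s) - cis (- (\<kappa> * s)) = 2 * \<i> * of_real (sin (\<kappa> * s))"
    by (simp add: complex_eq_iff)
  finally show ?thesis by (simp add: mult_ac)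
qed

lemma summation_by_parts:
  fixes G u :: "nat \<Rightarrow> complex"
  shows "(\<Sum>i<Suc n. (G (Suc i) - G i) * u i) =
    G (Suc n) * u n - G 0 * u 0 - (\<Sum>i<n. G (Suc i) * (u (Suc i) - u i))"
  by (induction n) (simp_all add: algebra_simps)

lemma chirp_sum_by_parts:
  "cis (\<kappa> / 4) * (2 * \<i>) *
     (\<Sum>i<Suc n. chirp \<kappa> (real i - \<tau>) * of_real (sin (\<kappa> * (real i - \<tau>))) * u i) =
   chirp \<kappa> (real n + 1 / 2 - \<tau>) * u n - chirp \<kappa> (- 1 / 2 - \<tau>) * u 0 -
     (\<Sum>i<n. chirp \<kappa> (real i + 1 / 2 - \<tau>) * (u (Suc i) - u i))"
proof -
  define G where "G i = chirp \<kappa> (real i - 1 / 2 - \<tau>)" for i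
  have GSuc: "G (Suc i) = chirp \<kappa> (real i + 1 / 2 - \<tau>)" for i
    unfolding G_def by (rule arg_cong[where f = "chirp \<kappa>"]) (simp add: field_simps)
  have G: "cis (\<kappa> / 4) * (2 * \<i>) * (chirp \<kappa> (real i - \<tau>) * of_real (sin (\<kappa> * (real i - \<tau>))) * u i) =
      (G (Suc i) - G i) * u i" for i
  proof -
    have "G (Suc i) - G i = chirp \<kappa> ((real i - \<tau>) + 1 / 2) - chirp \<kappa> ((real i - \<tau>) - 1 / 2)"
    proof -
      have "real i + 1 / 2 - \<tau> = (real i - \<tau>) + 1 / 2" "real i - 1 / 2 - \<tau> = (real i - \<tau>) - 1 / 2"
        by simp_all
      then show ?thesis unfolding GSuc unfolding G_def by (simp only:)
    qed
    then show ?thesis by (simp only: chirp_telescope mult_ac)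
  qed
  have G0: "G 0 = chirp \<kappa> (- 1 / 2 - \<tau>)" by (simp add: G_def)
  show ?thesis
    unfolding sum_distrib_left G summation_by_parts unfolding GSuc G0 ..
qed

text \<open>All chirps have modulus 1, so the size of u and half its total variation control the
  sum, uniformly in \<kappa> and \<tau>.\<close>

lemma norm_chirp_sum_le:
  assumes u: "\<And>i. i \<le> n \<Longrightarrow> norm (u i) \<le> b"
  shows "norm (\<Sum>i<Suc n. chirp \<kappa> (real i - \<tau>) * of_real (sin (\<kappa> * (real i - \<tau>))) * u i) \<le>
    b + (\<Sum>i<n. norm (u (Suc i) - u i)) / 2"
proof -
  let ?S = "\<Sum>i<Suc n. chirp \<kappa> (real i - \<tau>) * of_real (sin (\<kappa> * (real i - \<tau>))) * u i"
  have "2 * norm ?S = norm (cis (\<kappa> / 4) * (2 * \<i>) * ?S)"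
    by (simp only: norm_mult norm_cis) simp
  also have "\<dots> \<le> norm (u n) + norm (u 0) + (\<Sum>i<n. norm (u (Suc i) - u i))"
    unfolding chirp_sum_by_parts
    by (intro order.trans[OF norm_triangle_ineq4] add_mono sum_norm_le) (simp_all add: norm_mult)
  also have "\<dots> \<le> 2 * b + (\<Sum>i<n. norm (u (Suc i) - u i))"
    using u[of n] u[of 0] by simp
  finally show ?thesis by simp
qed

abbreviation unit_segment :: "complex set" where
  "unit_segment \<equiv> closed_segment (- (1 / 2)) (1 / 2)"

lemma of_real_in_unit_segment:
  assumes "\<bar>x\<bar> \<le> 1 / 2"
  shows "complex_of_real x \<in> unit_segment"
proof -
  have "complex_of_real x \<in> closed_segment (of_real (- (1 / 2))) (of_real (1 / 2))"
    unfolding closed_segment_of_real using assms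
    by (intro imageI) (auto simp: closed_segment_eq_real_ivl)
  then show ?thesis by simp
qed

lemma unit_segment_cases:
  assumes "z \<in> unit_segment"
  obtains x where "z = of_real x" "\<bar>x\<bar> \<le> 1 / 2"
proof -
  have "z \<in> closed_segment (of_real (- (1 / 2))) (of_real (1 / 2))" using assms by simp
  then show ?thesis
    unfolding closed_segment_of_real by (auto simp: closed_segment_eq_real_ivl intro!: that)
qed

text \<open>The estimates of \<open>holomorphic_first_order_bound\<close> restated at real points,
  since the weights are only sampled at k/N with |k| <= N/2.\<close>

definition segment_bound :: "(complex \<Rightarrow> complex) \<Rightarrow> real \<Rightarrow> bool" where
  "segment_bound U B \<longleftrightarrow> B \<ge> 0 \<and> (\<forall>x. \<bar>x\<bar> \<le> 1 / 2 \<longrightarrow> norm (U (of_real x)) \<le> B \<and>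
     (\<forall>y. \<bar>y\<bar> \<le> 1 / 2 \<longrightarrow> norm (U (of_real y) - U (of_real x)) \<le> B * \<bar>y - x\<bar> \<and>
       norm (U (of_real y) - U (of_real x) - deriv U (of_real x) * of_real (y - x)) \<le> B * (y - x)\<^sup>2))"

lemma segment_boundD:
  assumes "segment_bound U B"
  shows "B \<ge> 0" "\<bar>x\<bar> \<le> 1 / 2 \<Longrightarrow> norm (U (of_real x)) \<le> B"
    "\<bar>x\<bar> \<le> 1 / 2 \<Longrightarrow> \<bar>y\<bar> \<le> 1 / 2 \<Longrightarrow> norm (U (of_real y) - U (of_real x)) \<le> B * \<bar>y - x\<bar>"
    "\<bar>x\<bar> \<le> 1 / 2 \<Longrightarrow> \<bar>y\<bar> \<le> 1 / 2 \<Longrightarrow>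
       norm (U (of_real y) - U (of_real x) - deriv U (of_real x) * of_real (y - x)) \<le> B * (y - x)\<^sup>2"
  using assms unfolding segment_bound_def by blast+

lemma analytic_on_unit_segment_bound:
  assumes "U analytic_on unit_segment"
  shows "\<exists>B. segment_bound U B"
proof -
  obtain A where A: "open A" "unit_segment \<subseteq> A" "U holomorphic_on A"
    using assms by (auto simp: analytic_on_holomorphic)
  obtain B where B: "B \<ge> 0" "\<And>x. x \<in> unit_segment \<Longrightarrow> norm (U x) \<le> B"
    "\<And>x y. x \<in> unit_segment \<Longrightarrow> y \<in> unit_segment \<Longrightarrow> norm (U y - U x) \<le> B * norm (y - x)"
    "\<And>x y. x \<in> unit_segment \<Longrightarrow> y \<in> unit_segment \<Longrightarrow>
       norm (U y - U x - deriv U x * (y - x)) \<le> B * (norm (y - x))\<^sup>2"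
    using holomorphic_first_order_bound[OF A(1,3) _ _ A(2)] by auto
  have nrm: "norm (complex_of_real y - of_real x) = \<bar>y - x\<bar>" for x y
    by (simp only: of_real_diff [symmetric] norm_of_real)
  show ?thesis
    unfolding segment_bound_def
  proof (intro exI[of _ B] conjI allI impI B(1))
    fix x :: real assume x: "\<bar>x\<bar> \<le> 1 / 2"
    show "norm (U (of_real x)) \<le> B" by (intro B(2) of_real_in_unit_segment x)
    fix y :: real assume y: "\<bar>y\<bar> \<le> 1 / 2"
    show "norm (U (of_real y) - U (of_real x)) \<le> B * \<bar>y - x\<bar>"
      using B(3)[OF of_real_in_unit_segment[OF x] of_real_in_unit_segment[OF y]] by (simp only: nrm)
    show "norm (U (of_real y) - U (of_real x) - deriv U (of_real x) * of_real (y - x)) \<le> B * (y - x)\<^sup>2"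
      using B(4)[OF of_real_in_unit_segment[OF x] of_real_in_unit_segment[OF y]]
      by (simp only: nrm of_real_diff power2_abs)
  qed
qed

text \<open>The zeros of the sine are simple, so a zero of V at each of them suffices: l'Hopital's
  rule gives the limit of the quotient and \<open>remove_sings\<close> its analytic
  extension.\<close>

lemma analytic_divide_sin:
  assumes V: "V analytic_on unit_segment" and "\<omega> \<noteq> 0"
    and zeros: "\<And>x. \<bar>x\<bar> \<le> 1 / 2 \<Longrightarrow> sin (\<omega> * x) = 0 \<Longrightarrow> V (of_real x) = 0"
  obtains U where "U analytic_on unit_segment"
    "\<And>x. \<bar>x\<bar> \<le> 1 / 2 \<Longrightarrow> V (of_real x) = of_real (sin (\<omega> * x)) * U (of_real x)"
proof -
  define Q where "Q z = V z / sin (of_real \<omega> * z)" for z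
  have sin_of_real: "sin (of_real \<omega> * complex_of_real x) = of_real (sin (\<omega> * x))" for x
    by (simp flip: sin_of_real)
  have "remove_sings Q analytic_on {z} \<and> V z = sin (of_real \<omega> * z) * remove_sings Q z"
    if z: "z \<in> unit_segment" for z
  proof -
    obtain x where x: "z = of_real x" "\<bar>x\<bar> \<le> 1 / 2" using unit_segment_cases[OF z] by blast
    have Vz: "V analytic_on {z}" using V z by (auto intro: analytic_on_subset)
    show ?thesis
    proof (cases "sin (\<omega> * x) = 0")
      case False
      then have nz: "sin (of_real \<omega> * z) \<noteq> 0" by (simp add: x(1) sin_of_real)
      then have "Q analytic_on {z}"
        unfolding Q_def using Vz by (intro analytic_intros) auto
      then show ?thesis using nz by (simp add: remove_sings_analytic_on Q_def)
    next
      case True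
      then have V0: "V z = 0" and s0: "sin (of_real \<omega> * z) = 0"
        using zeros x by (auto simp: sin_of_real)
      have c: "cos (of_real \<omega> * z) \<noteq> 0"
        using s0 sin_cos_squared_add[of "of_real \<omega> * z"] by auto
      have "Q \<midarrow>z\<rightarrow> deriv V z / (of_real \<omega> * cos (of_real \<omega> * z))"
        unfolding Q_def
        by (rule lhopital_complex_simple[where f' = "deriv V z" and g' = "of_real \<omega> * cos (of_real \<omega> * z)"])
           (use Vz V0 s0 c \<open>\<omega> \<noteq> 0\<close> in \<open>auto intro!: derivative_eq_intros analytic_derivI\<close>)
      moreover have "Q meromorphic_on {z}"
        unfolding Q_def
        by (intro meromorphic_intros analytic_on_imp_meromorphic_on Vz analytic_intros)
      ultimately have "remove_sings Q analytic_on {z}"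
        by (intro remove_sings_analytic_at meromorphic_on_isolated_singularity)
      then show ?thesis using V0 s0 by simp
    qed
  qed
  then show ?thesis
    by (intro that[of "remove_sings Q"])
       (auto simp: analytic_on_analytic_at[of _ unit_segment] sin_of_real of_real_in_unit_segment)
qed

text \<open>The offset \<tau> is kept free because two kinds of sample points occur: the indices k
  themselves, with offset (N - 1)/2, and the midpoints left over by summation by parts, with offset
  N/2 - 1.\<close>

definition in_window :: "nat \<Rightarrow> real \<Rightarrow> nat \<Rightarrow> bool" where
  "in_window n \<tau> N \<longleftrightarrow> N > 0 \<and> (\<forall>i<n. \<bar>real i - \<tau>\<bar> \<le> real N / 2)"

text \<open>The cofactor U of the sine changes by at most B/N per step over at most N steps, so its
  variation stays bounded and \<open>norm_chirp_sum_le\<close> applies.\<close>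

lemma chirp_sum_bounded:
  assumes U: "U analytic_on unit_segment"
  shows "\<exists>B. \<forall>N n \<tau>. in_window n \<tau> N \<longrightarrow>
    norm (\<Sum>i<n. chirp (\<omega> / real N) (real i - \<tau>) *
       (of_real (sin (\<omega> * ((real i - \<tau>) / real N))) * U (of_real ((real i - \<tau>) / real N)))) \<le> B"
proof -
  obtain B where "segment_bound U B" using analytic_on_unit_segment_bound[OF U] by blast
  note B = segment_boundD[OF this]
  show ?thesis
  proof (intro exI[of _ "2 * B"] allI impI)
    fix N n \<tau> assume "in_window n \<tau> N"
    then have N: "N > 0" and range: "\<And>i. i < n \<Longrightarrow> \<bar>real i - \<tau>\<bar> \<le> real N / 2"
      by (auto simp: in_window_def)
    show "norm (\<Sum>i<n. chirp (\<omega> / real N) (real i - \<tau>) *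
       (of_real (sin (\<omega> * ((real i - \<tau>) / real N))) * U (of_real ((real i - \<tau>) / real N)))) \<le> 2 * B"
    proof (cases n)
      case (Suc m)
      define u where "u i = U (of_real ((real i - \<tau>) / real N))" for i
      have half: "\<bar>(real i - \<tau>) / real N\<bar> \<le> 1 / 2" if "i \<le> m" for i
        using range[of i] that N Suc by (simp add: abs_divide field_simps)
      have "norm (\<Sum>i<Suc m. chirp (\<omega> / real N) (real i - \<tau>) *
          of_real (sin (\<omega> / real N * (real i - \<tau>))) * u i) \<le> B + (\<Sum>i<m. norm (u (Suc i) - u i)) / 2"
        unfolding u_def by (intro norm_chirp_sum_le B half)
      also have "(\<Sum>i<m. norm (u (Suc i) - u i)) \<le> (\<Sum>i<m. B / real N)"
      proof (rule sum_mono)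
        fix i assume i: "i \<in> {..<m}"
        have "norm (u (Suc i) - u i) \<le> B * \<bar>(real (Suc i) - \<tau>) / real N - (real i - \<tau>) / real N\<bar>"
          unfolding u_def using i by (intro B half) auto
        also have "\<dots> = B / real N"
          by (simp add: diff_divide_distrib [symmetric] abs_divide)
        finally show "norm (u (Suc i) - u i) \<le> B / real N" .
      qed
      also have "(\<Sum>i<m. B / real N) \<le> B"
      proof -
        have "real m \<le> real N" using range[of 0] range[of m] Suc by linarith
        then show ?thesis using B(1) N by (simp add: field_simps mult_left_mono)
      qed
      finally show ?thesis
        using B(1) unfolding Suc u_def by (simp add: mult.assoc)
    qed (use B(1) in auto)
  qed
qed

lemma card_index_window:
  "real (card {i. i < n \<and> \<bar>real i - \<tau>\<bar> \<le> D}) \<le> 2 * D + 1" if "D \<ge> 0"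
proof -
  have "int ` {i. i < n \<and> \<bar>real i - \<tau>\<bar> \<le> D} \<subseteq> {\<lceil>\<tau> - D\<rceil>..\<lfloor>\<tau> + D\<rfloor>}"
    by (auto simp: ceiling_le_iff le_floor_iff)
  then have "card (int ` {i. i < n \<and> \<bar>real i - \<tau>\<bar> \<le> D}) \<le> card {\<lceil>\<tau> - D\<rceil>..\<lfloor>\<tau> + D\<rfloor>}"
    by (intro card_mono) auto
  also have "card (int ` {i. i < n \<and> \<bar>real i - \<tau>\<bar> \<le> D}) = card {i. i < n \<and> \<bar>real i - \<tau>\<bar> \<le> D}"
    by (intro card_image) auto
  finally have "real (card {i. i < n \<and> \<bar>real i - \<tau>\<bar> \<le> D}) \<le> real (nat (\<lfloor>\<tau> + D\<rfloor> - \<lceil>\<tau> - D\<rceil> + 1))"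
    by simp
  also have "\<dots> \<le> 2 * D + 1" using that by linarith
  finally show ?thesis .
qed

text \<open>|\<omega>| < 2 pi says that the argument lies strictly inside the first zero: the phase
  is stationary at x = 0 only, and not at the ends x = 1/2 and x = - 1/2.\<close>

lemma sin_scaled_eq_0:
  fixes \<omega> x :: real
  assumes "\<omega> \<noteq> 0" "\<bar>\<omega>\<bar> < 2 * pi" "\<bar>x\<bar> \<le> 1 / 2" "sin (\<omega> * x) = 0"
  shows "x = 0"
proof -
  have "\<bar>\<omega> * x\<bar> \<le> \<bar>\<omega>\<bar> * (1 / 2)"
    unfolding abs_mult using assms(3) by (intro mult_left_mono) auto
  then have "- pi < \<omega> * x" "\<omega> * x < pi" using assms(2) by linarith+
  then have "\<omega> * x = 0" using assms(4) by (rule sin_eq_0_pi)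
  then show ?thesis using assms(1) by simp
qed

lemma analytic_sin [analytic_intros]:
  "f analytic_on A \<Longrightarrow> (\<lambda>z::complex. sin (f z)) analytic_on A"
  using analytic_on_compose[of f A sin, unfolded o_def] by (simp add: analytic_on_sin)

text \<open>Such sums occur with factors of size 1/N, hence o(N) is the estimate to aim for. The
  total \<epsilon> N is spent as \<epsilon> N / 4 on the indices near the stationary point,
  \<epsilon> N / 4 on \<rho> elsewhere, and the remaining half on the bounded terms, for N
  large.\<close>

lemma chirp_sum_const_small:
  assumes \<omega>: "\<omega> \<noteq> 0" "\<bar>\<omega>\<bar> < 2 * pi" and "\<epsilon> > 0"
  shows "\<exists>N0. \<forall>N n \<tau>. N \<ge> N0 \<longrightarrow> in_window n \<tau> N \<longrightarrow>
    norm (\<Sum>i<n. chirp (\<omega> / real N) (real i - \<tau>)) \<le> \<epsilon> * real N"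
proof -
  define \<delta> where "\<delta> = min (\<epsilon> / 8) (1 / 2)"
  have \<delta>: "0 < \<delta>" "\<delta> \<le> 1 / 2" "\<delta> \<le> \<epsilon> / 8" using \<open>\<epsilon> > 0\<close> by (auto simp: \<delta>_def)
  define K where "K = {- (1 / 2)..- \<delta>} \<union> {\<delta>..1 / 2}"
  have "compact K" "K \<noteq> {}" using \<delta> by (auto simp: K_def intro: compact_Un)
  moreover have "continuous_on K (\<lambda>x. \<bar>sin (\<omega> * x)\<bar>)" by (intro continuous_intros)
  ultimately obtain x0 where x0: "x0 \<in> K" "\<And>x. x \<in> K \<Longrightarrow> \<bar>sin (\<omega> * x0)\<bar> \<le> \<bar>sin (\<omega> * x)\<bar>"
    using continuous_attains_inf[of K] by blast
  define c where "c = \<bar>sin (\<omega> * x0)\<bar>"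
  have "c > 0"
    using sin_scaled_eq_0[OF \<omega>, of x0] x0(1) \<delta> by (auto simp: c_def K_def)
  have c: "c\<^sup>2 \<le> (sin (\<omega> * x))\<^sup>2" if "\<delta> \<le> \<bar>x\<bar>" "\<bar>x\<bar> \<le> 1 / 2" for x
  proof -
    have "x \<in> K" using that by (auto simp: K_def abs_if split: if_splits)
    then have "c\<^sup>2 \<le> \<bar>sin (\<omega> * x)\<bar>\<^sup>2"
      using x0(2)[of x] by (intro power_mono) (auto simp: c_def)
    then show ?thesis by simp
  qed
  \<comment> \<open>Chosen so that \<eta> / c^2 = \<epsilon> / 4, the bound on \<rho> outside the
    window of radius \<delta>.\<close>
  define \<eta> where "\<eta> = c\<^sup>2 * \<epsilon> / 4"
  have \<eta>: "\<eta> > 0" using \<open>c > 0\<close> \<open>\<epsilon> > 0\<close> by (simp add: \<eta>_def)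
  define U where "U z = sin (of_real \<omega> * z) / ((sin (of_real \<omega> * z))\<^sup>2 + of_real \<eta>)" for z :: complex
  have U_real: "U (of_real x) = of_real (sin (\<omega> * x) / ((sin (\<omega> * x))\<^sup>2 + \<eta>))" for x
    by (simp add: U_def flip: sin_of_real)
  have "U analytic_on unit_segment"
    unfolding U_def
  proof (intro analytic_intros)
    fix z assume "z \<in> unit_segment"
    then obtain x where x: "z = of_real x" by (rule unit_segment_cases)
    have "(sin (\<omega> * x))\<^sup>2 + \<eta> > 0" using \<eta> by (intro add_nonneg_pos) auto
    moreover have "(sin (of_real \<omega> * z))\<^sup>2 + of_real \<eta> = complex_of_real ((sin (\<omega> * x))\<^sup>2 + \<eta>)"
      by (simp add: x flip: sin_of_real)
    ultimately show "(sin (of_real \<omega> * z))\<^sup>2 + of_real \<eta> \<noteq> 0"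
      by (simp only: of_real_eq_0_iff)
  qed
  then obtain B where B: "\<And>N n \<tau>. in_window n \<tau> N \<Longrightarrow>
    norm (\<Sum>i<n. chirp (\<omega> / real N) (real i - \<tau>) *
       (of_real (sin (\<omega> * ((real i - \<tau>) / real N))) * U (of_real ((real i - \<tau>) / real N)))) \<le> B"
    using chirp_sum_bounded[where U = U and \<omega> = \<omega>] by blast
  \<comment> \<open>The stationary point prevents dividing 1 by the sine, so it is split off through \<open>\<rho>\<close>, which is
    small away from that point.\<close>
  define \<rho> where "\<rho> x = \<eta> / ((sin (\<omega> * x))\<^sup>2 + \<eta>)" for x
  have split: "1 = of_real (sin (\<omega> * x)) * U (of_real x) + of_real (\<rho> x)" for x
  proof -
    have "(sin (\<omega> * x))\<^sup>2 + \<eta> > 0" using \<eta> by (intro add_nonneg_pos) auto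
    then have "1 = sin (\<omega> * x) * (sin (\<omega> * x) / ((sin (\<omega> * x))\<^sup>2 + \<eta>)) + \<rho> x"
      by (simp add: \<rho>_def power2_eq_square flip: add_divide_distrib)
    then show ?thesis unfolding U_real of_real_mult [symmetric] of_real_add [symmetric]
      by (metis of_real_1)
  qed
  have \<rho>: "0 \<le> \<rho> x" "\<rho> x \<le> 1" for x
    using \<eta> by (auto simp: \<rho>_def divide_le_eq add_nonneg_pos)
  have \<rho>_small: "\<rho> x \<le> \<epsilon> / 4" if "\<delta> \<le> \<bar>x\<bar>" "\<bar>x\<bar> \<le> 1 / 2" for x
  proof -
    have "\<rho> x \<le> \<eta> / c\<^sup>2"
      unfolding \<rho>_def using c[OF that] \<eta> \<open>c > 0\<close>
      by (intro divide_left_mono mult_pos_pos add_nonneg_pos) auto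
    then show ?thesis using \<open>c > 0\<close> by (simp add: \<eta>_def)
  qed
  define N0 where "N0 = nat \<lceil>2 * (B + 1 + \<epsilon> / 4) / \<epsilon>\<rceil>"
  show ?thesis
  proof (intro exI[of _ N0] allI impI)
    fix N n \<tau> assume "N \<ge> N0" and window: "in_window n \<tau> N"
    then have N: "N \<ge> N0" "N > 0" and range: "\<And>i. i < n \<Longrightarrow> \<bar>real i - \<tau>\<bar> \<le> real N / 2"
      by (auto simp: in_window_def)
    define x where "x i = (real i - \<tau>) / real N" for i
    have x: "\<bar>x i\<bar> \<le> 1 / 2" if "i < n" for i
      using range[OF that] N by (simp add: x_def abs_divide field_simps)
    have n: "real n \<le> real N + 1"
    proof (cases n)
      case (Suc m)
      then have "real m \<le> real N" using range[of 0] range[of m] by linarith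
      with Suc show ?thesis by simp
    qed simp
    let ?A = "\<Sum>i<n. chirp (\<omega> / real N) (real i - \<tau>) *
         (of_real (sin (\<omega> * x i)) * U (of_real (x i)))"
    let ?R = "\<Sum>i<n. chirp (\<omega> / real N) (real i - \<tau>) * of_real (\<rho> (x i))"
    have "(\<Sum>i<n. chirp (\<omega> / real N) (real i - \<tau>)) =
      (\<Sum>i<n. chirp (\<omega> / real N) (real i - \<tau>) *
         (of_real (sin (\<omega> * x i)) * U (of_real (x i))) +
       chirp (\<omega> / real N) (real i - \<tau>) * of_real (\<rho> (x i)))"
      by (intro sum.cong refl) (simp only: distrib_left [symmetric] split [symmetric] mult_1_right)
    then have total: "(\<Sum>i<n. chirp (\<omega> / real N) (real i - \<tau>)) = ?A + ?R"
      unfolding sum.distrib .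
    have "norm (?A + ?R) \<le> B + (\<Sum>i<n. (if \<bar>real i - \<tau>\<bar> \<le> \<delta> * real N then 1 else 0) + \<epsilon> / 4)"
    proof (intro order.trans[OF norm_triangle_ineq] add_mono sum_norm_le)
      show "norm (\<Sum>i<n. chirp (\<omega> / real N) (real i - \<tau>) *
         (of_real (sin (\<omega> * x i)) * U (of_real (x i)))) \<le> B"
        unfolding x_def by (rule B[OF window])
      fix i assume "i \<in> {..<n}"
      then have i: "\<bar>x i\<bar> \<le> 1 / 2" by (intro x) auto
      have "\<rho> (x i) \<le> (if \<bar>real i - \<tau>\<bar> \<le> \<delta> * real N then 1 else 0) + \<epsilon> / 4"
      proof (cases "\<bar>real i - \<tau>\<bar> \<le> \<delta> * real N")
        case True
        then show ?thesis using \<rho>(2)[of "x i"] \<open>\<epsilon> > 0\<close> by simp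
      next
        case False
        then have "\<delta> \<le> \<bar>x i\<bar>" using N(2) by (simp add: x_def abs_divide le_divide_eq)
        then show ?thesis using \<rho>_small[OF _ i] False by simp
      qed
      then show "norm (chirp (\<omega> / real N) (real i - \<tau>) * of_real (\<rho> (x i))) \<le>
          (if \<bar>real i - \<tau>\<bar> \<le> \<delta> * real N then 1 else 0) + \<epsilon> / 4"
        using \<rho>(1)[of "x i"] by (simp add: norm_mult)
    qed
    then have "norm (\<Sum>i<n. chirp (\<omega> / real N) (real i - \<tau>)) \<le>
      B + (\<Sum>i<n. (if \<bar>real i - \<tau>\<bar> \<le> \<delta> * real N then 1 else 0) + \<epsilon> / 4)"
      unfolding total .
    moreover have "(\<Sum>i<n. (if \<bar>real i - \<tau>\<bar> \<le> \<delta> * real N then 1 else 0) + \<epsilon> / 4) \<le>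
      1 + \<epsilon> / 4 + \<epsilon> * real N / 2"
    proof -
      have set: "{i \<in> {..<n}. \<bar>real i - \<tau>\<bar> \<le> \<delta> * real N} = {i. i < n \<and> \<bar>real i - \<tau>\<bar> \<le> \<delta> * real N}" by auto
      have "(\<Sum>i<n. if \<bar>real i - \<tau>\<bar> \<le> \<delta> * real N then 1 else 0) =
          real (card {i. i < n \<and> \<bar>real i - \<tau>\<bar> \<le> \<delta> * real N})"
        using sum.inter_filter[of "{..<n}" "\<lambda>_. 1 :: real" "\<lambda>i. \<bar>real i - \<tau>\<bar> \<le> \<delta> * real N"]
        unfolding set by simp
      also have "\<dots> \<le> 2 * (\<delta> * real N) + 1"
        using \<delta> by (intro card_index_window) auto
      finally have window_count: "(\<Sum>i<n. if \<bar>real i - \<tau>\<bar> \<le> \<delta> * real N then 1 else 0) \<le> 2 * (\<delta> * real N) + 1" .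
      have "\<delta> * real N \<le> \<epsilon> / 8 * real N" using \<delta> by (intro mult_right_mono) auto
      moreover have "real n * (\<epsilon> / 4) \<le> (real N + 1) * (\<epsilon> / 4)"
        using n \<open>\<epsilon> > 0\<close> by (intro mult_right_mono) auto
      ultimately show ?thesis using window_count unfolding sum.distrib by (simp add: field_simps)
    qed
    moreover have "B + 1 + \<epsilon> / 4 \<le> \<epsilon> * real N / 2"
    proof -
      have "2 * (B + 1 + \<epsilon> / 4) / \<epsilon> \<le> real N" using N(1) unfolding N0_def by linarith
      then show ?thesis using \<open>\<epsilon> > 0\<close> by (simp add: divide_le_eq mult.commute)
    qed
    ultimately show "norm (\<Sum>i<n. chirp (\<omega> / real N) (real i - \<tau>)) \<le> \<epsilon> * real N" by simp
  qed
qed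

text \<open>Y - Y 0 vanishes at the only zero of the sine and therefore gives a bounded sum; the
  constant Y 0 is left to \<open>chirp_sum_const_small\<close>.\<close>

lemma chirp_sum_small:
  assumes \<omega>: "\<omega> \<noteq> 0" "\<bar>\<omega>\<bar> < 2 * pi" and Y: "Y analytic_on unit_segment" and "\<epsilon> > 0"
  shows "\<exists>N0. \<forall>N n \<tau>. N \<ge> N0 \<longrightarrow> in_window n \<tau> N \<longrightarrow>
    norm (\<Sum>i<n. chirp (\<omega> / real N) (real i - \<tau>) * Y (of_real ((real i - \<tau>) / real N))) \<le> \<epsilon> * real N"
proof -
  have "(\<lambda>z. Y z - Y 0) analytic_on unit_segment" by (intro analytic_intros Y)
  moreover have "Y (of_real x) - Y 0 = 0" if "\<bar>x\<bar> \<le> 1 / 2" "sin (\<omega> * x) = 0" for x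
    using sin_scaled_eq_0[OF \<omega> that] by simp
  ultimately obtain U where U: "U analytic_on unit_segment"
    "\<And>x. \<bar>x\<bar> \<le> 1 / 2 \<Longrightarrow> Y (of_real x) - Y 0 = of_real (sin (\<omega> * x)) * U (of_real x)"
    using analytic_divide_sin[OF _ \<omega>(1), of "\<lambda>z. Y z - Y 0"] by blast
  obtain B where B: "\<And>N n \<tau>. in_window n \<tau> N \<Longrightarrow>
    norm (\<Sum>i<n. chirp (\<omega> / real N) (real i - \<tau>) *
       (of_real (sin (\<omega> * ((real i - \<tau>) / real N))) * U (of_real ((real i - \<tau>) / real N)))) \<le> B"
    using chirp_sum_bounded[OF U(1), where \<omega> = \<omega>] by blast
  define \<epsilon>' where "\<epsilon>' = \<epsilon> / (2 * (norm (Y 0) + 1))"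
  have "norm (Y 0) + 1 > 0" by (intro add_nonneg_pos) auto
  then have \<epsilon>': "\<epsilon>' > 0" "norm (Y 0) * \<epsilon>' \<le> \<epsilon> / 2"
    using \<open>\<epsilon> > 0\<close> by (auto simp: \<epsilon>'_def field_simps)
  obtain N1 where N1: "\<And>N n \<tau>. N \<ge> N1 \<Longrightarrow> in_window n \<tau> N \<Longrightarrow>
    norm (\<Sum>i<n. chirp (\<omega> / real N) (real i - \<tau>)) \<le> \<epsilon>' * real N"
    using chirp_sum_const_small[OF \<omega> \<epsilon>'(1)] by blast
  define N0 where "N0 = max N1 (nat \<lceil>2 * B / \<epsilon>\<rceil>)"
  show ?thesis
  proof (intro exI[of _ N0] allI impI)
    fix N n \<tau> assume "N \<ge> N0" and window: "in_window n \<tau> N"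
    then have N: "N \<ge> N0" "N > 0" and range: "\<And>i. i < n \<Longrightarrow> \<bar>real i - \<tau>\<bar> \<le> real N / 2"
      by (auto simp: in_window_def)
    define x where "x i = (real i - \<tau>) / real N" for i
    have x: "\<bar>x i\<bar> \<le> 1 / 2" if "i < n" for i
      using range[OF that] N by (simp add: x_def abs_divide field_simps)
    have "(\<Sum>i<n. chirp (\<omega> / real N) (real i - \<tau>) * Y (of_real (x i))) =
      (\<Sum>i<n. chirp (\<omega> / real N) (real i - \<tau>) * (Y (of_real (x i)) - Y 0)) +
      Y 0 * (\<Sum>i<n. chirp (\<omega> / real N) (real i - \<tau>))"
      unfolding sum_distrib_left sum.distrib [symmetric] by (simp add: algebra_simps)
    also have "(\<Sum>i<n. chirp (\<omega> / real N) (real i - \<tau>) * (Y (of_real (x i)) - Y 0)) =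
      (\<Sum>i<n. chirp (\<omega> / real N) (real i - \<tau>) *
         (of_real (sin (\<omega> * x i)) * U (of_real (x i))))"
      by (intro sum.cong refl) (simp only: U(2)[OF x] lessThan_iff)
    also have "norm (\<dots> + Y 0 * (\<Sum>i<n. chirp (\<omega> / real N) (real i - \<tau>))) \<le>
       B + norm (Y 0) * (\<epsilon>' * real N)"
      unfolding x_def
      by (intro order.trans[OF norm_triangle_ineq] add_mono B[OF window])
         (use N in \<open>auto simp: norm_mult N0_def intro!: mult_left_mono N1 window\<close>)
    also have "\<dots> \<le> \<epsilon> * real N / 2 + \<epsilon> / 2 * real N"
    proof (intro add_mono)
      have "2 * B / \<epsilon> \<le> real N" using N(1) unfolding N0_def by linarith
      then show "B \<le> \<epsilon> * real N / 2" using \<open>\<epsilon> > 0\<close> by (simp add: divide_le_eq mult.commute)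
      show "norm (Y 0) * (\<epsilon>' * real N) \<le> \<epsilon> / 2 * real N"
        unfolding mult.assoc [symmetric] using \<epsilon>' by (intro mult_right_mono) auto
    qed
    finally show "norm (\<Sum>i<n. chirp (\<omega> / real N) (real i - \<tau>) * Y (of_real ((real i - \<tau>) / real N))) \<le> \<epsilon> * real N"
      by (simp add: x_def)
  qed
qed

subsection \<open>Torus knots at imaginary arguments\<close>

definition jones_chirp_sum :: "real \<Rightarrow> nat \<Rightarrow> (complex \<Rightarrow> complex) \<Rightarrow> complex" where
  "jones_chirp_sum \<omega> N Y =
     (\<Sum>i<N. chirp (\<omega> / real N) (jones_index N i) * Y (of_real (jones_index N i / real N)))"

lemma norm_jones_index: "i < N \<Longrightarrow> \<bar>jones_index N i\<bar> \<le> real N / 2"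
  by (auto simp: abs_le_iff field_simps)

lemma abs_divide_le_half: "\<bar>k\<bar> \<le> d / 2 \<Longrightarrow> d > 0 \<Longrightarrow> \<bar>k / d\<bar> \<le> 1 / 2" for k d :: real
  by (simp add: abs_divide divide_le_eq)

lemma jones_chirp_sum_over_N:
  assumes "\<omega> \<noteq> 0" "\<bar>\<omega>\<bar> < 2 * pi" and "Y analytic_on unit_segment"
  shows "(\<lambda>N. jones_chirp_sum \<omega> N Y / of_nat N) \<longlonglongrightarrow> 0"
proof (rule LIMSEQ_I)
  fix r :: real assume "r > 0"
  obtain N0 where N0: "\<And>N n \<tau>. N \<ge> N0 \<Longrightarrow> in_window n \<tau> N \<Longrightarrow>
    norm (\<Sum>i<n. chirp (\<omega> / real N) (real i - \<tau>) * Y (of_real ((real i - \<tau>) / real N))) \<le> r / 2 * real N"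
    using chirp_sum_small[OF assms, of "r / 2"] \<open>r > 0\<close> by auto
  have "norm (jones_chirp_sum \<omega> N Y / of_nat N - 0) < r" if "N \<ge> max N0 1" for N
  proof -
    have "norm (jones_chirp_sum \<omega> N Y) \<le> r / 2 * real N"
      unfolding jones_chirp_sum_def using that
      by (intro N0) (auto simp: in_window_def abs_le_iff field_simps)
    then have "norm (jones_chirp_sum \<omega> N Y / of_nat N) \<le> r / 2"
      using that by (simp add: norm_divide divide_le_eq)
    then show ?thesis using \<open>r > 0\<close> by simp
  qed
  then show "\<exists>no. \<forall>n\<ge>no. norm (jones_chirp_sum \<omega> n Y / of_nat n - 0) < r" by blast
qed

lemma norm_jones_chirp_sum_le:
  assumes "Y analytic_on unit_segment"
  shows "\<exists>B. \<forall>N>0. norm (jones_chirp_sum \<omega> N Y) \<le> B * real N"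
proof -
  obtain B where "segment_bound Y B" using analytic_on_unit_segment_bound[OF assms] by blast
  note B = segment_boundD(2)[OF this]
  show ?thesis
  proof (intro exI[of _ B] allI impI)
    fix N :: nat assume N: "N > 0"
    have "norm (jones_chirp_sum \<omega> N Y) \<le> (\<Sum>i<N. B)"
      unfolding jones_chirp_sum_def
    proof (rule sum_norm_le)
      fix i assume "i \<in> {..<N}"
      then have "\<bar>jones_index N i / real N\<bar> \<le> 1 / 2"
        using N by (intro abs_divide_le_half norm_jones_index) auto
      then show "norm (chirp (\<omega> / real N) (jones_index N i) * Y (of_real (jones_index N i / real N))) \<le> B"
        unfolding norm_mult norm_chirp mult_1 by (rule B)
    qed
    then show "norm (jones_chirp_sum \<omega> N Y) \<le> B * real N" by (simp add: mult.commute)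
  qed
qed

lemma norm_cis_minus_1: "norm (cis x - 1) \<le> \<bar>x\<bar>"
proof -
  have "norm (cis x - 1) = 2 * \<bar>sin (x / 2)\<bar>"
    using dist_exp_i_1[of x] by (simp add: cis_conv_exp mult.commute)
  also have "\<bar>sin (x / 2)\<bar> \<le> \<bar>x / 2\<bar>" by (rule abs_sin_x_le_abs_x)
  finally show ?thesis by simp
qed

text \<open>The difference of hyperbolic cosines in \<open>torus_sum_symmetric\<close> at h = i
  \<theta> / N, with both exponential factors replaced by 1 and k/N by z.
  \<open>torus_weight_of_real\<close> displays its double zero at the stationary point.\<close>

definition torus_weight :: "nat \<Rightarrow> nat \<Rightarrow> real \<Rightarrow> complex \<Rightarrow> complex" where
  "torus_weight a b \<theta> z =
     cos (of_real (\<theta> * (real a + real b)) * z) - cos (of_real (\<theta> * (real a - real b)) * z)"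

lemma cosh_imaginary: "cosh (of_real x * of_real y * (\<i> * of_real t / of_nat N)) = cos (of_real (t * x) * of_real (y / real N))"
  for x y t :: real
proof -
  have "of_real x * of_real y * (\<i> * of_real t / of_nat N) = \<i> * (of_real (t * x) * complex_of_real (y / real N))"
    by simp
  then show ?thesis by (simp only: cosh_conv_cos) (simp add: mult.assoc [symmetric])
qed

text \<open>The factors exp (h/2) and exp (- (h/2)) are written as 1 plus a term of size 1/N. The
  two 1s combine to \<open>torus_weight\<close>; the rest are corrections.\<close>

lemma torus_jones_imaginary:
  fixes a b N :: nat and \<theta> :: real
  assumes N: "N > 0" and \<theta>: "sin (\<theta> / 2) \<noteq> 0"
  defines "\<omega> \<equiv> \<theta> * (real a * real b)"
  defines "C1 \<equiv> (\<lambda>z. cos (of_real (\<theta> * (real a + real b)) * z))"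
    and "C2 \<equiv> (\<lambda>z. cos (of_real (\<theta> * (real a - real b)) * z))"
  shows "torus_jones a b N (\<i> * of_real \<theta> / of_nat N) =
    cis (- (\<omega> * real N / 4)) * cis (\<omega> / (4 * real N)) / (2 * \<i> * of_real (sin (\<theta> / 2))) *
    (jones_chirp_sum \<omega> N (torus_weight a b \<theta>) +
     (cis (\<theta> / (2 * real N)) - 1) * jones_chirp_sum \<omega> N C1 -
     (cis (- (\<theta> / (2 * real N))) - 1) * jones_chirp_sum \<omega> N C2)"
proof -
  define h where "h = \<i> * of_real \<theta> / complex_of_nat N"
  have sinh: "sinh (of_nat N / 2 * h) = \<i> * of_real (sin (\<theta> / 2))"
  proof -
    have "of_nat N / 2 * h = \<i> * of_real (\<theta> / 2)" using N by (simp add: h_def)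
    then show ?thesis by (simp only: sinh_conv_sin) (simp flip: sin_of_real)
  qed
  have e1: "exp (- (of_nat a * of_nat b * (of_nat N ^ 2 - 1) / 4) * h) =
    cis (- (\<omega> * real N / 4)) * cis (\<omega> / (4 * real N))"
  proof -
    have "- (of_nat a * of_nat b * (of_nat N ^ 2 - 1) / 4) * h =
       \<i> * of_real (- (\<omega> * real N / 4) + \<omega> / (4 * real N))"
      using N by (simp add: h_def \<omega>_def field_simps power2_eq_square)
    then show ?thesis unfolding cis_mult by (simp only: cis_conv_exp)
  qed
  have e2: "exp (of_nat a * of_nat b * complex_of_real k ^ 2 * h) = chirp (\<omega> / real N) k" for k
  proof -
    have "of_nat a * of_nat b * complex_of_real k ^ 2 * h = \<i> * of_real (\<omega> / real N * k\<^sup>2)"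
      by (simp add: h_def \<omega>_def)
    then show ?thesis by (simp only: chirp_def cis_conv_exp)
  qed
  have e3: "exp (h / 2) = cis (\<theta> / (2 * real N))" "exp (- (h / 2)) = cis (- (\<theta> / (2 * real N)))"
    by (simp_all add: h_def cis_conv_exp mult.commute)
  have c: "cosh ((of_nat a + of_nat b) * of_real k * h) = C1 (of_real (k / real N))"
    "cosh ((of_nat a - of_nat b) * of_real k * h) = C2 (of_real (k / real N))" for k
    using cosh_imaginary[of "real a + real b" k \<theta> N] cosh_imaginary[of "real a - real b" k \<theta> N]
    by (simp_all add: C1_def C2_def h_def)
  have weight: "torus_weight a b \<theta> z = C1 z - C2 z" for z
    by (simp add: torus_weight_def C1_def C2_def)
  have sum: "torus_sum a b N h = jones_chirp_sum \<omega> N (torus_weight a b \<theta>) +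
     (cis (\<theta> / (2 * real N)) - 1) * jones_chirp_sum \<omega> N C1 -
     (cis (- (\<theta> / (2 * real N))) - 1) * jones_chirp_sum \<omega> N C2"
    unfolding torus_sum_symmetric Let_def e2 e3 c jones_chirp_sum_def sum_distrib_left
      sum.distrib [symmetric] sum_subtractf [symmetric]
    unfolding weight by (intro sum.cong refl) (simp only: algebra_simps mult_1)
  have "torus_jones a b N h = cis (- (\<omega> * real N / 4)) * cis (\<omega> / (4 * real N)) *
     torus_sum a b N h / (2 * (\<i> * of_real (sin (\<theta> / 2))))"
    using \<theta> by (subst torus_jones_eq) (simp_all only: sinh e1, simp_all)
  then show ?thesis unfolding sum unfolding h_def by (simp add: mult.assoc)
qed

text \<open>Summation by parts leaves boundary values of U and a chirp sum R over the increments of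
  U. The increments are U'/N up to O(1/N^2), so R is, up to O(1/N), 1/N times a sum of size
  o(N).\<close>

lemma jones_chirp_sum_divisible_tendsto:
  assumes \<omega>: "\<omega> \<noteq> 0" "\<bar>\<omega>\<bar> < 2 * pi" and U: "U analytic_on unit_segment"
    and W: "\<And>x. \<bar>x\<bar> \<le> 1 / 2 \<Longrightarrow> W (of_real x) = of_real (sin (\<omega> * x)) * U (of_real x)"
  shows "(\<lambda>N. cis (- (\<omega> * real N / 4)) * jones_chirp_sum \<omega> N W) \<longlonglongrightarrow> (U (1 / 2) - U (- (1 / 2))) / (2 * \<i>)"
proof -
  obtain B where "segment_bound U B" using analytic_on_unit_segment_bound[OF U] by blast
  note B = segment_boundD[OF this]
  define R where "R N = (\<Sum>i<N - 1. chirp (\<omega> / real N) (real i - (real N / 2 - 1)) *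
     (U (of_real ((real i - (real N / 2 - 1) + 1 / 2) / real N)) -
      U (of_real ((real i - (real N / 2 - 1) - 1 / 2) / real N))))" for N
  have R: "R \<longlonglongrightarrow> 0"
  proof (rule LIMSEQ_I)
    fix r :: real assume "r > 0"
    have "deriv U analytic_on unit_segment" using U by (rule analytic_deriv)
    then obtain N0 where N0: "\<And>N n \<tau>. N \<ge> N0 \<Longrightarrow> in_window n \<tau> N \<Longrightarrow>
      norm (\<Sum>i<n. chirp (\<omega> / real N) (real i - \<tau>) * deriv U (of_real ((real i - \<tau>) / real N))) \<le> r / 2 * real N"
      using chirp_sum_small[OF \<omega>, of "deriv U" "r / 2"] \<open>r > 0\<close> by auto
    define N1 where "N1 = max (max N0 1) (nat \<lceil>B / r\<rceil> + 1)"
    have "norm (R N - 0) < r" if "N \<ge> N1" for N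
    proof -
      have N: "N \<ge> N0" "N > 0" "B / r < real N"
        using that unfolding N1_def by linarith+
      define l where "l i = real i - (real N / 2 - 1)" for i
      define D where "D i = U (of_real ((l i + 1 / 2) / real N)) - U (of_real ((l i - 1 / 2) / real N))" for i
      have window: "in_window (N - 1) (real N / 2 - 1) N"
        using N(2) by (auto simp: in_window_def abs_le_iff of_nat_diff field_simps)
      have D: "norm (D i - deriv U (of_real (l i / real N)) / of_nat N) \<le> B / (2 * (real N)\<^sup>2)" if "i < N - 1" for i
      proof -
        let ?x = "l i / real N" and ?p = "(l i + 1 / 2) / real N" and ?m = "(l i - 1 / 2) / real N"
        have "real i + 2 \<le> real N" using that by linarith
        then have "\<bar>l i\<bar> \<le> real N / 2" "\<bar>l i + 1 / 2\<bar> \<le> real N / 2" "\<bar>l i - 1 / 2\<bar> \<le> real N / 2"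
          unfolding l_def by linarith+
        then have le: "\<bar>?x\<bar> \<le> 1 / 2" "\<bar>?p\<bar> \<le> 1 / 2" "\<bar>?m\<bar> \<le> 1 / 2"
          using N(2) by (simp_all only: abs_divide_le_half of_nat_0_less_iff)
        have diff: "?p - ?x = 1 / (2 * real N)" "?m - ?x = - (1 / (2 * real N))"
          by (simp_all add: diff_divide_distrib [symmetric] add_divide_distrib)
        have "D i - deriv U (of_real ?x) / of_nat N =
          (U (of_real ?p) - U (of_real ?x) - deriv U (of_real ?x) * of_real (?p - ?x)) -
          (U (of_real ?m) - U (of_real ?x) - deriv U (of_real ?x) * of_real (?m - ?x))"
          unfolding D_def diff by (simp add: field_simps)
        also have "norm \<dots> \<le> B * (?p - ?x)\<^sup>2 + B * (?m - ?x)\<^sup>2"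
          by (intro order.trans[OF norm_triangle_ineq4] add_mono B(4) le)
        also have "\<dots> = B / (2 * (real N)\<^sup>2)"
          unfolding diff using N(2) by (simp add: power_divide field_simps)
        finally show ?thesis .
      qed
      have "R N = (\<Sum>i<N - 1. chirp (\<omega> / real N) (l i) * (D i - deriv U (of_real (l i / real N)) / of_nat N)) +
        (\<Sum>i<N - 1. chirp (\<omega> / real N) (l i) * deriv U (of_real (l i / real N))) / of_nat N"
        unfolding R_def l_def [symmetric] D_def [symmetric] sum_divide_distrib sum.distrib [symmetric]
        by (intro sum.cong refl) (simp add: right_diff_distrib)
      also have "norm \<dots> \<le> real (N - 1) * (B / (2 * (real N)\<^sup>2)) + r / 2"
      proof (intro order.trans[OF norm_triangle_ineq] add_mono)
        have "norm (\<Sum>i<N - 1. chirp (\<omega> / real N) (l i) * (D i - deriv U (of_real (l i / real N)) / of_nat N)) \<le>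
          (\<Sum>i<N - 1. B / (2 * (real N)\<^sup>2))"
          by (rule sum_norm_le) (simp only: norm_mult norm_chirp mult_1 D lessThan_iff)
        then show "norm (\<Sum>i<N - 1. chirp (\<omega> / real N) (l i) * (D i - deriv U (of_real (l i / real N)) / of_nat N)) \<le>
          real (N - 1) * (B / (2 * (real N)\<^sup>2))" by simp
        have "norm (\<Sum>i<N - 1. chirp (\<omega> / real N) (l i) * deriv U (of_real (l i / real N))) \<le> r / 2 * real N"
          unfolding l_def by (rule N0[OF N(1) window])
        then show "norm ((\<Sum>i<N - 1. chirp (\<omega> / real N) (l i) * deriv U (of_real (l i / real N))) / of_nat N) \<le> r / 2"
          using N(2) by (simp add: norm_divide divide_le_eq)
      qed
      also have "real (N - 1) * (B / (2 * (real N)\<^sup>2)) \<le> real N * (B / (2 * (real N)\<^sup>2))"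
        using B(1) by (intro mult_right_mono) auto
      also have "real N * (B / (2 * (real N)\<^sup>2)) = B / real N / 2"
        using N(2) by (simp add: power2_eq_square)
      also have "B / real N < r" using N(2,3) \<open>r > 0\<close> by (simp add: divide_less_eq mult.commute)
      finally show ?thesis by simp
    qed
    then show "\<exists>no. \<forall>n\<ge>no. norm (R n - 0) < r" by blast
  qed
  define v where "v N = U (of_real ((real N - 1) / (2 * real N))) - U (of_real (- ((real N - 1) / (2 * real N))))" for N
  have ends: "(\<lambda>N. (real N - 1) / (2 * real N)) \<longlonglongrightarrow> 1 / 2"
    by real_asymp
  have v: "v \<longlonglongrightarrow> U (1 / 2) - U (- (1 / 2))"
  proof -
    have cont: "isCont U (of_real x)" if "\<bar>x\<bar> \<le> 1 / 2" for x
      using U of_real_in_unit_segment[OF that] by (intro analytic_at_imp_isCont) (auto intro: analytic_on_subset)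
    have "(\<lambda>N. U (of_real ((real N - 1) / (2 * real N)))) \<longlonglongrightarrow> U (of_real (1 / 2))"
      by (intro isCont_tendsto_compose[OF cont] tendsto_of_real ends) auto
    moreover have "(\<lambda>N. U (of_real (- ((real N - 1) / (2 * real N))))) \<longlonglongrightarrow> U (of_real (- (1 / 2)))"
      by (intro isCont_tendsto_compose[OF cont] tendsto_of_real tendsto_minus ends) auto
    ultimately show ?thesis unfolding v_def by (auto intro: tendsto_diff)
  qed
  have small: "(\<lambda>N. cis (- (\<omega> * real N / 4)) * R N) \<longlonglongrightarrow> 0"
    using R by (intro tendsto_norm_zero_cancel[of "\<lambda>N. cis (- (\<omega> * real N / 4)) * R N"])
      (simp add: norm_mult tendsto_norm_zero)
  have "(\<lambda>N. (v N - cis (- (\<omega> * real N / 4)) * R N) / (cis (\<omega> / (4 * real N)) * (2 * \<i>)))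
    \<longlonglongrightarrow> ((U (1 / 2) - U (- (1 / 2))) - 0) / (cis 0 * (2 * \<i>))"
  proof (intro tendsto_divide tendsto_diff tendsto_mult v small tendsto_const)
    have "(\<lambda>N. \<omega> / (4 * real N)) \<longlonglongrightarrow> 0" by real_asymp
    then show "(\<lambda>N. cis (\<omega> / (4 * real N))) \<longlonglongrightarrow> cis 0"
      unfolding cis_conv_exp by (intro tendsto_intros)
  qed auto
  then have "(\<lambda>N. (v N - cis (- (\<omega> * real N / 4)) * R N) / (cis (\<omega> / (4 * real N)) * (2 * \<i>)))
    \<longlonglongrightarrow> (U (1 / 2) - U (- (1 / 2))) / (2 * \<i>)" by simp
  then show ?thesis
  proof (rule Lim_transform_eventually)
    show "eventually (\<lambda>N. (v N - cis (- (\<omega> * real N / 4)) * R N) / (cis (\<omega> / (4 * real N)) * (2 * \<i>)) =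
      cis (- (\<omega> * real N / 4)) * jones_chirp_sum \<omega> N W) sequentially"
      using eventually_gt_at_top[of 0]
    proof eventually_elim
      case (elim N)
      then obtain n where n: "N = Suc n" by (cases N) auto
      define \<kappa> where "\<kappa> = \<omega> / real N"
      define u where "u i = U (of_real (jones_index N i / real N))" for i
      have S: "jones_chirp_sum \<omega> N W = (\<Sum>i<Suc n. chirp \<kappa> (jones_index N i) *
         of_real (sin (\<kappa> * jones_index N i)) * u i)"
        unfolding jones_chirp_sum_def n [symmetric]
      proof (intro sum.cong refl)
        fix i assume "i \<in> {..<N}"
        then have "\<bar>jones_index N i / real N\<bar> \<le> 1 / 2"
          using elim by (intro abs_divide_le_half norm_jones_index) auto
        from W[OF this] show "chirp (\<omega> / real N) (jones_index N i) * W (of_real (jones_index N i / real N)) =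
          chirp \<kappa> (jones_index N i) * of_real (sin (\<kappa> * jones_index N i)) * u i"
          by (simp only: \<kappa>_def u_def mult.assoc times_divide_eq_left times_divide_eq_right)
      qed
      have ends: "real n + 1 / 2 - (real N - 1) / 2 = real N / 2" "- 1 / 2 - (real N - 1) / 2 = - (real N / 2)"
        by (simp_all add: n field_simps)
      \<comment> \<open>Both ends carry the same phase because the chirp is even. The prefactor
        cancels it, which leaves U (1/2) - U (- (1/2)) in the limit.\<close>
      have chirp_ends: "chirp \<kappa> (real N / 2) = cis (\<omega> * real N / 4)" "chirp \<kappa> (- (real N / 2)) = cis (\<omega> * real N / 4)"
        using elim by (simp_all add: chirp_def \<kappa>_def power2_eq_square field_simps)
      have "u n - u 0 = v N"
      proof -
        have "jones_index N n / real N = (real N - 1) / (2 * real N)"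
          "jones_index N 0 / real N = - ((real N - 1) / (2 * real N))"
          using elim by (simp_all add: n field_simps)
        then show ?thesis unfolding u_def v_def by (simp only:)
      qed
      have "(\<Sum>i<n. chirp \<kappa> (real i + 1 / 2 - (real N - 1) / 2) * (u (Suc i) - u i)) = R N"
      proof -
        have "real i + 1 / 2 - (real N - 1) / 2 = real i - (real N / 2 - 1)"
          "jones_index N (Suc i) = real i - (real N / 2 - 1) + 1 / 2"
          "jones_index N i = real i - (real N / 2 - 1) - 1 / 2" for i
          by (simp_all add: field_simps)
        then show ?thesis unfolding R_def u_def \<kappa>_def by (simp only: n diff_Suc_1)
      qed
      then have main: "cis (\<kappa> / 4) * (2 * \<i>) * jones_chirp_sum \<omega> N W = cis (\<omega> * real N / 4) * v N - R N"
        unfolding S chirp_sum_by_parts ends chirp_ends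
        by (simp only: \<open>u n - u 0 = v N\<close> [symmetric] right_diff_distrib)
      have "\<kappa> / 4 = \<omega> / (4 * real N)" by (simp add: \<kappa>_def)
      then have "cis (\<omega> / (4 * real N)) * (2 * \<i>) * (cis (- (\<omega> * real N / 4)) * jones_chirp_sum \<omega> N W) =
        cis (- (\<omega> * real N / 4)) * (cis (\<kappa> / 4) * (2 * \<i>) * jones_chirp_sum \<omega> N W)"
        by (simp only: mult_ac)
      also have "\<dots> = cis (- (\<omega> * real N / 4)) * (cis (\<omega> * real N / 4) * v N - R N)"
        by (simp only: main)
      also have "\<dots> = v N - cis (- (\<omega> * real N / 4)) * R N"
        by (simp add: right_diff_distrib cis_mult flip: mult.assoc)
      finally show ?case
        by (subst eq_commute, subst nonzero_eq_divide_eq) (simp_all add: mult_ac)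
    qed
  qed
qed

lemma torus_weight_analytic: "torus_weight a b \<theta> analytic_on A"
  unfolding torus_weight_def by (auto intro!: analytic_intros analytic_on_cos)

lemma torus_weight_of_real:
  "torus_weight a b \<theta> (of_real x) = of_real (- 2 * sin (\<theta> * real a * x) * sin (\<theta> * real b * x))"
proof -
  have "cos (\<theta> * (real a + real b) * x) - cos (\<theta> * (real a - real b) * x) =
     - 2 * sin (\<theta> * real a * x) * sin (\<theta> * real b * x)"
    by (simp add: distrib_left distrib_right left_diff_distrib right_diff_distrib cos_add cos_diff)
  then show ?thesis
    by (simp only: torus_weight_def of_real_mult [symmetric] cos_of_real of_real_diff [symmetric])
qed

lemma cis_tendsto_1: "(\<lambda>N. cis (x / (d * real N))) \<longlonglongrightarrow> 1"
proof -
  have "(\<lambda>N. x / d * inverse (real N)) \<longlonglongrightarrow> 0"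
    by (intro tendsto_mult_right_zero lim_inverse_n)
  then have "(\<lambda>N. x / (d * real N)) \<longlonglongrightarrow> 0" by (simp add: divide_inverse mult.assoc)
  then have "(\<lambda>N. cis (x / (d * real N))) \<longlonglongrightarrow> cis 0"
    unfolding cis_conv_exp by (intro tendsto_intros)
  then show ?thesis by simp
qed

text \<open>The weight is divisible by sin (\<omega> x), so its sum tends to a boundary term; the
  quotient takes opposite values at the two ends, and they combine to the reciprocal of Delta. The
  corrections are O(1/N) times o(N).\<close>

lemma torus_jones_imaginary_tendsto:
  fixes a b :: nat and \<theta> :: real
  assumes ab: "a > 0" "b > 0" and \<theta>: "\<theta> \<noteq> 0" "\<bar>\<theta>\<bar> * (real a * real b) < 2 * pi"
  shows "(\<lambda>N. torus_jones a b N (\<i> * of_real \<theta> / of_nat N)) \<longlonglongrightarrow>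
    of_real (sin (\<theta> * real a / 2) * sin (\<theta> * real b / 2) / (sin (\<theta> * (real a * real b) / 2) * sin (\<theta> / 2)))"
proof -
  define \<omega> where "\<omega> = \<theta> * (real a * real b)"
  have \<omega>: "\<omega> \<noteq> 0" "\<bar>\<omega>\<bar> < 2 * pi" using ab \<theta> by (auto simp: \<omega>_def abs_mult)
  have ab1: "real a * real b \<ge> 1" using ab by (metis One_nat_def Suc_leI mult_pos_pos of_nat_1 of_nat_le_iff of_nat_mult)
  have sin\<theta>: "sin (\<theta> / 2) \<noteq> 0"
  proof
    assume "sin (\<theta> / 2) = 0"
    moreover have "\<bar>\<theta>\<bar> * 1 \<le> \<bar>\<theta>\<bar> * (real a * real b)" using ab1 by (intro mult_left_mono) auto
    moreover from this have "\<bar>\<theta>\<bar> < 2 * pi" using \<theta>(2) by linarith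
    ultimately show False using sin_scaled_eq_0[of \<theta> "1 / 2"] \<theta>(1) by simp
  qed
  define W where "W = torus_weight a b \<theta>"
  have W: "W analytic_on unit_segment" unfolding W_def by (rule torus_weight_analytic)
  have "W (of_real x) = 0" if "\<bar>x\<bar> \<le> 1 / 2" "sin (\<omega> * x) = 0" for x
    using sin_scaled_eq_0[OF \<omega> that] by (simp add: W_def torus_weight_def)
  then obtain U where U: "U analytic_on unit_segment"
    "\<And>x. \<bar>x\<bar> \<le> 1 / 2 \<Longrightarrow> W (of_real x) = of_real (sin (\<omega> * x)) * U (of_real x)"
    using analytic_divide_sin[OF W \<omega>(1)] by blast
  note main = jones_chirp_sum_divisible_tendsto[OF \<omega> U]
  define C1 C2 :: "complex \<Rightarrow> complex"
    where "C1 = (\<lambda>z. cos (of_real (\<theta> * (real a + real b)) * z))"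
      and "C2 = (\<lambda>z. cos (of_real (\<theta> * (real a - real b)) * z))"
  have correction: "(\<lambda>N. cis (- (\<omega> * real N / 4)) * ((cis (x / (2 * real N)) - 1) * jones_chirp_sum \<omega> N C)) \<longlonglongrightarrow> 0"
    if C: "C analytic_on unit_segment" for C x
  proof -
    have "(\<lambda>N. \<bar>x\<bar> / 2 * norm (jones_chirp_sum \<omega> N C / of_nat N)) \<longlonglongrightarrow> \<bar>x\<bar> / 2 * norm (0::complex)"
      by (intro tendsto_intros jones_chirp_sum_over_N[OF \<omega> C])
    then have lim: "(\<lambda>N. \<bar>x\<bar> / 2 * norm (jones_chirp_sum \<omega> N C / of_nat N)) \<longlonglongrightarrow> 0" by simp
    have "eventually (\<lambda>N. norm (cis (- (\<omega> * real N / 4)) * ((cis (x / (2 * real N)) - 1) * jones_chirp_sum \<omega> N C)) \<le>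
       \<bar>x\<bar> / 2 * norm (jones_chirp_sum \<omega> N C / of_nat N)) sequentially"
      using eventually_gt_at_top[of 0]
    proof eventually_elim
      case (elim N)
      have "norm (cis (x / (2 * real N)) - 1) * norm (jones_chirp_sum \<omega> N C) \<le>
          \<bar>x / (2 * real N)\<bar> * norm (jones_chirp_sum \<omega> N C)"
        by (intro mult_right_mono norm_cis_minus_1) auto
      then show ?case using elim by (simp add: norm_mult norm_divide abs_mult abs_divide)
    qed
    then show ?thesis using lim by (rule Lim_null_comparison)
  qed
  have C: "C1 analytic_on unit_segment" "C2 analytic_on unit_segment"
    unfolding C1_def C2_def by (auto intro!: analytic_intros analytic_on_cos)
  have half: "U (1 / 2) - U (- (1 / 2)) = of_real (- 4 * (sin (\<theta> * real a / 2) * sin (\<theta> * real b / 2)) / sin (\<omega> / 2))"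
  proof -
    have s: "sin (\<omega> / 2) \<noteq> 0" using sin_scaled_eq_0[OF \<omega>, of "1 / 2"] by auto
    have U_eq: "U (of_real x) = of_real (- 2 * sin (\<theta> * real a * x) * sin (\<theta> * real b * x) / sin (\<omega> * x))"
      if "\<bar>x\<bar> \<le> 1 / 2" "sin (\<omega> * x) \<noteq> 0" for x
      using U(2)[OF that(1)] that(2) unfolding W_def torus_weight_of_real
      by (simp only: of_real_divide nonzero_eq_divide_eq[of "of_real (sin (\<omega> * x))"] of_real_eq_0_iff not_False_eq_True mult.commute)
    have "U (1 / 2) = of_real (- 2 * sin (\<theta> * real a / 2) * sin (\<theta> * real b / 2) / sin (\<omega> / 2))"
      using U_eq[of "1 / 2"] s by simp
    moreover have "U (- (1 / 2)) = of_real (2 * sin (\<theta> * real a / 2) * sin (\<theta> * real b / 2) / sin (\<omega> / 2))"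
      using U_eq[of "- (1 / 2)"] s by simp
    ultimately show ?thesis by simp
  qed
  have "(\<lambda>N. cis (\<omega> / (4 * real N)) / (2 * \<i> * of_real (sin (\<theta> / 2))) *
      (cis (- (\<omega> * real N / 4)) * jones_chirp_sum \<omega> N W +
       cis (- (\<omega> * real N / 4)) * ((cis (\<theta> / (2 * real N)) - 1) * jones_chirp_sum \<omega> N C1) -
       cis (- (\<omega> * real N / 4)) * ((cis ((- \<theta>) / (2 * real N)) - 1) * jones_chirp_sum \<omega> N C2)))
    \<longlonglongrightarrow> 1 / (2 * \<i> * of_real (sin (\<theta> / 2))) * ((U (1 / 2) - U (- (1 / 2))) / (2 * \<i>) + 0 - 0)"
    by (intro tendsto_mult tendsto_divide tendsto_diff tendsto_add tendsto_const main correction C cis_tendsto_1)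
       (use sin\<theta> in auto)
  also have "1 / (2 * \<i> * of_real (sin (\<theta> / 2))) * ((U (1 / 2) - U (- (1 / 2))) / (2 * \<i>) + 0 - 0) =
    of_real (sin (\<theta> * real a / 2) * sin (\<theta> * real b / 2) / (sin (\<theta> * (real a * real b) / 2) * sin (\<theta> / 2)))"
    unfolding half \<omega>_def by (simp add: field_simps)
  finally show ?thesis
  proof (rule Lim_transform_eventually)
    show "eventually (\<lambda>N. cis (\<omega> / (4 * real N)) / (2 * \<i> * of_real (sin (\<theta> / 2))) *
      (cis (- (\<omega> * real N / 4)) * jones_chirp_sum \<omega> N W +
       cis (- (\<omega> * real N / 4)) * ((cis (\<theta> / (2 * real N)) - 1) * jones_chirp_sum \<omega> N C1) -
       cis (- (\<omega> * real N / 4)) * ((cis ((- \<theta>) / (2 * real N)) - 1) * jones_chirp_sum \<omega> N C2)) =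
      torus_jones a b N (\<i> * of_real \<theta> / of_nat N)) sequentially"
      using eventually_gt_at_top[of 0]
    proof eventually_elim
      case (elim N)
      show ?case
        unfolding torus_jones_imaginary[OF elim sin\<theta>] \<omega>_def [symmetric] W_def C1_def C2_def
          minus_divide_left by (simp add: algebra_simps)
    qed
  qed
qed

subsection \<open>Quadratic Gauss sums\<close>

definition gauss_term :: "nat \<Rightarrow> nat \<Rightarrow> complex" where
  "gauss_term N j = cis (pi * (real j)\<^sup>2 / (2 * real N))"

definition gauss_sum :: "nat \<Rightarrow> complex" where
  "gauss_sum N = (\<Sum>j<2 * N. gauss_term N j)"

lemma cis_2pi_int [simp]: "cis (2 * pi * of_int n) = 1"
  by (rule cis_multiple_2pi) simp

lemma gauss_term_periodic: "N > 0 \<Longrightarrow> gauss_term N (j + 2 * N) = gauss_term N j"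
proof -
  assume "N > 0"
  then have "pi * (real (j + 2 * N))\<^sup>2 / (2 * real N) =
      pi * (real j)\<^sup>2 / (2 * real N) + 2 * pi * of_int (int (j + N))"
    by (simp add: power2_eq_square field_simps)
  then show ?thesis
    unfolding gauss_term_def by (simp only: cis_mult [symmetric] cis_2pi_int mult_1_right)
qed

lemma gauss_term_reflect: "j \<le> 2 * N \<Longrightarrow> N > 0 \<Longrightarrow> gauss_term N (2 * N - j) = gauss_term N j"
proof -
  assume j: "j \<le> 2 * N" "N > 0"
  then have "pi * (real (2 * N - j))\<^sup>2 / (2 * real N) =
      pi * (real j)\<^sup>2 / (2 * real N) + 2 * pi * of_int (int N - int j)"
    by (simp add: of_nat_diff power2_eq_square field_simps)
  then show ?thesis
    unfolding gauss_term_def by (simp only: cis_mult [symmetric] cis_2pi_int mult_1_right)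
qed

lemma sum_periodic_shift:
  fixes f :: "nat \<Rightarrow> complex"
  assumes "\<And>j. f (j + m) = f j"
  shows "(\<Sum>j<m. f (l + j)) = (\<Sum>j<m. f j)"
proof (induction l)
  case (Suc l)
  have "(\<Sum>j<m. f (Suc l + j)) + f l = (\<Sum>j<Suc m. f (l + j))"
    by (subst sum.lessThan_Suc_shift) (simp add: add.commute)
  also have "\<dots> = (\<Sum>j<m. f (l + j)) + f l" by (simp add: assms)
  finally show ?case using Suc by simp
qed simp

text \<open>In the double sum for the squared modulus put j = l + d. The squares of l cancel, and
  the sum over l becomes geometric with ratio cis (pi d / N), a root of unity of order dividing 2 N
  that differs from 1 unless d = 0.\<close>

lemma norm_gauss_sum:
  assumes N: "N > 0"
  shows "(norm (gauss_sum N))\<^sup>2 = 2 * real N"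
proof -
  have corr: "gauss_term N (l + d) * cnj (gauss_term N l) = gauss_term N d * cis (pi * real d / real N) ^ l" for l d
  proof -
    have "pi * (real (l + d))\<^sup>2 / (2 * real N) + - (pi * (real l)\<^sup>2 / (2 * real N)) =
      pi * (real d)\<^sup>2 / (2 * real N) + real l * (pi * real d / real N)"
      using N by (simp add: power2_eq_square field_simps)
    then show ?thesis unfolding gauss_term_def cis_cnj Complex.DeMoivre cis_mult by (simp only:)
  qed
  have geo: "(\<Sum>l<2 * N. cis (pi * real d / real N) ^ l) = 0" if d: "0 < d" "d < 2 * N" for d
  proof -
    let ?w = "cis (pi * real d / real N)"
    have "?w ^ (2 * N) = cis (2 * pi * of_int (int d))"
      unfolding Complex.DeMoivre using N by (intro arg_cong[where f = cis]) (simp add: field_simps)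
    then have w: "?w ^ (2 * N) = 1" by (simp only: cis_2pi_int)
    have "?w \<noteq> 1"
    proof
      assume "?w = 1"
      then have "cos (pi * real d / real N) = 1" by (simp add: complex_eq_iff)
      then obtain k :: int where "pi * real d / real N = of_int k * 2 * pi"
        using cos_one_2pi_int by blast
      then have "real d = 2 * of_int k * real N" using N by (simp add: field_simps)
      then have "int d = 2 * k * int N" by (metis of_int_eq_iff of_int_mult of_int_numeral of_int_of_nat_eq)
      then have "0 < k * int N" "k * int N < 1 * int N" using d by linarith+
      then have "0 < k" "k < 1" using N zero_less_mult_pos2[of k "int N"] by auto
      then show False by simp
    qed
    then show ?thesis using w by (simp add: geometric_sum)
  qed
  have "of_real ((norm (gauss_sum N))\<^sup>2) = gauss_sum N * cnj (gauss_sum N)"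
    by (rule complex_norm_square)
  also have "\<dots> = (\<Sum>l<2 * N. \<Sum>j<2 * N. gauss_term N j * cnj (gauss_term N l))"
    unfolding gauss_sum_def cnj_sum sum_product by (rule sum.swap)
  also have "\<dots> = (\<Sum>l<2 * N. \<Sum>d<2 * N. gauss_term N (l + d) * cnj (gauss_term N l))"
    unfolding sum_distrib_right [symmetric]
    by (intro sum.cong refl arg_cong2[where f = times] sum_periodic_shift [symmetric] gauss_term_periodic N)
  also have "\<dots> = (\<Sum>d<2 * N. gauss_term N d * (\<Sum>l<2 * N. cis (pi * real d / real N) ^ l))"
    unfolding corr sum_distrib_left by (rule sum.swap)
  also have "\<dots> = (\<Sum>d\<in>{0}. gauss_term N d * (\<Sum>l<2 * N. cis (pi * real d / real N) ^ l))"
    by (rule sum.mono_neutral_right) (use N geo in auto)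
  also have "\<dots> = of_real (2 * real N)" by (simp add: gauss_term_def)
  finally show ?thesis by (simp only: of_real_eq_iff)
qed

text \<open>From sin y >= y - y^3 / 6 and y <= 2.\<close>

lemma third_le_sin:
  assumes "0 \<le> y" "y \<le> pi / 2"
  shows "y / 3 \<le> sin y"
proof -
  have y: "y \<le> 2" using assms pi_less_4 by linarith
  have "y * (y * y) \<le> y * (2 * 2)"
    using assms y by (intro mult_left_mono mult_mono) auto
  moreover have "\<bar>sin y - y\<bar> \<le> y * (y * y) / 6"
    using Maclaurin_sin_bound[of y 3] assms
    by (simp add: sin_coeff_def eval_nat_numeral fact_numeral)
  ultimately show ?thesis by linarith
qed

text \<open>Writing 1 as sin (\<kappa> j) times its reciprocal brings the sum under
  \<open>norm_chirp_sum_le\<close>. The reciprocal decreases on (0, pi/2], so its variation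
  telescopes and the sum is at most 2 / sin (\<kappa> n); \<open>third_le_sin\<close> and pi > 3
  turn this into 4 N / n.\<close>

lemma gauss_tail_bound:
  assumes n: "0 < n" "n \<le> N"
  shows "norm (\<Sum>j\<in>{n..<N}. gauss_term N j) \<le> 4 * real N / real n"
proof (cases "n = N")
  case False
  define \<kappa> where "\<kappa> = pi / (2 * real N)"
  define m where "m = N - n - 1"
  have N: "N = n + Suc m" using False n by (simp add: m_def)
  define u where "u i = 1 / sin (\<kappa> * (real i + real n))" for i
  have arg: "0 < \<kappa> * (real i + real n)" "\<kappa> * (real i + real n) \<le> pi / 2" if "i \<le> m" for i
  proof -
    show "0 < \<kappa> * (real i + real n)" unfolding \<kappa>_def using n by (intro mult_pos_pos divide_pos_pos) auto
    have "\<kappa> * (real i + real n) \<le> \<kappa> * real N" unfolding \<kappa>_def using that N by (intro mult_left_mono) auto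
    then show "\<kappa> * (real i + real n) \<le> pi / 2" unfolding \<kappa>_def using n by simp
  qed
  have sin_pos: "sin (\<kappa> * (real i + real n)) > 0" if "i \<le> m" for i
    using arg[OF that] by (intro sin_gt_zero) auto
  have u_pos: "0 < u i" if "i \<le> m" for i using sin_pos[OF that] by (simp add: u_def)
  have u_dec: "u (Suc i) \<le> u i" if "i < m" for i
  proof -
    have "sin (\<kappa> * (real i + real n)) \<le> sin (\<kappa> * (real (Suc i) + real n))"
    proof (subst sin_mono_le_eq)
      have "\<kappa> \<ge> 0" by (simp add: \<kappa>_def)
      then show "\<kappa> * (real i + real n) \<le> \<kappa> * (real (Suc i) + real n)" by (intro mult_left_mono) auto
    qed (use arg[of i] arg[of "Suc i"] that in auto)
    then show ?thesis unfolding u_def using sin_pos[of i] that by (intro divide_left_mono) auto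
  qed
  have "(\<Sum>j\<in>{n..<N}. gauss_term N j) = (\<Sum>i<Suc m. gauss_term N (i + n))"
  proof -
    have "{n..<N} = {0 + n..<Suc m + n}" by (simp add: N add.commute)
    then show ?thesis by (simp only: sum.shift_bounds_nat_ivl atLeast0LessThan)
  qed
  also have "\<dots> = (\<Sum>i<Suc m. chirp \<kappa> (real i - (- real n)) *
      of_real (sin (\<kappa> * (real i - (- real n)))) * of_real (u i))"
  proof (intro sum.cong refl)
    fix i assume "i \<in> {..<Suc m}"
    then have "sin (\<kappa> * (real i + real n)) \<noteq> 0" using sin_pos[of i] by auto
    then have "complex_of_real (sin (\<kappa> * (real i + real n)) * u i) = 1" by (simp add: u_def)
    moreover have "gauss_term N (i + n) = chirp \<kappa> (real i + real n)"
      by (simp add: gauss_term_def chirp_def \<kappa>_def)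
    ultimately show "gauss_term N (i + n) = chirp \<kappa> (real i - (- real n)) *
      of_real (sin (\<kappa> * (real i - (- real n)))) * of_real (u i)"
      by (simp only: diff_minus_eq_add mult.assoc of_real_mult [symmetric] mult_1_right)
  qed
  also have "norm \<dots> \<le> u 0 + (\<Sum>i<m. norm (complex_of_real (u (Suc i)) - of_real (u i))) / 2"
  proof (rule norm_chirp_sum_le)
    fix i assume i: "i \<le> m"
    have "u i \<le> u 0" using i
    proof (induction i)
      case (Suc i)
      then show ?case using u_dec[of i] by simp
    qed simp
    then show "norm (complex_of_real (u i)) \<le> u 0" using u_pos[OF i] by simp
  qed
  also have "(\<Sum>i<m. norm (complex_of_real (u (Suc i)) - of_real (u i))) = (\<Sum>i<m. u i - u (Suc i))"
    using u_dec by (intro sum.cong refl) (simp flip: of_real_diff add: norm_of_real)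
  also have "\<dots> = u 0 - u m" by (rule sum_lessThan_telescope')
  also have "u 0 + (u 0 - u m) / 2 \<le> 2 * u 0" using u_pos[of m] u_pos[of 0] by simp
  also have "2 * u 0 \<le> 2 * (1 / (\<kappa> * real n / 3))"
    unfolding u_def using arg[of 0] third_le_sin[of "\<kappa> * real n"] sin_pos[of 0] n
    by (intro mult_left_mono divide_left_mono mult_pos_pos) auto
  also have "\<dots> = 12 * real N / (pi * real n)" using n by (simp add: \<kappa>_def field_simps)
  also have "\<dots> \<le> 4 * real N / real n"
  proof -
    have "12 * real N * real n \<le> 4 * real N * (pi * real n)"
      using pi_gt3 by (simp add: mult_right_mono)
    then show ?thesis using n by (simp add: field_simps)
  qed
  finally show ?thesis .
qed simp

lemma sqrt_real_at_top: "filterlim (\<lambda>N. sqrt (real N)) at_top sequentially"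
  by (rule filterlim_compose[OF sqrt_at_top filterlim_real_sequentially])

text \<open>Half of the sum, j < N, is a Riemann sum on the scale sqrt N for the Fresnel integral of
  exp (i pi x^2 / 2); \<open>gauss_tail_bound\<close> makes the part beyond (M + 1) sqrt N at most 4
  / (M + 1) after scaling. The modulus from \<open>norm_gauss_sum\<close> passes to the limit and
  gives |2 l|^2 = 2.\<close>

lemma gauss_sum_growth:
  obtains g :: complex where "g \<noteq> 0" "(\<lambda>N. gauss_sum N / of_real (sqrt (real N))) \<longlonglongrightarrow> g"
proof -
  define s where "s N = sqrt (real N)" for N
  have s_top: "filterlim s at_top sequentially" unfolding s_def by (rule sqrt_real_at_top)
  have s_pos: "s N > 0" if "N > 0" for N using that by (simp add: s_def)
  have s2: "s N * s N = real N" for N by (simp add: s_def)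
  define n where "n M N = nat \<lceil>real (Suc M) * s N\<rceil>" for M N
  have n_lim: "(\<lambda>N. real (n M N) / s N) \<longlonglongrightarrow> real (Suc M)" for M
    unfolding n_def using s_top by (rule nat_ceiling_ratio_tendsto) simp
  have n_ge: "real (Suc M) * s N \<le> real (n M N)" for M N unfolding n_def by linarith
  have n_le: "eventually (\<lambda>N. n M N \<le> N) sequentially" for M
  proof -
    have "eventually (\<lambda>N. real (n M N) / s N < real (Suc M) + 1) sequentially"
      using order_tendstoD(2)[OF n_lim[of M], of "real (Suc M) + 1"] by simp
    moreover have "eventually (\<lambda>N. real (Suc M) + 1 < s N) sequentially"
      using s_top unfolding filterlim_at_top_dense by blast
    ultimately show ?thesis using eventually_gt_at_top[of 0]
    proof eventually_elim
      case (elim N)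
      then have "real (n M N) / s N < s N" by linarith
      then have "real (n M N) < real N" using s_pos[OF elim(3)] by (simp add: divide_less_eq s2)
      then show ?case by simp
    qed
  qed
  define f where "f z = exp (\<i> * of_real (pi / 2) * z\<^sup>2)" for z :: complex
  have "f holomorphic_on UNIV" unfolding f_def by (intro holomorphic_intros)
  then obtain F where F: "\<And>z. (F has_field_derivative f z) (at z)"
    using entire_primitive by blast
  define X where "X M = F (of_real (real (Suc M))) - F 0" for M
  define h where "h M N = (\<Sum>j<n M N. f (of_real (real j / s N))) / of_real (s N)" for M N
  have head: "h M \<longlonglongrightarrow> X M" for M
    unfolding h_def X_def by (rule riemann_sum_tendsto[OF F s_top n_lim])
  have f_eq: "f (of_real (real j / s N)) = gauss_term N j" if "N > 0" for j N
  proof -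
    have "\<i> * of_real (pi / 2) * (complex_of_real (real j / s N))\<^sup>2 =
      \<i> * of_real (pi / 2 * (real j / s N)\<^sup>2)" by (simp only: of_real_mult of_real_power mult.assoc)
    also have "pi / 2 * (real j / s N)\<^sup>2 = pi * (real j)\<^sup>2 / (2 * real N)"
      using s2[of N] by (simp add: power_divide power2_eq_square)
    finally show ?thesis by (simp only: f_def gauss_term_def cis_conv_exp)
  qed
  define a where "a N = (\<Sum>j<N. gauss_term N j) / of_real (s N)" for N
  define e where "e M = 4 / real (Suc M)" for M
  have tail: "eventually (\<lambda>N. norm (a N - h M N) \<le> e M) sequentially" for M
    using n_le[of M] eventually_gt_at_top[of 0]
  proof eventually_elim
    case (elim N)
    note sN = s_pos[OF elim(2)]
    have n_pos: "0 < n M N" using n_ge[of M N] sN by (metis mult_pos_pos of_nat_0_less_iff less_le_trans zero_less_Suc)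
    have "(\<Sum>j<N. gauss_term N j) - (\<Sum>j<n M N. gauss_term N j) = (\<Sum>j\<in>{n M N..<N}. gauss_term N j)"
      using elim(1) sum_diff_nat_ivl[of 0 "n M N" N "gauss_term N"] by (simp add: atLeast0LessThan)
    then have "a N - h M N = (\<Sum>j\<in>{n M N..<N}. gauss_term N j) / of_real (s N)"
      unfolding a_def h_def f_eq[OF elim(2)] by (simp only: diff_divide_distrib [symmetric])
    then have "norm (a N - h M N) = norm (\<Sum>j\<in>{n M N..<N}. gauss_term N j) / s N"
      using sN by (simp add: norm_divide)
    also have "\<dots> \<le> 4 * real N / real (n M N) / s N"
      using sN gauss_tail_bound[OF n_pos elim(1)] by (intro divide_right_mono) auto
    also have "\<dots> = 4 * s N / real (n M N)"
      unfolding s2[of N, symmetric] using sN by (simp add: field_simps)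
    also have "\<dots> \<le> 4 * s N / (real (Suc M) * s N)"
      using n_ge[of M N] n_pos sN by (intro divide_left_mono mult_pos_pos) auto
    also have "\<dots> = e M" using sN by (simp add: e_def)
    finally show ?case .
  qed
  have e: "e \<longlonglongrightarrow> 0"
  proof -
    have "(\<lambda>M. 4 * inverse (real (Suc M))) \<longlonglongrightarrow> 4 * 0"
      by (intro tendsto_intros LIMSEQ_inverse_real_of_nat)
    then show ?thesis by (simp add: e_def[abs_def] divide_inverse)
  qed
  obtain l where l: "a \<longlonglongrightarrow> l"
    using convergent_of_approximations[OF head tail e] by blast
  \<comment> \<open>The reflection of j to 2 N - j maps N, ..., 2 N - 1 to N, ..., 1, which differs
    from 0, ..., N - 1 in the two end terms only.\<close>
  have fold: "gauss_sum N = 2 * (\<Sum>j<N. gauss_term N j) - 1 + gauss_term N N" if "N > 0" for N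
  proof -
    have "gauss_sum N = (\<Sum>j<N. gauss_term N j) + (\<Sum>j<N. gauss_term N (N + j))"
      unfolding gauss_sum_def using sum.nat_group[of "gauss_term N" N 2]
      by (simp add: mult.commute atLeast0LessThan sum.atLeastLessThan_shift_0[of _ N] numeral_2_eq_2)
    also have "(\<Sum>j<N. gauss_term N (N + j)) = (\<Sum>j<N. gauss_term N (N + (N - Suc j)))"
      by (rule sum.nat_diff_reindex [symmetric])
    also have "\<dots> = (\<Sum>j<N. gauss_term N (Suc j))"
    proof (intro sum.cong refl)
      fix j assume "j \<in> {..<N}"
      then have "N + (N - Suc j) = 2 * N - Suc j" "Suc j \<le> 2 * N" by auto
      then show "gauss_term N (N + (N - Suc j)) = gauss_term N (Suc j)"
        using gauss_term_reflect[OF _ that] by metis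
    qed
    also have "\<dots> = (\<Sum>j<N. gauss_term N j) - gauss_term N 0 + gauss_term N N"
      using sum.lessThan_Suc_shift[of "gauss_term N" N] by (simp add: algebra_simps)
    also have "gauss_term N 0 = 1" by (simp add: gauss_term_def)
    finally show ?thesis by simp
  qed
  have inv_s: "(\<lambda>N. 1 / s N) \<longlonglongrightarrow> 0"
    using tendsto_inverse_0_at_top[OF s_top] by (simp add: inverse_eq_divide)
  have small: "(\<lambda>N. (gauss_term N N - 1) / of_real (s N)) \<longlonglongrightarrow> 0"
  proof (rule Lim_null_comparison)
    show "eventually (\<lambda>N. norm ((gauss_term N N - 1) / of_real (s N)) \<le> 2 * (1 / s N)) sequentially"
      using eventually_gt_at_top[of 0]
    proof eventually_elim
      case (elim N)
      have "norm (gauss_term N N - 1) \<le> 2"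
        using norm_triangle_ineq4[of "gauss_term N N" 1] by (simp add: gauss_term_def)
      then show ?case using s_pos[OF elim] by (simp add: norm_divide divide_right_mono)
    qed
    show "(\<lambda>N. 2 * (1 / s N)) \<longlonglongrightarrow> 0" using tendsto_mult_right_zero[OF inv_s] .
  qed
  have lim: "(\<lambda>N. gauss_sum N / of_real (s N)) \<longlonglongrightarrow> 2 * l"
  proof (rule Lim_transform_eventually)
    show "(\<lambda>N. 2 * a N + (gauss_term N N - 1) / of_real (s N)) \<longlonglongrightarrow> 2 * l"
      using tendsto_add[OF tendsto_mult[OF tendsto_const l] small, of 2] by simp
    show "eventually (\<lambda>N. 2 * a N + (gauss_term N N - 1) / of_real (s N) = gauss_sum N / of_real (s N)) sequentially"
      using eventually_gt_at_top[of 0]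
      by eventually_elim (simp add: fold a_def add_divide_distrib diff_divide_distrib)
  qed
  have "(\<lambda>N. (norm (gauss_sum N / of_real (s N)))\<^sup>2) \<longlonglongrightarrow> (norm (2 * l))\<^sup>2"
    by (intro tendsto_intros lim)
  moreover have "eventually (\<lambda>N. (norm (gauss_sum N / of_real (s N)))\<^sup>2 = 2) sequentially"
    using eventually_gt_at_top[of 0]
  proof eventually_elim
    case (elim N)
    then show ?case using s_pos[OF elim] norm_gauss_sum[OF elim] s2[of N]
      by (simp add: norm_divide power_divide power2_eq_square)
  qed
  ultimately have "(\<lambda>N. 2) \<longlonglongrightarrow> (norm (2 * l))\<^sup>2"
    by (rule Lim_transform_eventually)
  then have "(norm (2 * l))\<^sup>2 = 2" by (simp add: LIMSEQ_const_iff)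
  then have "2 * l \<noteq> 0" by auto
  then show ?thesis using lim by (intro that[of "2 * l"]) (auto simp: s_def)
qed

lemma sum_even_odd:
  fixes f :: "nat \<Rightarrow> complex"
  shows "(\<Sum>j<2 * n. f j) = (\<Sum>i<n. f (2 * i)) + (\<Sum>i<n. f (2 * i + 1))"
  by (induction n) (simp_all add: algebra_simps)

text \<open>Completing the square. Doubling the index k = i - (N - 1)/2 gives 2 i + 1 - N, so the
  plain chirp yields an odd term of \<open>gauss_sum\<close>, and a further factor cis (2 pi k / N)
  or its inverse moves to a neighbouring even one. The minus sign is cis pi.\<close>

lemma chirp_2pi_eq:
  assumes N: "N > 0"
  shows "cis (- (2 * pi * real N / 4)) * chirp (2 * pi / real N) (jones_index N i) = - gauss_term N (2 * i + 1)"
    and "cis (- (2 * pi * real N / 4)) * (chirp (2 * pi / real N) (jones_index N i) * cis (2 * pi * (jones_index N i / real N))) =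
      cis (- (pi / (2 * real N))) * gauss_term N (2 * i + 2)"
    and "cis (- (2 * pi * real N / 4)) * (chirp (2 * pi / real N) (jones_index N i) * cis (- (2 * pi * (jones_index N i / real N)))) =
      cis (- (pi / (2 * real N))) * gauss_term N (2 * i)"
proof -
  have "- (2 * pi * real N / 4) + 2 * pi / real N * (jones_index N i)\<^sup>2 =
     pi + pi * (real (2 * i + 1))\<^sup>2 / (2 * real N) + 2 * pi * of_int (- int i - 1)"
    using N by (simp add: power2_eq_square field_simps)
  then show "cis (- (2 * pi * real N / 4)) * chirp (2 * pi / real N) (jones_index N i) = - gauss_term N (2 * i + 1)"
    unfolding chirp_def gauss_term_def cis_mult
    by (simp only: cis_mult [symmetric] cis_2pi_int cis_pi) simp
  have "- (2 * pi * real N / 4) + (2 * pi / real N * (jones_index N i)\<^sup>2 + 2 * pi * (jones_index N i / real N)) =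
     - (pi / (2 * real N)) + pi * (real (2 * i + 2))\<^sup>2 / (2 * real N) + 2 * pi * of_int (- int i - 1)"
    using N by (simp add: power2_eq_square field_simps)
  then show "cis (- (2 * pi * real N / 4)) * (chirp (2 * pi / real N) (jones_index N i) * cis (2 * pi * (jones_index N i / real N))) =
      cis (- (pi / (2 * real N))) * gauss_term N (2 * i + 2)"
    unfolding chirp_def gauss_term_def cis_mult
    by (simp only: cis_mult [symmetric] cis_2pi_int mult_1_right)
  have "- (2 * pi * real N / 4) + (2 * pi / real N * (jones_index N i)\<^sup>2 + - (2 * pi * (jones_index N i / real N))) =
     - (pi / (2 * real N)) + pi * (real (2 * i))\<^sup>2 / (2 * real N) + 2 * pi * of_int (- int i)"
    using N by (simp add: power2_eq_square field_simps)
  then show "cis (- (2 * pi * real N / 4)) * (chirp (2 * pi / real N) (jones_index N i) * cis (- (2 * pi * (jones_index N i / real N)))) =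
      cis (- (pi / (2 * real N))) * gauss_term N (2 * i)"
    unfolding chirp_def gauss_term_def cis_mult
    by (simp only: cis_mult [symmetric] cis_2pi_int mult_1_right)
qed

text \<open>Since sin^2 (pi x) = 1/2 - (exp (2 pi i x) + exp (- 2 pi i x)) / 4, half of the odd and
  half of the even terms of \<open>gauss_sum\<close> appear, all with a minus sign. The even ones
  carry a factor c with |c - 1| <= pi / (2 N), which costs at most pi / 4 in total.\<close>

lemma jones_chirp_sum_sin_squared:
  assumes N: "N > 0"
  shows "norm (cis (- (2 * pi * real N / 4)) * jones_chirp_sum (2 * pi) N (\<lambda>z. (sin (of_real pi * z))\<^sup>2) +
    gauss_sum N / 2) \<le> 1"
proof -
  define c where "c = cis (- (pi / (2 * real N)))"
  define Ev where "Ev = (\<Sum>i<N. gauss_term N (2 * i))"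
  define Od where "Od = (\<Sum>i<N. gauss_term N (2 * i + 1))"
  have shift: "(\<Sum>i<N. gauss_term N (2 * i + 2)) = Ev"
  proof -
    have "gauss_term N (2 * N) = gauss_term N 0" using gauss_term_periodic[OF N, of 0] by simp
    then show ?thesis
      using sum.lessThan_Suc_shift[of "\<lambda>i. gauss_term N (2 * i)" N] by (simp add: Ev_def)
  qed
  have sin2: "(sin (of_real pi * complex_of_real x))\<^sup>2 = 1 / 2 - (cis (2 * pi * x) + cis (- (2 * pi * x))) / 4" for x
  proof -
    have "(sin (of_real pi * complex_of_real x))\<^sup>2 = of_real ((sin (pi * x))\<^sup>2)"
      by (simp flip: sin_of_real)
    also have "cos (2 * pi * x) = 1 - 2 * (sin (pi * x))\<^sup>2"
      using cos_double_sin[of "pi * x"] by (simp add: mult.assoc)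
    then have "(sin (pi * x))\<^sup>2 = 1 / 2 - 2 * cos (2 * pi * x) / 4" by linarith
    also have "complex_of_real \<dots> = 1 / 2 - (cis (2 * pi * x) + cis (- (2 * pi * x))) / 4"
      by (simp add: complex_eq_iff)
    finally show ?thesis .
  qed
  have "cis (- (2 * pi * real N / 4)) * (chirp (2 * pi / real N) (jones_index N i) *
      (sin (of_real pi * complex_of_real (jones_index N i / real N)))\<^sup>2) =
      - (gauss_term N (2 * i + 1) / 2) - c * (gauss_term N (2 * i + 2) + gauss_term N (2 * i)) / 4" for i
  proof -
    have "cis (- (2 * pi * real N / 4)) * (chirp (2 * pi / real N) (jones_index N i) *
      (sin (of_real pi * complex_of_real (jones_index N i / real N)))\<^sup>2) =
      cis (- (2 * pi * real N / 4)) * chirp (2 * pi / real N) (jones_index N i) / 2 -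
      (cis (- (2 * pi * real N / 4)) * (chirp (2 * pi / real N) (jones_index N i) * cis (2 * pi * (jones_index N i / real N))) +
       cis (- (2 * pi * real N / 4)) * (chirp (2 * pi / real N) (jones_index N i) * cis (- (2 * pi * (jones_index N i / real N))))) / 4"
      unfolding sin2 by (simp only: right_diff_distrib distrib_left times_divide_eq_right mult_1_right)
    then show ?thesis unfolding chirp_2pi_eq[OF N] c_def by (simp add: distrib_left)
  qed
  then have "cis (- (2 * pi * real N / 4)) * jones_chirp_sum (2 * pi) N (\<lambda>z. (sin (of_real pi * z))\<^sup>2) =
    (\<Sum>i<N. - (gauss_term N (2 * i + 1) / 2) - c * (gauss_term N (2 * i + 2) + gauss_term N (2 * i)) / 4)"
    unfolding jones_chirp_sum_def sum_distrib_left by (intro sum.cong refl)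
  also have "\<dots> = - (Od / 2) - c * (Ev + Ev) / 4"
    by (simp only: sum_subtractf sum_negf sum_divide_distrib [symmetric] sum_distrib_left [symmetric] sum.distrib
        shift Ev_def [symmetric] Od_def [symmetric])
  finally have eq: "cis (- (2 * pi * real N / 4)) * jones_chirp_sum (2 * pi) N (\<lambda>z. (sin (of_real pi * z))\<^sup>2) =
    - (Od / 2) - c * (Ev + Ev) / 4" .
  have "cis (- (2 * pi * real N / 4)) * jones_chirp_sum (2 * pi) N (\<lambda>z. (sin (of_real pi * z))\<^sup>2) +
    gauss_sum N / 2 = - ((c - 1) * Ev / 2)"
    unfolding eq gauss_sum_def sum_even_odd Ev_def [symmetric] Od_def [symmetric]
    by (simp add: field_simps)
  also have "norm \<dots> = norm (c - 1) * norm Ev / 2" by (simp add: norm_mult)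
  also have "\<dots> \<le> \<bar>- (pi / (2 * real N))\<bar> * real N / 2"
  proof (intro divide_right_mono mult_mono)
    show "norm (c - 1) \<le> \<bar>- (pi / (2 * real N))\<bar>" unfolding c_def by (rule norm_cis_minus_1)
    have "norm Ev \<le> (\<Sum>i<N. 1)" unfolding Ev_def by (rule sum_norm_le) (simp add: gauss_term_def)
    then show "norm Ev \<le> real N" by simp
  qed auto
  also have "\<dots> = pi / 4" using N by simp
  also have "pi / 4 \<le> 1" using pi_less_4 by simp
  finally show ?thesis .
qed

subsection \<open>Growth of torus knots at the critical argument\<close>

lemma sin_2pi_eq_0:
  fixes x :: real
  assumes "\<bar>x\<bar> \<le> 1 / 2" "sin (2 * pi * x) = 0"
  shows "x = 0 \<or> x = 1 / 2 \<or> x = - (1 / 2)"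
proof -
  obtain i :: int where "2 * pi * x = of_int i * pi" using assms(2) by (auto simp: sin_zero_iff_int2)
  then have x: "x = of_int i / 2" by simp
  then have "\<bar>i\<bar> \<le> 1" using assms(1) by simp
  then have "i = 0 \<or> i = 1 \<or> i = - 1" by linarith
  then show ?thesis using x by auto
qed

lemma torus_jones_imaginary_growth:
  fixes a b :: nat
  assumes ab: "a > 1" "b > 1"
  defines "\<theta> \<equiv> 2 * pi / (real a * real b)"
  obtains C :: complex where "C \<noteq> 0"
    "(\<lambda>N. torus_jones a b N (\<i> * of_real \<theta> / of_nat N) / of_real (sqrt (real N))) \<longlonglongrightarrow> C"
proof -
  have ab0: "real a * real b > 0" using ab by simp
  have \<omega>: "\<theta> * (real a * real b) = 2 * pi" using ab by (simp add: \<theta>_def)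
  have "real a * real b \<ge> 2 * 2" using ab by (intro mult_mono) auto
  then have \<theta>: "0 < \<theta>" "\<theta> / 2 < pi"
    unfolding \<theta>_def using ab0 by (auto simp: divide_less_eq intro!: mult_strict_left_mono)
  then have sin\<theta>: "sin (\<theta> / 2) \<noteq> 0" using sin_gt_zero[of "\<theta> / 2"] by simp
  define W where "W = torus_weight a b \<theta>"
  have W: "W analytic_on unit_segment" unfolding W_def by (rule torus_weight_analytic)
  \<comment> \<open>The value of the weight at the two stationary ends, - 2 sin (pi/a) sin (pi/b),
    nonzero because a and b exceed 1.\<close>
  define w where "w = W (1 / 2)"
  have w: "w = of_real (- 2 * sin (pi / real b) * sin (pi / real a))"
  proof -
    have "\<theta> * real a * (1 / 2) = pi / real b" "\<theta> * real b * (1 / 2) = pi / real a"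
      using ab by (simp_all add: \<theta>_def)
    then show ?thesis
      using torus_weight_of_real[of a b \<theta> "1 / 2"] unfolding w_def W_def by (simp only:) simp
  qed
  have "sin (pi / real b) > 0" "sin (pi / real a) > 0"
    using ab by (intro sin_gt_zero; simp add: divide_less_eq)+
  then have "w \<noteq> 0" unfolding w by simp
  \<comment> \<open>The sine now vanishes also at the two ends of the range. The \<open>sin\<^sup>2\<close> part carries the
    contribution of these stationary points; the rest is divisible by the sine and stays bounded.\<close>
  define V where "V z = W z - w * (sin (of_real pi * z))\<^sup>2" for z
  have V: "V analytic_on unit_segment"
    unfolding V_def by (intro analytic_intros W)
  have "V (of_real x) = 0" if x: "\<bar>x\<bar> \<le> 1 / 2" "sin (2 * pi * x) = 0" for x
  proof -
    have "W (- (1 / 2)) = w" by (simp add: w_def W_def torus_weight_def)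
    moreover have "sin (complex_of_real pi * (1 / 2)) = 1"
      using sin_of_real[of "pi / 2", where 'a = complex] by (simp del: sin_of_real)
    moreover have "W 0 = 0" by (simp add: W_def torus_weight_def)
    ultimately have "V (of_real 0) = 0" "V (of_real (1 / 2)) = 0" "V (of_real (- (1 / 2))) = 0"
      by (simp_all add: V_def w_def)
    then show ?thesis using sin_2pi_eq_0[OF x] by metis
  qed
  then obtain U where U: "U analytic_on unit_segment"
    "\<And>x. \<bar>x\<bar> \<le> 1 / 2 \<Longrightarrow> V (of_real x) = of_real (sin (2 * pi * x)) * U (of_real x)"
    using analytic_divide_sin[OF V, of "2 * pi"] by auto
  obtain B where B: "\<And>N n \<tau>. in_window n \<tau> N \<Longrightarrow>
    norm (\<Sum>i<n. chirp (2 * pi / real N) (real i - \<tau>) *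
       (of_real (sin (2 * pi * ((real i - \<tau>) / real N))) * U (of_real ((real i - \<tau>) / real N)))) \<le> B"
    using chirp_sum_bounded[OF U(1), where \<omega> = "2 * pi"] by blast
  have SV: "norm (jones_chirp_sum (2 * pi) N V) \<le> B" if N: "N > 0" for N
  proof -
    have "jones_chirp_sum (2 * pi) N V = (\<Sum>i<N. chirp (2 * pi / real N) (jones_index N i) *
       (of_real (sin (2 * pi * (jones_index N i / real N))) * U (of_real (jones_index N i / real N))))"
      unfolding jones_chirp_sum_def
    proof (intro sum.cong refl arg_cong2[where f = times] U(2))
      fix i assume "i \<in> {..<N}"
      then show "\<bar>jones_index N i / real N\<bar> \<le> 1 / 2"
        using N by (intro abs_divide_le_half norm_jones_index) auto
    qed
    moreover have "in_window N ((real N - 1) / 2) N"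
      using N norm_jones_index unfolding in_window_def by blast
    ultimately show ?thesis using B by (simp only:)
  qed
  define C1 C2 :: "complex \<Rightarrow> complex"
    where "C1 = (\<lambda>z. cos (of_real (\<theta> * (real a + real b)) * z))"
      and "C2 = (\<lambda>z. cos (of_real (\<theta> * (real a - real b)) * z))"
  have C: "C1 analytic_on unit_segment" "C2 analytic_on unit_segment"
    unfolding C1_def C2_def by (auto intro!: analytic_intros analytic_on_cos)
  have correction: "\<exists>B. \<forall>N>0. norm ((cis (x / (2 * real N)) - 1) * jones_chirp_sum (2 * pi) N C) \<le> B"
    if C: "C analytic_on unit_segment" for C x
  proof -
    obtain B where B: "\<forall>N>0. norm (jones_chirp_sum (2 * pi) N C) \<le> B * real N"
      using norm_jones_chirp_sum_le[OF C] by blast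
    have "norm ((cis (x / (2 * real N)) - 1) * jones_chirp_sum (2 * pi) N C) \<le> \<bar>x\<bar> / 2 * B" if N: "N > 0" for N
    proof -
      have "norm ((cis (x / (2 * real N)) - 1) * jones_chirp_sum (2 * pi) N C) \<le> \<bar>x / (2 * real N)\<bar> * (B * real N)"
        unfolding norm_mult using B N by (intro mult_mono norm_cis_minus_1) auto
      then show ?thesis using N by (simp add: abs_divide abs_mult)
    qed
    then show ?thesis by blast
  qed
  obtain B1 where B1: "\<And>N. N > 0 \<Longrightarrow> norm ((cis (\<theta> / (2 * real N)) - 1) * jones_chirp_sum (2 * pi) N C1) \<le> B1"
    using correction[OF C(1)] by blast
  obtain B2 where B2: "\<And>N. N > 0 \<Longrightarrow> norm ((cis ((- \<theta>) / (2 * real N)) - 1) * jones_chirp_sum (2 * pi) N C2) \<le> B2"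
    using correction[OF C(2)] by blast
  define T where "T N = jones_chirp_sum (2 * pi) N W +
     (cis (\<theta> / (2 * real N)) - 1) * jones_chirp_sum (2 * pi) N C1 -
     (cis ((- \<theta>) / (2 * real N)) - 1) * jones_chirp_sum (2 * pi) N C2" for N
  define Z where "Z N = cis (- (2 * pi * real N / 4))" for N
  define Q where "Q N = jones_chirp_sum (2 * pi) N (\<lambda>z. (sin (of_real pi * z))\<^sup>2)" for N
  have norm_Z: "norm (Z N * z) = norm z" for N z by (simp add: Z_def norm_mult)
  \<comment> \<open>All that accompanies the Gauss sum is bounded and disappears after division by
    sqrt N. In the corrections the trivial bound O(N) on the sum meets a factor O(1/N).\<close>
  have bounded: "norm (Z N * T N + w * gauss_sum N / 2) \<le> norm w + B + B1 + B2" if N: "N > 0" for N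
  proof -
    have "jones_chirp_sum (2 * pi) N W = w * Q N + jones_chirp_sum (2 * pi) N V"
      unfolding jones_chirp_sum_def Q_def V_def sum_distrib_left sum.distrib [symmetric]
      by (intro sum.cong refl) (simp only: right_diff_distrib, simp add: mult_ac)
    then have "Z N * T N + w * gauss_sum N / 2 =
      w * (Z N * Q N + gauss_sum N / 2) + Z N * jones_chirp_sum (2 * pi) N V +
      Z N * ((cis (\<theta> / (2 * real N)) - 1) * jones_chirp_sum (2 * pi) N C1) -
      Z N * ((cis ((- \<theta>) / (2 * real N)) - 1) * jones_chirp_sum (2 * pi) N C2)"
      unfolding T_def by (simp add: algebra_simps)
    also have "norm \<dots> \<le> norm w * 1 + B + B1 + B2"
    proof (intro order.trans[OF norm_triangle_ineq4] order.trans[OF norm_triangle_ineq] add_mono)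
      show "norm (w * (Z N * Q N + gauss_sum N / 2)) \<le> norm w * 1"
        unfolding norm_mult Z_def Q_def by (intro mult_left_mono jones_chirp_sum_sin_squared N) auto
      show "norm (Z N * jones_chirp_sum (2 * pi) N V) \<le> B"
        unfolding norm_Z by (rule SV[OF N])
      show "norm (Z N * ((cis (\<theta> / (2 * real N)) - 1) * jones_chirp_sum (2 * pi) N C1)) \<le> B1"
        unfolding norm_Z by (rule B1[OF N])
      show "norm (Z N * ((cis ((- \<theta>) / (2 * real N)) - 1) * jones_chirp_sum (2 * pi) N C2)) \<le> B2"
        unfolding norm_Z by (rule B2[OF N])
    qed
    finally show ?thesis by simp
  qed
  define s where "s N = sqrt (real N)" for N
  have inv_s: "(\<lambda>N. 1 / s N) \<longlonglongrightarrow> 0"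
    using tendsto_inverse_0_at_top[OF sqrt_real_at_top] by (simp add: inverse_eq_divide s_def)
  have error: "(\<lambda>N. (Z N * T N + w * gauss_sum N / 2) / of_real (s N)) \<longlonglongrightarrow> 0"
  proof (rule Lim_null_comparison)
    show "eventually (\<lambda>N. norm ((Z N * T N + w * gauss_sum N / 2) / of_real (s N)) \<le>
      (norm w + B + B1 + B2) * (1 / s N)) sequentially"
      using eventually_gt_at_top[of 0]
    proof eventually_elim
      case (elim N)
      then have "norm (Z N * T N + w * gauss_sum N / 2) / s N \<le> (norm w + B + B1 + B2) / s N"
        using bounded by (intro divide_right_mono) (auto simp: s_def)
      then show ?case by (simp add: norm_divide s_def)
    qed
    show "(\<lambda>N. (norm w + B + B1 + B2) * (1 / s N)) \<longlonglongrightarrow> 0" using tendsto_mult_right_zero[OF inv_s] .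
  qed
  obtain g where g: "g \<noteq> 0" "(\<lambda>N. gauss_sum N / of_real (s N)) \<longlonglongrightarrow> g"
    unfolding s_def by (rule gauss_sum_growth)
  define D where "D = 2 * \<i> * complex_of_real (sin (\<theta> / 2))"
  have D: "D \<noteq> 0" using sin\<theta> by (simp add: D_def)
  have "(\<lambda>N. cis (2 * pi / (4 * real N)) / D * ((Z N * T N + w * gauss_sum N / 2) / of_real (s N) -
      w / 2 * (gauss_sum N / of_real (s N)))) \<longlonglongrightarrow> 1 / D * (0 - w / 2 * g)"
    by (intro tendsto_mult tendsto_divide tendsto_diff tendsto_const error g cis_tendsto_1 D)
  then have "(\<lambda>N. torus_jones a b N (\<i> * of_real \<theta> / of_nat N) / of_real (s N)) \<longlonglongrightarrow> 1 / D * (0 - w / 2 * g)"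
  proof (rule Lim_transform_eventually)
    show "eventually (\<lambda>N. cis (2 * pi / (4 * real N)) / D * ((Z N * T N + w * gauss_sum N / 2) / of_real (s N) -
      w / 2 * (gauss_sum N / of_real (s N))) =
      torus_jones a b N (\<i> * of_real \<theta> / of_nat N) / of_real (s N)) sequentially"
      using eventually_gt_at_top[of 0]
    proof eventually_elim
      case (elim N)
      have "torus_jones a b N (\<i> * of_real \<theta> / of_nat N) = Z N * cis (2 * pi / (4 * real N)) / D * T N"
        unfolding torus_jones_imaginary[OF elim sin\<theta>] \<omega> T_def Z_def D_def W_def C1_def C2_def
          minus_divide_left ..
      then show ?case by (simp add: add_divide_distrib)
    qed
  qed
  moreover have "1 / D * (0 - w / 2 * g) \<noteq> 0" using D g \<open>w \<noteq> 0\<close> by simp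
  ultimately show ?thesis unfolding s_def by (intro that) auto
qed

subsection \<open>The trefoil at real arguments\<close>

text \<open>The generalized pentagonal numbers at nonnegative and at negative indices:
  \<open>pent' m\<close> is the value of \<open>n (3 n + 1) / 2\<close> at \<open>n = - m - 1\<close>.\<close>

definition pent :: "nat \<Rightarrow> real" where "pent m = real m * (3 * real m + 1) / 2"
definition pent' :: "nat \<Rightarrow> real" where "pent' m = (real m + 1) * (3 * real m + 2) / 2"

text \<open>On the left each integer n from - N to N - 1 occurs exactly once, with sign (- 1)^(N +
  n): the first family has the parity of N, the second the opposite one. On the right n = m is
  paired with n = - m - 1. The induction advances by two because that preserves the parity.\<close>

lemma alternating_reindex:
  fixes G :: "int \<Rightarrow> real"
  shows "(\<Sum>i<N. G (int N - 2 - 2 * int i) - G (2 * int i + 1 - int N)) =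
    (- 1) ^ N * (\<Sum>m<N. (- 1) ^ m * (G (int m) - G (- int m - 1)))"
proof (induction N rule: induct_nat_012)
  case (ge2 N)
  let ?F = "\<lambda>N i. G (int N - 2 - 2 * int i) - G (2 * int i + 1 - int N)"
  let ?A = "G (int N)" and ?B = "G (- int N - 1)" and ?C = "G (int N + 1)" and ?D = "G (- int N - 2)"
  have "(\<Sum>i<Suc (Suc N). ?F (Suc (Suc N)) i) =
    ?F (Suc (Suc N)) 0 + (\<Sum>i<N. ?F (Suc (Suc N)) (Suc i)) + ?F (Suc (Suc N)) (Suc N)"
    by (subst sum.lessThan_Suc, subst sum.lessThan_Suc_shift) simp
  also have "(\<Sum>i<N. ?F (Suc (Suc N)) (Suc i)) = (\<Sum>i<N. ?F N i)"
    by (intro sum.cong refl) (simp add: algebra_simps)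
  also have "\<dots> = (- 1) ^ N * (\<Sum>m<N. (- 1) ^ m * (G (int m) - G (- int m - 1)))" by (rule ge2.IH(1))
  also have "?F (Suc (Suc N)) 0 = ?A - ?B"
  proof -
    have "int (Suc (Suc N)) - 2 - 2 * int 0 = int N" "2 * int 0 + 1 - int (Suc (Suc N)) = - int N - 1" by simp_all
    then show ?thesis by (simp only:)
  qed
  also have "?F (Suc (Suc N)) (Suc N) = ?D - ?C"
  proof -
    have "int (Suc (Suc N)) - 2 - 2 * int (Suc N) = - int N - 2" "2 * int (Suc N) + 1 - int (Suc (Suc N)) = int N + 1"
      by simp_all
    then show ?thesis by (simp only:)
  qed
  finally have lhs: "(\<Sum>i<Suc (Suc N). ?F (Suc (Suc N)) i) =
    ?A - ?B + (- 1) ^ N * (\<Sum>m<N. (- 1) ^ m * (G (int m) - G (- int m - 1))) + (?D - ?C)" .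
  have "int (Suc N) = int N + 1" "- int (Suc N) - 1 = - int N - 2" by simp_all
  then have rhs: "(\<Sum>m<Suc (Suc N). (- 1) ^ m * (G (int m) - G (- int m - 1))) =
    (\<Sum>m<N. (- 1) ^ m * (G (int m) - G (- int m - 1))) + (- 1) ^ N * (?A - ?B) + (- 1) ^ Suc N * (?C - ?D)"
    by (simp only: sum.lessThan_Suc)
  have "p + c * S + q = c * (S + c * p + (- c) * (- q))" if "c * c = 1" for c p q S :: real
    using that by algebra
  from this[of "(- 1) ^ N" "?A - ?B" _ "?D - ?C"] show ?case
    unfolding lhs rhs by (simp flip: power_add mult_2)
qed (simp_all add: algebra_simps)

text \<open>With n = - 2 k - 1 in the first exponential and n = 2 k in the second, both exponents
  equal n (3 n + 1) / 2 - 1 / 2, a generalized pentagonal number up to the shift.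
  \<open>alternating_reindex\<close> then puts them in increasing order.\<close>

lemma trefoil_jones_real:
  fixes h :: real
  assumes "N > 0" "h \<noteq> 0"
  shows "torus_jones 2 3 N (of_real h) = of_real ((- 1) ^ N * exp (h - 3 / 2 * (real N)\<^sup>2 * h) *
     (\<Sum>m<N. (- 1) ^ m * (exp (pent m * h) - exp (pent' m * h))) / (2 * sinh (real N / 2 * h)))"
proof -
  have sinh: "sinh (of_nat N / 2 * complex_of_real h) = of_real (sinh (real N / 2 * h))"
    by (simp add: sinh_field_def flip: exp_of_real)
  have nz: "sinh (real N / 2 * h) \<noteq> 0" using assms by simp
  define G where "G m = exp ((of_int m * (3 * of_int m + 1) / 2 - 1 / 2) * h)" for m :: int
  have "torus_sum 2 3 N (of_real h) = of_real (\<Sum>i<N. G (int N - 2 - 2 * int i) - G (2 * int i + 1 - int N))"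
    unfolding torus_sum_def of_real_sum Let_def
  proof (intro sum.cong refl)
    fix i
    have 1: "(2 * 3 * (jones_index N i)\<^sup>2 + (2 + 3) * jones_index N i + 1 / 2) =
        of_int (int N - 2 - 2 * int i) * (3 * of_int (int N - 2 - 2 * int i) + 1) / 2 - 1 / 2"
      by (simp add: power2_eq_square field_simps)
    have 2: "(2 * 3 * (jones_index N i)\<^sup>2 + (3 - 2) * jones_index N i - 1 / 2) =
        of_int (2 * int i + 1 - int N) * (3 * of_int (2 * int i + 1 - int N) + 1) / 2 - 1 / 2"
      by (simp add: power2_eq_square field_simps)
    have "complex_of_real (G (int N - 2 - 2 * int i) - G (2 * int i + 1 - int N)) =
      of_real (exp ((2 * 3 * (jones_index N i)\<^sup>2 + (2 + 3) * jones_index N i + 1 / 2) * h) -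
       exp ((2 * 3 * (jones_index N i)\<^sup>2 + (3 - 2) * jones_index N i - 1 / 2) * h))"
      unfolding G_def 1 2 ..
    also have "\<dots> = exp ((of_nat 2 * of_nat 3 * (complex_of_real (jones_index N i))\<^sup>2 + (of_nat 2 + of_nat 3) * of_real (jones_index N i) + 1 / 2) * of_real h) -
       exp ((of_nat 2 * of_nat 3 * (complex_of_real (jones_index N i))\<^sup>2 + (of_nat 3 - of_nat 2) * of_real (jones_index N i) - 1 / 2) * of_real h)"
      by (simp flip: exp_of_real)
    finally show "exp ((of_nat 2 * of_nat 3 * (complex_of_real (jones_index N i))\<^sup>2 + (of_nat 2 + of_nat 3) * of_real (jones_index N i) + 1 / 2) * of_real h) -
       exp ((of_nat 2 * of_nat 3 * (complex_of_real (jones_index N i))\<^sup>2 + (of_nat 3 - of_nat 2) * of_real (jones_index N i) - 1 / 2) * of_real h) =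
       complex_of_real (G (int N - 2 - 2 * int i) - G (2 * int i + 1 - int N))" ..
  qed
  also have "(\<Sum>i<N. G (int N - 2 - 2 * int i) - G (2 * int i + 1 - int N)) =
     exp (- h / 2) * ((- 1) ^ N * (\<Sum>m<N. (- 1) ^ m * (exp (pent m * h) - exp (pent' m * h))))"
  proof -
    have "G (int m) = exp (- h / 2) * exp (pent m * h)" "G (- int m - 1) = exp (- h / 2) * exp (pent' m * h)" for m
      by (simp_all add: G_def pent_def pent'_def field_simps flip: exp_add)
    then show ?thesis unfolding alternating_reindex
      by (simp add: sum_distrib_left algebra_simps)
  qed
  finally have sum: "torus_sum 2 3 N (of_real h) = of_real (exp (- h / 2) * ((- 1) ^ N *
     (\<Sum>m<N. (- 1) ^ m * (exp (pent m * h) - exp (pent' m * h)))))" .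
  have e: "exp (- (of_nat 2 * of_nat 3 * (of_nat N ^ 2 - 1) / 4) * complex_of_real h) =
    of_real (exp (3 / 2 * h - 3 / 2 * (real N)\<^sup>2 * h))"
  proof -
    have "3 / 2 * h - 3 / 2 * (real N)\<^sup>2 * h = - (2 * 3 * (real N ^ 2 - 1) / 4) * h" by (simp add: field_simps)
    then show ?thesis by (simp flip: exp_of_real)
  qed
  have "exp (h - 3 / 2 * (real N)\<^sup>2 * h) = exp (3 / 2 * h - 3 / 2 * (real N)\<^sup>2 * h) * exp (- h / 2)"
    by (simp flip: exp_add)
  then show ?thesis
    using nz by (subst torus_jones_eq) (simp_all only: sinh sum e of_real_eq_0_iff not_False_eq_True, simp add: mult_ac)
qed

section \<open>The size of Euler's pentagonal series\<close>

lemma real_le_pent: "real m \<le> pent m"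
proof (cases "m = 0")
  case False
  then have "real m * 2 \<le> real m * (3 * real m + 1)" by (intro mult_left_mono) auto
  then show ?thesis by (simp add: pent_def)
qed (simp add: pent_def)

text \<open>With q = exp (- x) this is the quotient of (1 - q) ... (1 - q^n) by (1 - q) ... (1 -
  q^s), written without division.\<close>

definition shanks_prod :: "real \<Rightarrow> nat \<Rightarrow> nat \<Rightarrow> real" where
  "shanks_prod x n s = (\<Prod>j\<in>{s<..n}. 1 - exp (- (x * real j)))"

definition shanks_term :: "real \<Rightarrow> nat \<Rightarrow> nat \<Rightarrow> real" where
  "shanks_term x n s = (- 1) ^ s * shanks_prod x n s *
     exp (- (x * (real n * real s + real s * (real s + 1) / 2)))"

lemma shanks_prod_Suc: "s \<le> n \<Longrightarrow> shanks_prod x (Suc n) s = shanks_prod x n s * (1 - exp (- (x * real (Suc n))))"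
proof -
  assume "s \<le> n"
  then have "{s<..Suc n} = insert (Suc n) {s<..n}" by auto
  then show ?thesis by (simp add: shanks_prod_def)
qed

lemma shanks_prod_lower: "s < n \<Longrightarrow> shanks_prod x n s = (1 - exp (- (x * real (Suc s)))) * shanks_prod x n (Suc s)"
proof -
  assume "s < n"
  then have "{s<..n} = insert (Suc s) {Suc s<..n}" by auto
  then show ?thesis by (simp add: shanks_prod_def)
qed

lemma shanks_prod_self [simp]: "shanks_prod x n n = 1"
  by (simp add: shanks_prod_def)

text \<open>Each term changes by a difference Z s - Z (s + 1), so only the last Z and the new term
  at s = n + 1 survive; their exponents are \<open>pent' n\<close> and
  \<open>pent (Suc n)\<close>.\<close>

lemma shanks_step:
  "(\<Sum>s\<le>Suc n. shanks_term x (Suc n) s) - (\<Sum>s\<le>n. shanks_term x n s) =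
    (- 1) ^ Suc n * (exp (- (x * pent (Suc n))) + exp (- (x * pent' n)))"
proof -
  define Y where "Y s = (- 1) ^ s * shanks_prod x n s *
     exp (- (x * (real n * real s + real s * (real s + 1) / 2 + real s + real n + 1)))" for s
  define Z where "Z s = (case s of 0 \<Rightarrow> 0 | Suc s \<Rightarrow> Y s)" for s
  \<comment> \<open>With common factors removed this is (1 - q^(n+1)) q^s - 1 = - (1 - q^s) -
    q^(s+n+1), where q = exp (- x). The factor 1 - q^s extends the product above s to the product
    above s - 1.\<close>
  have diff: "shanks_term x (Suc n) s - shanks_term x n s = Z s - Z (Suc s)" if "s \<le> n" for s
  proof -
    define E where "E = exp (- (x * (real n * real s + real s * (real s + 1) / 2)))"
    have e1: "exp (- (x * (real (Suc n) * real s + real s * (real s + 1) / 2))) = E * exp (- (x * real s))"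
      by (simp add: E_def algebra_simps flip: exp_add)
    have e2: "exp (- (x * (real n * real s + real s * (real s + 1) / 2 + real s + real n + 1))) =
      E * exp (- (x * real s)) * exp (- (x * real (Suc n)))"
      by (simp add: E_def algebra_simps flip: exp_add)
    have Z1: "Z s = - ((- 1) ^ s * shanks_prod x n s * E * (1 - exp (- (x * real s))))"
    proof (cases s)
      case (Suc r)
      have "exp (- (x * (real n * real r + real r * (real r + 1) / 2 + real r + real n + 1))) = E"
        unfolding E_def Suc by (rule arg_cong[where f = exp]) (simp add: field_simps)
      then show ?thesis
        using shanks_prod_lower[of r n x] that Suc by (simp add: Z_def Y_def)
    qed (simp add: Z_def)
    have Z2: "Z (Suc s) = (- 1) ^ s * shanks_prod x n s * (E * exp (- (x * real s)) * exp (- (x * real (Suc n))))"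
      by (simp only: Z_def Y_def e2 nat.case)
    show ?thesis
      unfolding Z1 Z2 shanks_term_def e1 E_def [symmetric] shanks_prod_Suc[OF that]
      by (simp only: algebra_simps; simp)
  qed
  have "(\<Sum>s\<le>Suc n. shanks_term x (Suc n) s) - (\<Sum>s\<le>n. shanks_term x n s) =
    (\<Sum>s\<le>n. shanks_term x (Suc n) s - shanks_term x n s) + shanks_term x (Suc n) (Suc n)"
    by (simp add: sum_subtractf)
  also have "(\<Sum>s\<le>n. shanks_term x (Suc n) s - shanks_term x n s) = (\<Sum>s\<le>n. Z s - Z (Suc s))"
    using diff by (intro sum.cong refl) auto
  also have "\<dots> = - Y n"
    by (subst sum_telescope) (simp add: Z_def)
  also have "- Y n + shanks_term x (Suc n) (Suc n) =
    (- 1) ^ Suc n * (exp (- (x * pent (Suc n))) + exp (- (x * pent' n)))"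
  proof -
    have "real n * real n + real n * (real n + 1) / 2 + real n + real n + 1 = pent' n"
      "real (Suc n) * real (Suc n) + real (Suc n) * (real (Suc n) + 1) / 2 = pent (Suc n)"
      by (simp_all add: pent_def pent'_def field_simps)
    then show ?thesis by (simp only: Y_def shanks_term_def shanks_prod_self) (simp add: algebra_simps)
  qed
  finally show ?thesis .
qed

text \<open>Shanks' finite form of Euler's pentagonal number theorem, with \<open>q = exp (- x)\<close>.\<close>

lemma shanks_identity:
  "(\<Sum>m<n. (- 1) ^ m * (exp (- (x * pent m)) - exp (- (x * pent' m)))) =
     (\<Sum>s\<le>n. shanks_term x n s) - (- 1) ^ n * exp (- (x * pent n))"
proof (induction n)
  case 0
  show ?case by (simp add: shanks_term_def pent_def)
next
  case (Suc n)
  have "(\<Sum>m<Suc n. (- 1) ^ m * (exp (- (x * pent m)) - exp (- (x * pent' m)))) =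
    (\<Sum>s\<le>n. shanks_term x n s) - (- 1) ^ n * exp (- (x * pent' n))"
    unfolding sum.lessThan_Suc Suc by (simp add: algebra_simps)
  also have "(\<Sum>s\<le>n. shanks_term x n s) = (\<Sum>s\<le>Suc n. shanks_term x (Suc n) s) -
      (- 1) ^ Suc n * (exp (- (x * pent (Suc n))) + exp (- (x * pent' n)))"
    unfolding shanks_step [symmetric] by simp
  finally show ?case by (simp add: algebra_simps)
qed

text \<open>The truncated logarithm series: ln (1 - t) plus the polynomial has derivative - t^4 / (1
  - t).\<close>

lemma one_minus_le_exp:
  fixes y :: real
  assumes "0 \<le> y" "y < 1"
  shows "1 - y \<le> exp (- (y + y ^ 2 / 2 + y ^ 3 / 3 + y ^ 4 / 4))"
proof -
  define f where "f y = ln (1 - y) + (y + y ^ 2 / 2 + y ^ 3 / 3 + y ^ 4 / 4)" for y :: real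
  have "f y \<le> f 0"
  proof (rule DERIV_nonpos_imp_nonincreasing[of 0 y f])
    fix t assume t: "0 \<le> t" "t \<le> y"
    have "(f has_real_derivative (- 1 / (1 - t) + (1 + t + t ^ 2 + t ^ 3))) (at t)"
      unfolding f_def using t assms by (auto intro!: derivative_eq_intros)
    moreover have "- 1 / (1 - t) + (1 + t + t ^ 2 + t ^ 3) = - (t ^ 4) / (1 - t)"
      using t assms by (simp add: field_simps eval_nat_numeral)
    moreover have "- (t ^ 4) / (1 - t) \<le> 0" using t assms by (intro divide_nonpos_pos) auto
    ultimately show "\<exists>d. (f has_real_derivative d) (at t) \<and> d \<le> 0" by metis
  qed (use assms in auto)
  then have "ln (1 - y) \<le> - (y + y ^ 2 / 2 + y ^ 3 / 3 + y ^ 4 / 4)" by (simp add: f_def)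
  then have "exp (ln (1 - y)) \<le> exp (- (y + y ^ 2 / 2 + y ^ 3 / 3 + y ^ 4 / 4))" by (simp only: exp_le_cancel_iff)
  then show ?thesis using assms by simp
qed

lemma inverse_exp_minus_1_ge:
  fixes y :: real
  assumes "y > 0"
  shows "exp (- y) / (1 - exp (- y)) \<ge> 1 / y - 1"
proof -
  have "(1 - y) * (1 - exp (- y)) \<le> y * exp (- y)"
    using exp_ge_add_one_self[of "- y"] by (simp add: algebra_simps)
  then have "(1 - y) / y \<le> exp (- y) / (1 - exp (- y))"
    using assms by (simp add: pos_divide_le_eq pos_le_divide_eq mult_ac)
  then show ?thesis using assms by (simp add: diff_divide_distrib)
qed

lemma shanks_prod_bounds:
  assumes "x > 0"
  shows "0 \<le> shanks_prod x n s" "shanks_prod x n s \<le> 1"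
  unfolding shanks_prod_def using assms by (auto intro!: prod_nonneg prod_le_1)

text \<open>As n grows, the term s = 0 of Shanks' sum tends to Euler's product and the others total
  at most n q^n, so l is bounded by the product of all 1 - q^j. Four powers of the logarithm give
  the sums over j of q^(k j) / k for k = 1, ..., 4, each at least (1 / (k x) - 1) / k. Hence 205/144
  = 1 + 1/4 + 1/9 + 1/16 and 25/12 = 1 + 1/2 + 1/3 + 1/4.\<close>

lemma pentagonal_sum_bound:
  assumes x: "x > 0" and full: "(\<lambda>n. \<Sum>m<n. (- 1) ^ m * (exp (- (x * pent m)) - exp (- (x * pent' m)))) \<longlonglongrightarrow> l"
  shows "\<bar>l\<bar> \<le> exp (25 / 12 - 205 / (144 * x))"
proof -
  define q where "q = exp (- x)"
  have q: "0 < q" "q < 1" using x by (auto simp: q_def)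
  have qpow: "exp (- (x * real j)) = q ^ j" for j
    by (simp add: q_def exp_of_nat_mult [symmetric] mult.commute)
  define b where "b n = exp (- ((\<Sum>j=1..n. q ^ j) + (\<Sum>j=1..n. (q ^ 2) ^ j) / 2 + (\<Sum>j=1..n. (q ^ 3) ^ j) / 3 +
     (\<Sum>j=1..n. (q ^ 4) ^ j) / 4))" for n
  have prod_le: "shanks_prod x n 0 \<le> b n" for n
  proof -
    have "shanks_prod x n 0 = (\<Prod>j=1..n. 1 - q ^ j)"
      unfolding shanks_prod_def qpow by (intro prod.cong) auto
    also have "\<dots> \<le> (\<Prod>j=1..n. exp (- (q ^ j + (q ^ 2) ^ j / 2 + (q ^ 3) ^ j / 3 + (q ^ 4) ^ j / 4)))"
    proof (intro prod_mono conjI)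
      fix j assume "j \<in> {1..n}"
      then have qj: "0 \<le> q ^ j" "q ^ j < 1" using q by (auto simp: power_less_one_iff)
      then show "0 \<le> 1 - q ^ j" by simp
      have "(q ^ j) ^ k = (q ^ k) ^ j" for k by (simp add: mult.commute flip: power_mult)
      with one_minus_le_exp[OF qj]
      show "1 - q ^ j \<le> exp (- (q ^ j + (q ^ 2) ^ j / 2 + (q ^ 3) ^ j / 3 + (q ^ 4) ^ j / 4))"
        by (simp only:)
    qed
    also have "\<dots> = b n"
      unfolding b_def
      by (simp only: exp_sum [symmetric] finite_atLeastAtMost sum_negf sum.distrib sum_divide_distrib [symmetric])
    finally show ?thesis .
  qed
  have partial: "\<bar>\<Sum>m<n. (- 1) ^ m * (exp (- (x * pent m)) - exp (- (x * pent' m)))\<bar> \<le> b n + real n * q ^ n + q ^ n" for n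
  proof -
    have "\<bar>\<Sum>s\<le>n. shanks_term x n s\<bar> \<le> (\<Sum>s\<le>n. \<bar>shanks_term x n s\<bar>)" by (rule sum_abs)
    also have "\<dots> = \<bar>shanks_term x n 0\<bar> + (\<Sum>s=1..n. \<bar>shanks_term x n s\<bar>)"
    proof -
      have "{..n} = insert 0 {1..n}" by auto
      then show ?thesis by simp
    qed
    also have "\<bar>shanks_term x n 0\<bar> \<le> b n"
      using prod_le[of n] shanks_prod_bounds[OF x, of n 0] by (simp add: shanks_term_def)
    also have "(\<Sum>s=1..n. \<bar>shanks_term x n s\<bar>) \<le> (\<Sum>s=1..n. q ^ n)"
    proof (rule sum_mono)
      fix s assume s: "s \<in> {1..n}"
      have "\<bar>shanks_term x n s\<bar> = shanks_prod x n s * exp (- (x * (real n * real s + real s * (real s + 1) / 2)))"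
        using shanks_prod_bounds[OF x, of n s] by (simp add: shanks_term_def abs_mult power_abs)
      also have "\<dots> \<le> 1 * exp (- (x * real n))"
      proof (intro mult_mono)
        have "real n * 1 \<le> real n * real s" using s by (intro mult_left_mono) auto
        moreover have "0 \<le> real s * (real s + 1) / 2" by simp
        ultimately have "real n \<le> real n * real s + real s * (real s + 1) / 2" by linarith
        then show "exp (- (x * (real n * real s + real s * (real s + 1) / 2))) \<le> exp (- (x * real n))"
          using x by simp
      qed (use shanks_prod_bounds[OF x, of n s] in auto)
      finally show "\<bar>shanks_term x n s\<bar> \<le> q ^ n" by (simp add: qpow)
    qed
    finally have "\<bar>\<Sum>s\<le>n. shanks_term x n s\<bar> \<le> b n + real n * q ^ n" by simp
    moreover have "\<bar>(- 1) ^ n * exp (- (x * pent n))\<bar> \<le> q ^ n"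
    proof -
      have "exp (- (x * pent n)) \<le> exp (- (x * real n))" using x real_le_pent[of n] by simp
      then show ?thesis by (simp add: abs_mult power_abs qpow)
    qed
    ultimately show ?thesis unfolding shanks_identity by linarith
  qed
  have geo: "(\<lambda>n. \<Sum>j=1..n. r ^ j) \<longlonglongrightarrow> r / (1 - r)" if r: "0 < r" "r < 1" for r :: real
  proof -
    have "(\<lambda>n. r * (\<Sum>j<n. r ^ j)) \<longlonglongrightarrow> r * (1 / (1 - r))"
      using geometric_sums[of r] r by (intro tendsto_mult tendsto_const) (auto simp: sums_def)
    moreover have "r * (\<Sum>j<n. r ^ j) = (\<Sum>j=1..n. r ^ j)" for n
      by (simp add: sum_distrib_left sum.atLeast1_atMost_eq)
    ultimately show ?thesis by simp
  qed
  define L where "L = q / (1 - q) + (q ^ 2 / (1 - q ^ 2)) / 2 + (q ^ 3 / (1 - q ^ 3)) / 3 + (q ^ 4 / (1 - q ^ 4)) / 4"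
  have "(\<lambda>n. b n + real n * q ^ n + q ^ n) \<longlonglongrightarrow> exp (- L) + 0 + 0"
    unfolding b_def L_def using q
    by (intro tendsto_add tendsto_exp tendsto_minus tendsto_divide geo tendsto_const powser_times_n_limit_0 LIMSEQ_realpow_zero)
       (auto simp: power_less_one_iff)
  then have "\<bar>l\<bar> \<le> exp (- L) + 0 + 0"
    by (rule LIMSEQ_le[OF tendsto_rabs[OF full]]) (use partial in auto)
  also have "\<dots> \<le> exp (25 / 12 - 205 / (144 * x))"
  proof -
    have r: "q ^ k / (1 - q ^ k) \<ge> 1 / (x * real k) - 1" if "k > 0" for k
      using inverse_exp_minus_1_ge[of "x * real k"] x that by (simp add: qpow)
    have "L \<ge> (1 / x - 1) + (1 / (x * 2) - 1) / 2 + (1 / (x * 3) - 1) / 3 + (1 / (x * 4) - 1) / 4"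
      unfolding L_def using r[of 1] r[of 2] r[of 3] r[of 4] by (intro add_mono divide_right_mono) auto
    also have "(1 / x - 1) + (1 / (x * 2) - 1) / 2 + (1 / (x * 3) - 1) / 3 + (1 / (x * 4) - 1) / 4 =
      205 / (144 * x) - 25 / 12" using x by (simp add: field_simps)
    finally show ?thesis by simp
  qed
  finally show ?thesis .
qed

text \<open>Common to both signs of the real argument: P selects i < N for the partial sum and
  everything for the tail of the series. The limit series is geometric with ratio - exp (- 3 y), and
  \<open>bound\<close> provides the majorant 2 exp (- y)^i. After expansion by exp (3 y / 2) the
  denominator is 2 cosh (3 y / 2) = 2 cosh (y / 2) (2 cosh y - 1), whose last factor is Delta of the
  trefoil.\<close>

lemma alternating_exp_sum_tendsto:
  fixes A B :: "nat \<Rightarrow> nat \<Rightarrow> real" and P :: "nat \<Rightarrow> nat \<Rightarrow> bool"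
  assumes y: "y > 0"
    and A: "\<And>i. (\<lambda>N. A i N) \<longlonglongrightarrow> - ((3 * real i + 1 / 2) * y)"
    and B: "\<And>i. (\<lambda>N. B i N) \<longlonglongrightarrow> - ((3 * real i + 5 / 2) * y)"
    and P: "\<And>i. eventually (\<lambda>N. P i N) sequentially"
    and bound: "\<And>i N. N > 0 \<Longrightarrow> P i N \<Longrightarrow> A i N \<le> - (real i * y) \<and> B i N \<le> - (real i * y)"
  shows "(\<lambda>N. \<Sum>i. if P i N then (- 1) ^ i * (exp (A i N) - exp (B i N)) else 0)
    \<longlonglongrightarrow> 2 * sinh (y / 2) / (2 * cosh y - 1)"
proof -
  define t where "t i = (- 1) ^ i * (exp (- ((3 * real i + 1 / 2) * y)) - exp (- ((3 * real i + 5 / 2) * y)))" for i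
  have "(\<lambda>N. \<Sum>i. if P i N then (- 1) ^ i * (exp (A i N) - exp (B i N)) else 0) \<longlonglongrightarrow> suminf t"
  proof (rule tannerys_theorem[THEN conjunct2, THEN conjunct2])
    show "(\<lambda>N. if P i N then (- 1) ^ i * (exp (A i N) - exp (B i N)) else 0) \<longlonglongrightarrow> t i" for i
    proof (rule Lim_transform_eventually)
      show "(\<lambda>N. (- 1) ^ i * (exp (A i N) - exp (B i N))) \<longlonglongrightarrow> t i"
        unfolding t_def by (intro tendsto_intros A B)
      show "eventually (\<lambda>N. (- 1) ^ i * (exp (A i N) - exp (B i N)) =
        (if P i N then (- 1) ^ i * (exp (A i N) - exp (B i N)) else 0)) sequentially"
        using P[of i] by eventually_elim simp
    qed
    have "eventually (\<lambda>(i, N). N > 0) (at_top \<times>\<^sub>F sequentially)"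
      using eventually_gt_at_top[of 0]
      by (auto simp: eventually_prod_filter intro!: exI[of _ "\<lambda>_. True"] exI[of _ "\<lambda>N. N > 0"])
    then show "eventually (\<lambda>(i, N). norm (if P i N then (- 1) ^ i * (exp (A i N) - exp (B i N)) else 0) \<le>
      2 * exp (- y) ^ i) (at_top \<times>\<^sub>F sequentially)"
    proof (rule eventually_mono, clarify)
      fix i N :: nat assume N: "N > 0"
      show "norm (if P i N then (- 1) ^ i * (exp (A i N) - exp (B i N)) else 0) \<le> 2 * exp (- y) ^ i"
      proof (cases "P i N")
        case True
        have "exp (A i N) \<le> exp (- (real i * y))" "exp (B i N) \<le> exp (- (real i * y))"
          using bound[OF N True] by auto
        moreover have "exp (- (real i * y)) = exp (- y) ^ i" by (simp flip: exp_of_nat_mult)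
        moreover have "0 < exp (A i N)" "0 < exp (B i N)" by auto
        ultimately have "\<bar>exp (A i N) - exp (B i N)\<bar> \<le> 2 * exp (- y) ^ i" by linarith
        then show ?thesis using True by (simp add: abs_mult power_abs)
      qed simp
    qed
    show "summable (\<lambda>i. 2 * exp (- y) ^ i)" using y by (intro summable_mult summable_geometric) auto
  qed simp
  also have "suminf t = 2 * sinh (y / 2) / (2 * cosh y - 1)"
  proof -
    define u where "u = exp (y / 2)"
    have u: "u > 1" using y by (simp add: u_def)
    have e1: "exp (- (y / 2)) = 1 / u" unfolding u_def exp_minus inverse_eq_divide ..
    have e2: "exp y = u ^ 2" using exp_of_nat_mult[of 2 "y / 2"] by (simp add: u_def)
    have e3: "exp (- y) = 1 / u ^ 2" unfolding exp_minus e2 inverse_eq_divide ..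
    note e = e1 e2 e3
    have t: "t i = (1 / u - 1 / u ^ 5) * (- (1 / u ^ 6)) ^ i" for i
    proof -
      define w where "w = (1 / u) ^ (6 * i)"
      have "exp (- ((3 * real i + 1 / 2) * y)) = exp (- (y / 2)) * exp (- (y / 2)) ^ (6 * i)"
        unfolding exp_of_nat_mult [symmetric] exp_add [symmetric] by (rule arg_cong[where f = exp]) (simp add: field_simps)
      then have f1: "exp (- ((3 * real i + 1 / 2) * y)) = 1 / u * w" by (simp only: e w_def)
      have "exp (- ((3 * real i + 5 / 2) * y)) = exp (- (y / 2)) ^ 5 * exp (- (y / 2)) ^ (6 * i)"
        unfolding exp_of_nat_mult [symmetric] exp_add [symmetric] by (rule arg_cong[where f = exp]) (simp add: field_simps)
      then have f2: "exp (- ((3 * real i + 5 / 2) * y)) = 1 / u ^ 5 * w" by (simp only: e w_def power_one_over)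
      have f3: "(- (1 / u ^ 6)) ^ i = (- 1) ^ i * w"
        by (simp add: w_def power_minus[of "1 / u ^ 6"] power_mult power_divide)
      show ?thesis unfolding t_def f1 f2 f3 by (simp only: algebra_simps)
    qed
    have "suminf t = (1 / u - 1 / u ^ 5) * (1 / (1 - (- (1 / u ^ 6))))"
      unfolding t using u by (subst suminf_mult) (auto simp: suminf_geometric summable_geometric power_less_one_iff intro: one_less_power)
    also have "\<dots> = 2 * sinh (y / 2) / (2 * cosh y - 1)"
    proof -
      have s: "2 * sinh (y / 2) = u - 1 / u" "2 * cosh y - 1 = u ^ 2 + 1 / u ^ 2 - 1"
        using e by (simp_all add: sinh_field_def cosh_field_def u_def)
      have pos: "u ^ 4 - u ^ 2 + 1 > 0"
      proof -
        have "u ^ 4 \<ge> u ^ 2" using u by (intro power_increasing) auto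
        then show ?thesis by linarith
      qed
      have "(1 / u - 1 / u ^ 5) * (1 / (1 - (- (1 / u ^ 6)))) = (u ^ 5 - u) / (u ^ 6 + 1)"
      proof -
        have "1 / u - 1 / u ^ 5 = (u ^ 5 - u) / u ^ 6" "1 - (- (1 / u ^ 6)) = (u ^ 6 + 1) / u ^ 6"
          using u by (simp_all add: field_simps eval_nat_numeral)
        then show ?thesis using u by simp
      qed
      \<comment> \<open>The common factor u^2 + 1 of u^5 - u and u^6 + 1 cancels.\<close>
      also have "\<dots> = (u - 1 / u) * u ^ 2 / (u ^ 4 - u ^ 2 + 1)"
      proof -
        have "u ^ 6 + 1 > 0" using u by (intro add_pos_pos) auto
        moreover have "(u ^ 5 - u) * (u ^ 4 - u ^ 2 + 1) = (u - 1 / u) * u ^ 2 * (u ^ 6 + 1)"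
          using u by (simp add: field_simps eval_nat_numeral)
        ultimately show ?thesis using pos by (simp add: frac_eq_eq)
      qed
      also have "\<dots> = (u - 1 / u) / (u ^ 2 + 1 / u ^ 2 - 1)"
      proof -
        have "u ^ 2 + 1 / u ^ 2 - 1 = (u ^ 4 - u ^ 2 + 1) / u ^ 2" using u by (simp add: field_simps eval_nat_numeral)
        then show ?thesis by simp
      qed
      finally show ?thesis unfolding s .
    qed
    finally show ?thesis .
  qed
  finally show ?thesis .
qed

text \<open>The terms grow with m, so the sum is read from the top, i = N - 1 - m. Combined with the
  factor exp (- 3/2 N^2 h), the exponents become \<open>A i N\<close> for the \<open>pent'\<close>
  term and \<open>B i N\<close> for the \<open>pent\<close> term; the reversal contributes the sign
  that makes A the positive one.\<close>

lemma trefoil_jones_tendsto_pos: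
  assumes y: "y > 0"
  shows "(\<lambda>N. torus_jones 2 3 N (of_real y / of_nat N)) \<longlonglongrightarrow> of_real (1 / (2 * cosh y - 1))"
proof -
  define A where "A i N = (- 6 * real N * real i - real N + 3 * (real i)\<^sup>2 + real i) / 2 * (y / real N)" for i N
  define B where "B i N = (- 6 * real N * (real i + 1) + real N + 3 * (real i + 1)\<^sup>2 - (real i + 1)) / 2 * (y / real N)" for i N
  define S where "S N = (\<Sum>i. if i < N then (- 1) ^ i * (exp (A i N) - exp (B i N)) else 0)" for N
  have S: "S \<longlonglongrightarrow> 2 * sinh (y / 2) / (2 * cosh y - 1)"
    unfolding S_def
  proof (rule alternating_exp_sum_tendsto[OF y])
    show "(\<lambda>N. A i N) \<longlonglongrightarrow> - ((3 * real i + 1 / 2) * y)" for i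
      unfolding A_def by (real_asymp; simp add: field_simps)
    show "(\<lambda>N. B i N) \<longlonglongrightarrow> - ((3 * real i + 5 / 2) * y)" for i
      unfolding B_def by (real_asymp; simp add: field_simps)
    show "eventually (\<lambda>N. i < N) sequentially" for i by (rule eventually_gt_at_top)
    fix i N :: nat assume N: "N > 0" "i < N"
    define M where "M = real N"
    define d where "d = real i"
    have r: "0 \<le> d" "d + 1 \<le> M" using N by (auto simp: d_def M_def)
    have "d * d \<le> M * d" using r by (intro mult_right_mono) auto
    moreover have Md: "0 \<le> M * d" using r by simp
    ultimately have "3 * (d * d) + d - M \<le> 4 * (M * d)" using r by linarith
    then have "(- 6 * M * d - M + 3 * d\<^sup>2 + d) / 2 \<le> - (M * d)" by (simp add: power2_eq_square)
    moreover have "(d + 1) * (d + 1) \<le> M * (d + 1)" using r by (intro mult_right_mono) auto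
    then have "(d + 1) * d + (d + 1) \<le> M * d + M" by (simp add: distrib_left)
    then have "2 * d + (3 * ((d + 1) * d) + (2 - 5 * M)) \<le> 4 * (M * d)" using Md r by linarith
    then have "(- 6 * M * (d + 1) + M + 3 * (d + 1)\<^sup>2 - (d + 1)) / 2 \<le> - (M * d)"
      using r by (simp add: power2_eq_square distrib_left)
    ultimately have "A i N \<le> - (M * d) * (y / real N)" "B i N \<le> - (M * d) * (y / real N)"
      unfolding A_def B_def M_def d_def using y by (intro mult_right_mono; simp)+
    then show "A i N \<le> - (real i * y) \<and> B i N \<le> - (real i * y)"
      using N by (simp add: M_def d_def)
  qed
  have "(\<lambda>N. exp (y / real N) * S N / (2 * sinh (y / 2))) \<longlonglongrightarrow>
     exp 0 * (2 * sinh (y / 2) / (2 * cosh y - 1)) / (2 * sinh (y / 2))"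
    using y by (intro tendsto_intros S real_tendsto_divide_at_top[OF tendsto_const] filterlim_real_sequentially) auto
  also have "exp 0 * (2 * sinh (y / 2) / (2 * cosh y - 1)) / (2 * sinh (y / 2)) = 1 / (2 * cosh y - 1)"
    using y by simp
  finally have "(\<lambda>N. complex_of_real (exp (y / real N) * S N / (2 * sinh (y / 2)))) \<longlonglongrightarrow> of_real (1 / (2 * cosh y - 1))"
    by (rule tendsto_of_real)
  then show ?thesis
  proof (rule Lim_transform_eventually)
    show "eventually (\<lambda>N. complex_of_real (exp (y / real N) * S N / (2 * sinh (y / 2))) =
      torus_jones 2 3 N (of_real y / of_nat N)) sequentially"
      using eventually_gt_at_top[of 0]
    proof eventually_elim
      case (elim N)
      define h where "h = y / real N"
      have h: "h \<noteq> 0" using y elim by (simp add: h_def)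
      let ?f = "\<lambda>m. (- 1) ^ m * (exp (pent m * h) - exp (pent' m * h))"
      have "(- 1) ^ N * exp (h - 3 / 2 * (real N)\<^sup>2 * h) * (\<Sum>m<N. ?f m) =
        (- 1) ^ N * exp (h - 3 / 2 * (real N)\<^sup>2 * h) * (\<Sum>i<N. ?f (N - Suc i))"
        using sum.nat_diff_reindex[of ?f N] by (simp only:)
      also have "\<dots> = exp h * (\<Sum>i<N. (- 1) ^ i * (exp (A i N) - exp (B i N)))"
        unfolding sum_distrib_left
      proof (intro sum.cong refl)
        fix i assume "i \<in> {..<N}"
        then have i: "i < N" by simp
        have r: "real (N - Suc i) = real N - real i - 1" using i by (simp add: of_nat_diff)
        have AB: "pent' (N - Suc i) * h = 3 / 2 * (real N)\<^sup>2 * h + A i N"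
          "pent (N - Suc i) * h = 3 / 2 * (real N)\<^sup>2 * h + B i N"
          unfolding pent_def pent'_def r A_def B_def h_def [symmetric]
          by (simp_all add: field_simps power2_eq_square)
        have sgn: "(- 1) ^ N * (- 1) ^ (N - Suc i) = - ((- 1) ^ i :: real)"
        proof -
          have "N = Suc i + (N - Suc i)" using i by simp
          then have "(- 1) ^ N * (- 1) ^ (N - Suc i) = (- 1) ^ Suc i * ((- 1) ^ (N - Suc i) * (- 1) ^ (N - Suc i) :: real)"
            by (metis mult.assoc power_add)
          then show ?thesis by (simp flip: power_add mult_2)
        qed
        have exps: "exp (h - 3 / 2 * (real N)\<^sup>2 * h) * exp (3 / 2 * (real N)\<^sup>2 * h) = exp h"
          by (simp flip: exp_add)
        have "(- 1) ^ N * exp (h - 3 / 2 * (real N)\<^sup>2 * h) * ?f (N - Suc i) =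
          ((- 1) ^ N * (- 1) ^ (N - Suc i)) *
          ((exp (h - 3 / 2 * (real N)\<^sup>2 * h) * exp (3 / 2 * (real N)\<^sup>2 * h)) * (exp (B i N) - exp (A i N)))"
          unfolding AB exp_add by (simp only: algebra_simps)
        also have "\<dots> = exp h * ((- 1) ^ i * (exp (A i N) - exp (B i N)))"
          unfolding sgn exps by (simp add: algebra_simps)
        finally show "(- 1) ^ N * exp (h - 3 / 2 * (real N)\<^sup>2 * h) * ?f (N - Suc i) =
          exp h * ((- 1) ^ i * (exp (A i N) - exp (B i N)))" .
      qed
      also have "(\<Sum>i<N. (- 1) ^ i * (exp (A i N) - exp (B i N))) = S N"
        unfolding S_def by (subst suminf_finite[of "{..<N}"]) auto
      finally have eq: "(- 1) ^ N * exp (h - 3 / 2 * (real N)\<^sup>2 * h) * (\<Sum>m<N. ?f m) = exp h * S N" .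
      have "torus_jones 2 3 N (of_real y / of_nat N) = torus_jones 2 3 N (of_real h)" by (simp add: h_def)
      also have "\<dots> = of_real (exp h * S N / (2 * sinh (real N / 2 * h)))"
        unfolding trefoil_jones_real[OF elim h] eq ..
      also have "real N / 2 * h = y / 2" using elim by (simp add: h_def)
      finally show ?case by (simp add: h_def)
    qed
  qed
qed

lemma fig8_root_square: "fig8_root\<^sup>2 < 205 / 216"
proof -
  have "fig8_root\<^sup>2 \<le> (97 / 100)\<^sup>2" using fig8_root_gt fig8_root_less by (intro power_mono) auto
  then show ?thesis by (simp add: power2_eq_square)
qed

lemma trefoil_jones_tendsto_neg:
  assumes y: "0 < y" "y \<le> fig8_root"
  shows "(\<lambda>N. torus_jones 2 3 N (of_real (- y) / of_nat N)) \<longlonglongrightarrow> of_real (1 / (2 * cosh y - 1))"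
proof -
  \<comment> \<open>The exponents of the tail at m = N + i: 3/2 N y minus y/N times
    \<open>pent m\<close>, and for B the same with \<open>pent' m\<close>.\<close>
  define A where "A i N = - ((6 * real N * real i + real N + 3 * (real i)\<^sup>2 + real i) / 2 * (y / real N))" for i N
  define B where "B i N = - ((6 * real N * (real i + 1) - real N + 3 * (real i + 1)\<^sup>2 - (real i + 1)) / 2 * (y / real N))" for i N
  \<comment> \<open>The tail is an infinite series; the condition \<open>True\<close> fits it to
    \<open>alternating_exp_sum_tendsto\<close>.\<close>
  define S where "S N = (\<Sum>i. if True then (- 1) ^ i * (exp (A i N) - exp (B i N)) else 0)" for N
  have S: "S \<longlonglongrightarrow> 2 * sinh (y / 2) / (2 * cosh y - 1)"
    unfolding S_def
  proof (rule alternating_exp_sum_tendsto[OF y(1)])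
    show "(\<lambda>N. A i N) \<longlonglongrightarrow> - ((3 * real i + 1 / 2) * y)" for i
      unfolding A_def by (real_asymp; simp add: field_simps)
    show "(\<lambda>N. B i N) \<longlonglongrightarrow> - ((3 * real i + 5 / 2) * y)" for i
      unfolding B_def by (real_asymp; simp add: field_simps)
    show "eventually (\<lambda>N. True) sequentially" by simp
    fix i N :: nat assume N: "N > 0"
    define M where "M = real N"
    define d where "d = real i"
    have r: "0 \<le> d" "1 \<le> M" using N by (auto simp: d_def M_def)
    have nn: "0 \<le> M * d" "0 \<le> d * d" using r by auto
    have "M * d \<le> (6 * M * d + M + 3 * d\<^sup>2 + d) / 2" using r nn by (simp add: power2_eq_square)
    moreover have "M * d \<le> (6 * M * (d + 1) - M + 3 * (d + 1)\<^sup>2 - (d + 1)) / 2"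
      using r nn by (simp add: power2_eq_square algebra_simps)
    ultimately have "(M * d) * (y / real N) \<le> - A i N" "(M * d) * (y / real N) \<le> - B i N"
      unfolding A_def B_def M_def d_def minus_minus using y by (intro mult_right_mono; simp)+
    then show "A i N \<le> - (real i * y) \<and> B i N \<le> - (real i * y)"
      using N by (simp add: M_def d_def)
  qed
  define f where "f x m = (- 1) ^ m * (exp (- (x * pent m)) - exp (- (x * pent' m)))" for x :: real and m
  have f_summable: "summable (f x)" if x: "x > 0" for x
  proof (rule summable_comparison_test)
    show "\<exists>M. \<forall>m\<ge>M. norm (f x m) \<le> 2 * exp (- x) ^ m"
    proof (intro exI allI impI)
      fix m :: nat
      have nn: "0 \<le> real m * real m" by simp
      note real_le_pent[of m]
      moreover have "real m \<le> pent' m" using nn unfolding pent'_def by (simp add: algebra_simps)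
      ultimately have "exp (- (x * pent m)) \<le> exp (- (x * real m))" "exp (- (x * pent' m)) \<le> exp (- (x * real m))"
        using x by auto
      moreover have "exp (- (x * real m)) = exp (- x) ^ m" by (simp add: mult.commute flip: exp_of_nat_mult)
      moreover have "0 < exp (- (x * pent m))" "0 < exp (- (x * pent' m))" by auto
      ultimately have "\<bar>exp (- (x * pent m)) - exp (- (x * pent' m))\<bar> \<le> 2 * exp (- x) ^ m" by linarith
      then show "norm (f x m) \<le> 2 * exp (- x) ^ m" by (simp add: f_def abs_mult power_abs)
    qed
    show "summable (\<lambda>m. 2 * exp (- x) ^ m)" using x by (intro summable_mult summable_geometric) auto
  qed
  \<comment> \<open>The sum is the full pentagonal series minus its tail. The full series is of order
    \<open>exp (- pi\<^sup>2 / (6 x))\<close> with \<open>x = y / N\<close>, which beats the prefactor \<open>exp (3 N y / 2)\<close>.\<close>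
  define R where "R N = (- 1) ^ N * exp (3 / 2 * real N * y - y / real N) * suminf (f (y / real N))" for N
  \<comment> \<open>The rate that is left when the bound of \<open>pentagonal_sum_bound\<close> at x
    = y/N meets the prefactor; it is positive precisely for y^2 < 205/216.\<close>
  define c where "c = 205 / (144 * y) - 3 / 2 * y"
  have "c > 0"
  proof -
    have "y * y \<le> fig8_root * fig8_root" using y by (intro mult_mono) auto
    then have "y * y < 205 / 216" using fig8_root_square by (simp add: power2_eq_square)
    then show ?thesis using y by (simp add: c_def field_simps)
  qed
  have R: "R \<longlonglongrightarrow> 0"
  proof (rule Lim_null_comparison)
    show "eventually (\<lambda>N. norm (R N) \<le> exp (25 / 12 - c * real N)) sequentially"
      using eventually_gt_at_top[of 0]
    proof eventually_elim
      case (elim N)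
      define x where "x = y / real N"
      have x: "x > 0" using y elim by (simp add: x_def)
      have "(\<lambda>n. \<Sum>m<n. f x m) \<longlonglongrightarrow> suminf (f x)" by (rule summable_LIMSEQ[OF f_summable[OF x]])
      then have "\<bar>suminf (f x)\<bar> \<le> exp (25 / 12 - 205 / (144 * x))"
        unfolding f_def by (rule pentagonal_sum_bound[OF x])
      moreover have "exp (3 / 2 * real N * y - x) \<le> exp (3 / 2 * real N * y)" using x by simp
      ultimately have "exp (3 / 2 * real N * y - x) * \<bar>suminf (f x)\<bar> \<le>
        exp (3 / 2 * real N * y) * exp (25 / 12 - 205 / (144 * x))" by (intro mult_mono) auto
      also have "\<dots> = exp (25 / 12 - c * real N)"
      proof -
        have "3 / 2 * real N * y + (25 / 12 - 205 / (144 * x)) = 25 / 12 - c * real N"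
          using elim y by (simp add: c_def x_def field_simps)
        then show ?thesis by (simp flip: exp_add)
      qed
      finally show ?case by (simp add: R_def x_def abs_mult power_abs)
    qed
    show "(\<lambda>N. exp (25 / 12 - c * real N)) \<longlonglongrightarrow> 0" using \<open>c > 0\<close> by real_asymp
  qed
  have "(\<lambda>N. (exp (- (y / real N)) * S N - R N) / (2 * sinh (y / 2))) \<longlonglongrightarrow>
     (exp (- 0) * (2 * sinh (y / 2) / (2 * cosh y - 1)) - 0) / (2 * sinh (y / 2))"
    using y by (intro tendsto_intros S R real_tendsto_divide_at_top[OF tendsto_const] filterlim_real_sequentially) auto
  also have "(exp (- 0) * (2 * sinh (y / 2) / (2 * cosh y - 1)) - 0) / (2 * sinh (y / 2)) = 1 / (2 * cosh y - 1)"
    using y by simp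
  finally have "(\<lambda>N. complex_of_real ((exp (- (y / real N)) * S N - R N) / (2 * sinh (y / 2)))) \<longlonglongrightarrow> of_real (1 / (2 * cosh y - 1))"
    by (rule tendsto_of_real)
  then show ?thesis
  proof (rule Lim_transform_eventually)
    show "eventually (\<lambda>N. complex_of_real ((exp (- (y / real N)) * S N - R N) / (2 * sinh (y / 2))) =
      torus_jones 2 3 N (of_real (- y) / of_nat N)) sequentially"
      using eventually_gt_at_top[of 0]
    proof eventually_elim
      case (elim N)
      define x where "x = y / real N"
      have x: "x > 0" using y elim by (simp add: x_def)
      define E where "E = exp (3 / 2 * real N * y - x)"
      have NN: "3 / 2 * (real N)\<^sup>2 * x = 3 / 2 * real N * y" using elim by (simp add: x_def power2_eq_square)
      have tail: "E * f x (i + N) = (- 1) ^ N * (exp (- x) * ((- 1) ^ i * (exp (A i N) - exp (B i N))))" for i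
      proof -
        have "3 / 2 * real N * y + - (x * pent (i + N)) = A i N" "3 / 2 * real N * y + - (x * pent' (i + N)) = B i N"
          unfolding NN [symmetric] pent_def pent'_def A_def B_def x_def [symmetric]
          by (simp_all add: field_simps power2_eq_square)
        then have "exp (A i N) = exp (3 / 2 * real N * y) * exp (- (x * pent (i + N)))"
          "exp (B i N) = exp (3 / 2 * real N * y) * exp (- (x * pent' (i + N)))"
          by (simp_all only: exp_add [symmetric])
        moreover have "E = exp (3 / 2 * real N * y) * exp (- x)" by (simp add: E_def flip: exp_add)
        ultimately show ?thesis by (simp add: f_def power_add algebra_simps)
      qed
      have "suminf (f x) = (\<Sum>i. f x (i + N)) + (\<Sum>m<N. f x m)"
        by (rule suminf_split_initial_segment[OF f_summable[OF x]])
      moreover have "E * (\<Sum>i. f x (i + N)) = (- 1) ^ N * (exp (- x) * S N)"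
      proof -
        have "E * (\<Sum>i. f x (i + N)) = (\<Sum>i. E * f x (i + N))"
          by (rule suminf_mult [symmetric]) (use f_summable[OF x] in \<open>simp add: summable_iff_shift\<close>)
        also have "\<dots> = (\<Sum>i. (- 1) ^ N * exp (- x) * ((- 1) ^ i * (exp (A i N) - exp (B i N))))"
          unfolding tail by (simp add: mult.assoc)
        also have "\<dots> = (- 1) ^ N * exp (- x) * S N"
          unfolding S_def if_True
        proof (rule suminf_mult)
          have "summable (\<lambda>i. E * f x (i + N))"
            using f_summable[OF x] by (intro summable_mult) (simp add: summable_iff_shift)
          then have "summable (\<lambda>i. ((- 1) ^ N * exp (- x)) * ((- 1) ^ i * (exp (A i N) - exp (B i N))))"
            unfolding tail by (simp add: mult.assoc)
          then show "summable (\<lambda>i. (- 1) ^ i * (exp (A i N) - exp (B i N)))"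
            by (subst (asm) summable_cmult_iff) simp
        qed
        finally show ?thesis by (simp add: mult.assoc)
      qed
      ultimately have "E * (\<Sum>m<N. f x m) = E * suminf (f x) - (- 1) ^ N * (exp (- x) * S N)"
        by (simp add: algebra_simps)
      then have "(- 1) ^ N * (E * (\<Sum>m<N. f x m)) = R N - (- 1) ^ N * ((- 1) ^ N * (exp (- x) * S N))"
        unfolding R_def x_def [symmetric] E_def [symmetric] by (simp only: right_diff_distrib mult.assoc)
      moreover have "(- 1) ^ N * ((- 1) ^ N * (exp (- x) * S N)) = exp (- x) * S N"
        by (simp flip: mult.assoc power_add mult_2)
      ultimately have eq: "(- 1) ^ N * (E * (\<Sum>m<N. f x m)) = R N - exp (- x) * S N" by simp
      have fx: "(- 1) ^ m * (exp (pent m * (- x)) - exp (pent' m * (- x))) = f x m" for m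
        by (simp add: f_def mult.commute)
      have Ex: "exp (- x - 3 / 2 * (real N)\<^sup>2 * (- x)) = E"
        unfolding E_def by (rule arg_cong[where f = exp]) (use NN in simp)
      have "torus_jones 2 3 N (of_real (- y) / of_nat N) = torus_jones 2 3 N (of_real (- x))" by (simp add: x_def)
      also have "\<dots> = of_real ((- 1) ^ N * E * (\<Sum>m<N. f x m) / (2 * sinh (real N / 2 * (- x))))"
        using trefoil_jones_real[OF elim, of "- x"] x unfolding fx Ex by simp
      also have "(- 1) ^ N * E * (\<Sum>m<N. f x m) = R N - exp (- x) * S N" using eq by (simp only: mult.assoc)
      also have "real N / 2 * (- x) = - (y / 2)" using elim by (simp add: x_def)
      also have "(R N - exp (- x) * S N) / (2 * sinh (- (y / 2))) = (exp (- x) * S N - R N) / (2 * sinh (y / 2))"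
        by (simp only: sinh_minus mult_minus_right minus_divide_right [symmetric])
           (simp only: minus_divide_left minus_diff_eq)
      finally show ?case by (simp only: x_def)
    qed
  qed
qed

subsection \<open>Connected sums\<close>

lemma sinh_eq_0_small:
  fixes w :: complex
  assumes "sinh w = 0" "norm w < pi"
  shows "w = 0"
proof -
  have "sin (\<i> * w) = 0" using assms(1) by (simp add: sinh_conv_sin)
  then obtain n :: int where n: "\<i> * w = of_real (of_int n * pi)" by (auto simp: sin_eq_0)
  then have "norm w = \<bar>of_int n\<bar> * pi"
    by (metis abs_mult abs_of_pos mult_1 norm_ii norm_mult norm_of_real pi_gt_zero)
  then have "\<bar>of_int n\<bar> * pi < 1 * pi" using assms(2) by simp
  then have "\<bar>n\<bar> < 1" by (simp only: mult_less_cancel_right_pos pi_gt_zero; linarith)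
  then show ?thesis using n by simp
qed

context
  fixes a b :: nat
  assumes ab: "a > 1" "b > 1"
begin

lemma ab_pos: "real a > 0" "real b > 0" "real a * real b > 0"
  using ab by auto

text \<open>On the closed disc up to the first zero, a |z| / 2 <= pi / b and b |z| / 2 <= pi / a
  stay below pi. So the quotient formula for Delta is valid there away from 0.\<close>

lemma sinh_factor_nonzero:
  fixes z :: complex
  assumes z: "z \<noteq> 0" "norm z \<le> 2 * pi / (real a * real b)"
  shows "sinh (of_nat a / 2 * z) \<noteq> 0" "sinh (of_nat b / 2 * z) \<noteq> 0" "sinh (z / 2) \<noteq> 0"
proof -
  have nz: "real a * real b * norm z \<le> 2 * pi" using z(2) ab_pos by (simp add: field_simps)
  have n0: "norm z > 0" using z by simp
  have "2 * (real b * norm z) \<le> real a * (real b * norm z)" "2 * (real a * norm z) \<le> real b * (real a * norm z)"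
    using ab n0 by (intro mult_right_mono; simp)+
  moreover have "1 * norm z < real b * norm z" using ab n0 by (intro mult_strict_right_mono) auto
  ultimately have le: "real b * norm z \<le> pi" "real a * norm z \<le> pi" "norm z < pi"
    using nz by (simp_all add: mult_ac)
  have ne: "sinh (of_real r * z) \<noteq> 0" if "r > 0" "r * norm z < pi" for r
  proof
    assume "sinh (of_real r * z) = 0"
    moreover have "norm (of_real r * z) < pi" using that by (simp add: norm_mult)
    ultimately have "of_real r * z = 0" by (rule sinh_eq_0_small)
    then show False using that z by simp
  qed
  have "real b * norm z > 0" "real a * norm z > 0" using n0 ab by auto
  then have "real a / 2 * norm z < pi" "real b / 2 * norm z < pi" "1 / 2 * norm z < pi"
    using le n0 by auto
  then show "sinh (of_nat a / 2 * z) \<noteq> 0" "sinh (of_nat b / 2 * z) \<noteq> 0" "sinh (z / 2) \<noteq> 0"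
    using ne[of "real a / 2"] ne[of "real b / 2"] ne[of "1 / 2"] ab by auto
qed

text \<open>All four hyperbolic sines are odd. The norm bound keeps z on the disc where the quotient
  formula is available, which is also where mirror images use the evenness.\<close>

lemma torus_alexander_minus:
  assumes "norm z \<le> 2 * pi / (real a * real b)"
  shows "torus_alexander a b (- z) = torus_alexander a b z"
proof (cases "z = 0")
  case False
  note nz = sinh_factor_nonzero[OF False assms]
  show ?thesis
    by (subst (1 2) torus_alexander_eq) (use nz in simp_all)
qed simp

text \<open>A zero can only come from sinh (a b z / 2), so z is an integer multiple of 2 pi i / (a
  b). The value 1 at z = 0 excludes the multiple 0, and the norm bound leaves 1 and - 1.\<close>

lemma torus_alexander_eq_0D:
  assumes z: "torus_alexander a b z = 0" "norm z \<le> 2 * pi / (real a * real b)"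
  shows "\<exists>\<theta>. z = \<i> * of_real \<theta> \<and> \<bar>\<theta>\<bar> = 2 * pi / (real a * real b)"
proof -
  have z0: "z \<noteq> 0" using z(1) torus_alexander_0[of a b] ab by auto
  note nz = sinh_factor_nonzero[OF z0 z(2)]
  have "sinh (of_nat a * of_nat b / 2 * z) = 0"
    using z(1) nz unfolding torus_alexander_eq[OF nz(1,2)] by auto
  then have "sin (\<i> * (of_nat a * of_nat b / 2 * z)) = 0" by (simp add: sinh_conv_sin)
  then obtain n :: int where "\<i> * (of_nat a * of_nat b / 2 * z) = of_real (of_int n * pi)"
    by (auto simp: sin_eq_0)
  then have "\<i> * z = of_real (of_int n * (2 * pi / (real a * real b)))"
    using ab by (simp add: field_simps)
  then have zn: "z = \<i> * of_real (- of_int n * (2 * pi / (real a * real b)))"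
    by (simp add: complex_eq_iff)
  then have "norm z = \<bar>- of_int n * (2 * pi / (real a * real b))\<bar>"
    by (simp only: norm_mult norm_ii norm_of_real mult_1)
  then have norm: "norm z = \<bar>of_int n\<bar> * (2 * pi / (real a * real b))"
    using ab_pos by (simp add: abs_mult)
  have p: "2 * pi / (real a * real b) > 0" using ab_pos by simp
  have "\<bar>of_int n\<bar> * (2 * pi / (real a * real b)) \<le> 1 * (2 * pi / (real a * real b))"
    using z(2) norm by simp
  then have "\<bar>of_int n\<bar> \<le> (1::real)" using p by (simp only: mult_le_cancel_right_pos)
  moreover have "n \<noteq> 0" using zn z0 by auto
  ultimately have "\<bar>of_int n\<bar> = (1::real)" by linarith
  then show ?thesis using zn p by (intro exI[of _ "- of_int n * (2 * pi / (real a * real b))"]) (simp only: abs_mult abs_minus_cancel, simp)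
qed

lemma torus_alexander_imaginary:
  assumes \<theta>: "\<theta> \<noteq> 0" "\<bar>\<theta>\<bar> * (real a * real b) \<le> 2 * pi"
  shows "torus_alexander a b (\<i> * of_real \<theta>) =
    of_real (sin (\<theta> * (real a * real b) / 2) * sin (\<theta> / 2) / (sin (\<theta> * real a / 2) * sin (\<theta> * real b / 2)))"
    and "sin (\<theta> * real a / 2) \<noteq> 0" "sin (\<theta> * real b / 2) \<noteq> 0" "sin (\<theta> / 2) \<noteq> 0"
proof -
  have z: "\<i> * complex_of_real \<theta> \<noteq> 0" "norm (\<i> * complex_of_real \<theta>) \<le> 2 * pi / (real a * real b)"
    using \<theta> ab_pos by (auto simp: norm_mult field_simps)
  have s: "sinh (of_nat a * of_nat b / 2 * (\<i> * complex_of_real \<theta>)) = \<i> * of_real (sin (\<theta> * (real a * real b) / 2))"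
    "sinh (of_nat a / 2 * (\<i> * complex_of_real \<theta>)) = \<i> * of_real (sin (\<theta> * real a / 2))"
    "sinh (of_nat b / 2 * (\<i> * complex_of_real \<theta>)) = \<i> * of_real (sin (\<theta> * real b / 2))"
    "sinh (\<i> * complex_of_real \<theta> / 2) = \<i> * of_real (sin (\<theta> / 2))"
    by (simp_all add: sinh_conv_sin mult_ac flip: sin_of_real)
  note nz = sinh_factor_nonzero[OF z]
  then show "sin (\<theta> * real a / 2) \<noteq> 0" "sin (\<theta> * real b / 2) \<noteq> 0" "sin (\<theta> / 2) \<noteq> 0"
    unfolding s by auto
  show "torus_alexander a b (\<i> * of_real \<theta>) =
    of_real (sin (\<theta> * (real a * real b) / 2) * sin (\<theta> / 2) / (sin (\<theta> * real a / 2) * sin (\<theta> * real b / 2)))"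
    unfolding torus_alexander_eq[OF nz(1,2)] s by simp
qed

end

text \<open>Duplication of sinh reduces the quotient to cosh (3 r / 2) / cosh (r / 2).\<close>

lemma trefoil_alexander_real:
  fixes r :: real
  assumes "r \<noteq> 0"
  shows "torus_alexander 2 3 (of_real r) = of_real (2 * cosh r - 1)"
proof -
  have s: "sinh (of_nat 2 * of_nat 3 / 2 * complex_of_real r) = of_real (sinh (2 * (3 / 2 * r)))"
    "sinh (of_nat 2 / 2 * complex_of_real r) = of_real (sinh (2 * (r / 2)))"
    "sinh (of_nat 3 / 2 * complex_of_real r) = of_real (sinh (3 / 2 * r))"
    "sinh (complex_of_real r / 2) = of_real (sinh (r / 2))"
    by (simp_all add: sinh_field_def flip: exp_of_real)
  have nz: "sinh (3 / 2 * r) \<noteq> 0" "sinh (r / 2) \<noteq> 0" "sinh (2 * (r / 2)) \<noteq> 0" using assms by auto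
  have c: "cosh (r / 2) > 0" by (rule cosh_real_pos)
  have "torus_alexander 2 3 (of_real r) = of_real (sinh (2 * (3 / 2 * r)) * sinh (r / 2) / (sinh (2 * (r / 2)) * sinh (3 / 2 * r)))"
    using nz by (subst torus_alexander_eq) (simp_all only: s of_real_eq_0_iff not_False_eq_True, simp)
  also have "sinh (2 * (3 / 2 * r)) * sinh (r / 2) / (sinh (2 * (r / 2)) * sinh (3 / 2 * r)) = cosh (3 / 2 * r) / cosh (r / 2)"
    using nz unfolding sinh_double by simp
  also have "cosh (3 / 2 * r) = cosh (2 * (r / 2) + r / 2)" by (rule arg_cong[where f = cosh]) simp
  also have "\<dots> = cosh (r / 2) * (cosh r + 2 * (sinh (r / 2))\<^sup>2)"
    unfolding cosh_add sinh_double by (simp add: power2_eq_square algebra_simps)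
  also have "2 * (sinh (r / 2))\<^sup>2 = cosh r - 1"
    using cosh_double[of "r / 2"] by (simp add: cosh_square_eq)
  finally show ?thesis using c by simp
qed

section \<open>Torus summands up to and at their first zero\<close>

lemma torus_sum_cnj: "torus_sum a b N (cnj h) = cnj (torus_sum a b N h)"
  by (simp add: torus_sum_def Let_def exp_cnj)

text \<open>The Laurent polynomial has real coefficients. Conjugation carries the growth at 2 pi i /
  (a b) over to the opposite zero.\<close>

lemma torus_jones_cnj:
  assumes "sinh (of_nat N / 2 * h) \<noteq> 0"
  shows "torus_jones a b N (cnj h) = cnj (torus_jones a b N h)"
proof -
  have c: "sinh (of_nat N / 2 * cnj h) = cnj (sinh (of_nat N / 2 * h))"
    by (simp add: sinh_field_def exp_cnj)
  then have "sinh (of_nat N / 2 * cnj h) \<noteq> 0" using assms by simp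
  then show ?thesis
    unfolding torus_jones_eq[OF assms] torus_jones_eq[OF \<open>sinh (of_nat N / 2 * cnj h) \<noteq> 0\<close>]
    unfolding c by (simp add: torus_sum_cnj exp_cnj)
qed

lemma torus_jones_growth:
  assumes ab: "a > 1" "b > 1" and c: "c = \<i> * of_real \<theta>" "\<bar>\<theta>\<bar> = 2 * pi / (real a * real b)"
  shows "\<exists>C. C \<noteq> 0 \<and> (\<lambda>N. torus_jones a b N (c / of_nat N) / of_real (real N powr (1 / 2))) \<longlonglongrightarrow> C"
proof -
  define \<phi> where "\<phi> = 2 * pi / (real a * real b)"
  obtain C where C: "C \<noteq> 0"
    "(\<lambda>N. torus_jones a b N (\<i> * of_real \<phi> / of_nat N) / of_real (sqrt (real N))) \<longlonglongrightarrow> C"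
    unfolding \<phi>_def by (rule torus_jones_imaginary_growth[OF ab])
  have "\<exists>C. C \<noteq> 0 \<and> (\<lambda>N. torus_jones a b N (c / of_nat N) / of_real (sqrt (real N))) \<longlonglongrightarrow> C"
  proof (cases "\<theta> \<ge> 0")
    case True
    then have "\<theta> = \<phi>" using c by (simp add: \<phi>_def)
    then show ?thesis using C c by blast
  next
    case False
    then have th: "\<theta> = - \<phi>" using c by (simp add: \<phi>_def)
    have "(\<lambda>N. cnj (torus_jones a b N (\<i> * of_real \<phi> / of_nat N) / of_real (sqrt (real N)))) \<longlonglongrightarrow> cnj C"
      using C(2) by (rule tendsto_cnj)
    then have "(\<lambda>N. torus_jones a b N (c / of_nat N) / of_real (sqrt (real N))) \<longlonglongrightarrow> cnj C"
    proof (rule Lim_transform_eventually)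
      show "eventually (\<lambda>N. cnj (torus_jones a b N (\<i> * of_real \<phi> / of_nat N) / of_real (sqrt (real N))) =
        torus_jones a b N (c / of_nat N) / of_real (sqrt (real N))) sequentially"
        using eventually_gt_at_top[of 0]
      proof eventually_elim
        case (elim N)
        have "\<phi> > 0" using ab by (simp add: \<phi>_def)
        moreover have "norm (\<i> * complex_of_real \<phi>) = 2 * pi / (real a * real b)"
          using \<open>\<phi> > 0\<close> by (simp only: norm_mult norm_ii norm_of_real) (simp add: \<phi>_def)
        ultimately have "sinh ((\<i> * complex_of_real \<phi>) / 2) \<noteq> 0"
          using sinh_factor_nonzero(3)[OF ab, of "\<i> * complex_of_real \<phi>"] by simp
        then have "sinh (of_nat N / 2 * (\<i> * of_real \<phi> / of_nat N)) \<noteq> 0" using elim by simp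
        from torus_jones_cnj[OF this, of a b] show ?case by (simp add: c th)
      qed
    qed
    then show ?thesis using C(1) by (intro exI[of _ "cnj C"]) simp
  qed
  then show ?thesis by (simp add: powr_half_sqrt)
qed

text \<open>The arguments at which the limit 1 / Delta is established. For a minimal c they comprise
  t c with 0 <= t < 1, and c itself unless it is a first zero of this torus knot; nonzero real ones
  occur for the trefoil only.\<close>

definition tame :: "nat \<Rightarrow> nat \<Rightarrow> complex \<Rightarrow> bool" where
  "tame a b z \<longleftrightarrow> z = 0 \<or>
     (\<exists>r. z = of_real r \<and> \<bar>r\<bar> \<le> fig8_root \<and> (a = 2 \<and> b = 3 \<or> a = 3 \<and> b = 2)) \<or>
     (\<exists>\<theta>. z = \<i> * of_real \<theta> \<and> \<bar>\<theta>\<bar> * (real a * real b) < 2 * pi)"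

lemma fig8_root_less_pi_third: "fig8_root < 2 * pi / 6"
  using fig8_root_less pi_gt3 by simp

lemma tame_norm_le:
  assumes "a > 1" "b > 1" "tame a b z"
  shows "norm z \<le> 2 * pi / (real a * real b)"
  using assms(3) fig8_root_less_pi_third assms(1,2) unfolding tame_def
  by (auto simp: norm_mult field_simps)

lemma trefoil_jones_tendsto:
  assumes "r \<noteq> 0" "\<bar>r\<bar> \<le> fig8_root"
  shows "(\<lambda>N. torus_jones 2 3 N (of_real r / of_nat N)) \<longlonglongrightarrow> of_real (1 / (2 * cosh r - 1))"
proof (cases "r > 0")
  case True
  then show ?thesis by (rule trefoil_jones_tendsto_pos)
next
  case False
  then show ?thesis using trefoil_jones_tendsto_neg[of "- r"] assms by simp
qed

lemma torus_jones_tendsto: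
  assumes ab: "a > 1" "b > 1" and z: "tame a b z"
  shows "(\<lambda>N. torus_jones a b N (z / of_nat N)) \<longlonglongrightarrow> 1 / torus_alexander a b z"
    and "torus_alexander a b z \<noteq> 0"
proof -
  have "(\<lambda>N. torus_jones a b N (z / of_nat N)) \<longlonglongrightarrow> 1 / torus_alexander a b z \<and> torus_alexander a b z \<noteq> 0"
  proof (cases "z = 0")
    case True
    have "eventually (\<lambda>N. 1 = torus_jones a b N (z / of_nat N)) sequentially"
      using eventually_gt_at_top[of 0] by eventually_elim (simp add: True torus_jones_0)
    then have "(\<lambda>N. torus_jones a b N (z / of_nat N)) \<longlonglongrightarrow> 1"
      by (rule Lim_transform_eventually[OF tendsto_const])
    then show ?thesis using ab by (simp add: True torus_alexander_0)
  next
    case False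
    with z consider
      r where "z = of_real r" "\<bar>r\<bar> \<le> fig8_root" "a = 2 \<and> b = 3 \<or> a = 3 \<and> b = 2" "r \<noteq> 0"
      | \<theta> where "z = \<i> * of_real \<theta>" "\<bar>\<theta>\<bar> * (real a * real b) < 2 * pi" "\<theta> \<noteq> 0"
      unfolding tame_def by auto
    then show ?thesis
    proof cases
      case (1 r)
      have eq: "torus_jones a b = torus_jones 2 3" "torus_alexander a b = torus_alexander 2 3"
        using 1(3) by (auto simp: fun_eq_iff torus_jones_commute[of 3 2] torus_alexander_commute[of 3 2])
      have "2 * cosh r - 1 > 0" using cosh_real_ge_1[of r] by linarith
      then have "complex_of_real (2 * cosh r - 1) \<noteq> 0" by (simp only: of_real_eq_0_iff)
      then show ?thesis
        using trefoil_jones_tendsto[OF 1(4,2)]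
        unfolding eq 1(1) trefoil_alexander_real[OF 1(4)] of_real_divide of_real_1 by blast
    next
      case (2 \<theta>)
      have "\<bar>\<theta>\<bar> * (real a * real b) \<le> 2 * pi" using 2 by simp
      note alex = torus_alexander_imaginary[OF ab 2(3) this]
      have "sin (\<theta> * (real a * real b) * (1 / 2)) \<noteq> 0"
        using sin_scaled_eq_0[of "\<theta> * (real a * real b)" "1 / 2"] 2 ab by (auto simp: abs_mult)
      then have "sin (\<theta> * (real a * real b) / 2) \<noteq> 0" by simp
      then show ?thesis
        using torus_jones_imaginary_tendsto[of a b \<theta>] 2 ab alex(2-4) unfolding 2(1) alex(1) by simp
    qed
  qed
  then show "(\<lambda>N. torus_jones a b N (z / of_nat N)) \<longlonglongrightarrow> 1 / torus_alexander a b z"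
    and "torus_alexander a b z \<noteq> 0" by auto
qed

text \<open>The nearest zeros of single summands. The pair a, b belongs to the summand from which c
  stems and may differ from that of the summand under study, which enters only through the distance
  of its own first zero from 0.\<close>

definition minimal_root :: "complex \<Rightarrow> bool" where
  "minimal_root c \<longleftrightarrow> c = of_real fig8_root \<or> c = - of_real fig8_root \<or>
     (\<exists>a b \<theta>. a > 1 \<and> b > 1 \<and> coprime a b \<and> c = \<i> * of_real \<theta> \<and> \<bar>\<theta>\<bar> = 2 * pi / (real a * real b))"

text \<open>Below 10 the only product of two coprime factors greater than 1 is 2 * 3; the next one
  is 2 * 5.\<close>

lemma coprime_product_cases:
  fixes a b :: nat
  assumes "a > 1" "b > 1" "coprime a b"
  shows "a = 2 \<and> b = 3 \<or> a = 3 \<and> b = 2 \<or> 10 \<le> a * b"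
proof (rule ccontr)
  assume *: "\<not> ?thesis"
  have "2 * b \<le> a * b" "a * 2 \<le> a * b" using assms by auto
  then have "a < 5" "b < 5" using * by linarith+
  then have "a \<in> {2, 3, 4}" "b \<in> {2, 3, 4}" using assms by auto
  then show False using assms(3) * by (auto simp: coprime_iff_gcd_eq_1 gcd_nat.simps)
qed

lemma imaginary_root_less:
  fixes a b :: nat
  assumes "10 \<le> a * b"
  shows "2 * pi / (real a * real b) < fig8_root"
proof -
  have "10 \<le> real a * real b" using assms by (metis of_nat_le_iff of_nat_mult of_nat_numeral)
  then have "2 * pi / (real a * real b) \<le> 2 * pi / 10" by (intro divide_left_mono) auto
  also have "\<dots> < 2 / 3" using pi_approx by simp
  finally show ?thesis using fig8_root_gt by simp
qed

text \<open>Makes |c| strictly less than \<open>fig8_root\<close> when c is imaginary, so that a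
  figure-eight summand converges at c. For a b >= 10 the torus root is the smaller one, and for the
  trefoil 2 pi / 6 is the larger one.\<close>

lemma imaginary_root_ne_fig8_root:
  fixes a b :: nat
  assumes ab: "a > 1" "b > 1" "coprime a b"
  shows "2 * pi / (real a * real b) \<noteq> fig8_root"
  using coprime_product_cases[OF ab] imaginary_root_less[of a b] fig8_root_less_pi_third by auto

text \<open>A real c has norm \<open>fig8_root\<close>; that it lies no farther out than the first
  zero of T(a,b) forces a b < 10, that is, the trefoil. An imaginary c is either at the first zero
  or strictly inside it.\<close>

lemma tame_minimal_root:
  assumes ab: "a > 1" "b > 1" "coprime a b" and c: "minimal_root c" "norm c \<le> 2 * pi / (real a * real b)"
  shows "tame a b c \<or> (\<exists>\<theta>. c = \<i> * of_real \<theta> \<and> \<bar>\<theta>\<bar> = 2 * pi / (real a * real b))"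
    and "0 \<le> t \<Longrightarrow> t < 1 \<Longrightarrow> tame a b (of_real t * c)"
proof -
  have pos: "real a * real b > 0" using ab by simp
  have real_case: "tame a b (of_real (t * r))" if t: "0 \<le> t" "t \<le> 1" and r: "c = of_real r" "\<bar>r\<bar> = fig8_root" for t r
  proof -
    have le: "fig8_root \<le> 2 * pi / (real a * real b)" using c(2) r by simp
    then have "a = 2 \<and> b = 3 \<or> a = 3 \<and> b = 2"
      using coprime_product_cases[OF ab] imaginary_root_less[of a b] by linarith
    moreover have "\<bar>t * r\<bar> \<le> fig8_root"
      using t r(2) fig8_root_gt by (simp add: abs_mult mult_left_le_one_le)
    ultimately show ?thesis unfolding tame_def by blast
  qed
  have imag: "\<bar>\<theta>\<bar> * (real a * real b) \<le> 2 * pi" if "c = \<i> * of_real \<theta>" for \<theta>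
    using c(2) that pos by (simp add: norm_mult field_simps)
  consider r where "c = of_real r" "\<bar>r\<bar> = fig8_root" | \<theta> where "c = \<i> * of_real \<theta>"
  proof -
    have "\<bar>fig8_root\<bar> = fig8_root" using fig8_root_gt by simp
    then show thesis
      using c(1) that(1)[of fig8_root] that(1)[of "- fig8_root"] that(2) unfolding minimal_root_def by auto
  qed
  note cases = this
  show "tame a b c \<or> (\<exists>\<theta>. c = \<i> * of_real \<theta> \<and> \<bar>\<theta>\<bar> = 2 * pi / (real a * real b))"
  proof (cases rule: cases)
    case (1 r)
    then show ?thesis using real_case[of 1 r] by simp
  next
    case (2 \<theta>)
    then show ?thesis
    proof (cases "\<bar>\<theta>\<bar> * (real a * real b) = 2 * pi")
      case True
      then have "\<bar>\<theta>\<bar> = 2 * pi / (real a * real b)" using pos by (metis nonzero_eq_divide_eq less_irrefl)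
      then show ?thesis using 2 by blast
    next
      case False
      then have "\<bar>\<theta>\<bar> * (real a * real b) < 2 * pi" using imag[OF 2] by simp
      then show ?thesis using 2 unfolding tame_def by blast
    qed
  qed
  assume t: "0 \<le> t" "t < 1"
  show "tame a b (of_real t * c)"
  proof (cases rule: cases)
    case (1 r)
    then show ?thesis using real_case[of t r] t by simp
  next
    case (2 \<theta>)
    have "t * (\<bar>\<theta>\<bar> * (real a * real b)) \<le> t * (2 * pi)" using imag[OF 2] t by (intro mult_left_mono) auto
    also have "\<dots> < 1 * (2 * pi)" using t by (intro mult_strict_right_mono) auto
    finally have "\<bar>t * \<theta>\<bar> * (real a * real b) < 2 * pi" using t by (simp add: abs_mult mult_ac)
    moreover have "of_real t * c = \<i> * of_real (t * \<theta>)" by (simp add: 2)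
    ultimately show ?thesis unfolding tame_def by blast
  qed
qed

lemma minimal_root_minus: "minimal_root c \<Longrightarrow> minimal_root (- c)"
proof -
  assume "minimal_root c"
  then consider "c = of_real fig8_root" | "c = - of_real fig8_root"
    | a b \<theta> where "a > 1" "b > 1" "coprime a b" "c = \<i> * of_real \<theta>" "\<bar>\<theta>\<bar> = 2 * pi / (real a * real b)"
    unfolding minimal_root_def by blast
  then show ?thesis
  proof cases
    case (3 a b \<theta>)
    then have "- c = \<i> * of_real (- \<theta>)" "\<bar>- \<theta>\<bar> = 2 * pi / (real a * real b)" by auto
    then show ?thesis unfolding minimal_root_def using 3(1-3) by blast
  qed (auto simp: minimal_root_def)
qed

section \<open>Locating c and combining the summands\<close>

lemma Lambda_set_Connected_Sum: "Lambda_set (Connected_Sum K L) = Lambda_set K \<union> Lambda_set L"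
  by (auto simp: Lambda_set_def)

lemma torus_root_in_Lambda:
  assumes "a > 1" "b > 1"
  shows "\<i> * of_real (2 * pi / (real a * real b)) \<in> Lambda_set (Torus a b)"
  using torus_alexander_imaginary(1)[OF assms, of "2 * pi / (real a * real b)"] assms
  by (simp add: Lambda_set_def)

lemma norm_torus_root:
  assumes "a > 1" "b > 1"
  shows "norm (\<i> * complex_of_real (2 * pi / (real a * real b))) = 2 * pi / (real a * real b)"
  using assms by (simp add: norm_mult norm_divide)

lemma Lambda_set_Mirror: "Lambda_set (Mirror K) = Lambda_set K"
  by (simp add: Lambda_set_def)

lemma norm_le_fig8_root:
  assumes "\<forall>z\<in>Lambda_set Figure_Eight. norm c \<le> norm z"
  shows "norm c \<le> fig8_root"
proof -
  have "of_real fig8_root \<in> Lambda_set Figure_Eight"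
    using fig8_alexander_root by (simp only: Lambda_set_def mem_Collect_eq)
  then have "norm c \<le> norm (complex_of_real fig8_root)" using assms by blast
  then show ?thesis using fig8_root_gt by simp
qed

lemma norm_le_torus_root:
  assumes "a > 1" "b > 1" "\<forall>z\<in>Lambda_set (Torus a b). norm c \<le> norm z"
  shows "norm c \<le> 2 * pi / (real a * real b)"
  using torus_root_in_Lambda norm_torus_root assms by metis

text \<open>In a connected sum c is a zero of one of the two parts and, the zero sets being united,
  still of least norm there. So it is a nearest zero of a single summand.\<close>

lemma minimal_in_Lambda_set:
  assumes "fig8_torus_sum K" "c \<in> Lambda_set K" "\<forall>z\<in>Lambda_set K. norm c \<le> norm z"
  shows "minimal_root c"
  using assms
proof (induction rule: fig8_torus_sum.induct)
  case 1
  have "norm c \<le> fig8_root" using 1 by (intro norm_le_fig8_root)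
  moreover have "alexander_exp Figure_Eight c = 0" using 1 by (simp only: Lambda_set_def mem_Collect_eq)
  ultimately show ?case using fig8_alexander_eq_0D unfolding minimal_root_def by blast
next
  case (2 a b)
  then have "norm c \<le> 2 * pi / (real a * real b)"
    by (intro norm_le_torus_root)
  moreover have "torus_alexander a b c = 0" using 2 by (simp add: Lambda_set_def)
  ultimately show ?case using torus_alexander_eq_0D 2 unfolding minimal_root_def by blast
next
  case (3 a b)
  then have "norm c \<le> 2 * pi / (real a * real b)"
    unfolding Lambda_set_Mirror by (intro norm_le_torus_root)
  moreover have "torus_alexander a b c = 0" using 3 by (simp add: Lambda_set_def)
  ultimately show ?case using torus_alexander_eq_0D 3 unfolding minimal_root_def by blast
next
  case (4 K L)
  then show ?case by (auto simp: Lambda_set_Connected_Sum)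
qed

definition power_growth :: "knot \<Rightarrow> complex \<Rightarrow> real \<Rightarrow> bool" where
  "power_growth K c \<alpha> \<longleftrightarrow> (\<exists>C. C \<noteq> 0 \<and>
     (\<lambda>N. colored_jones_exp N K (c / of_nat N) / of_real (real N powr \<alpha>)) \<longlonglongrightarrow> C)"

lemma power_growth_0:
  assumes "(\<lambda>N. colored_jones_exp N K (c / of_nat N)) \<longlonglongrightarrow> C" "C \<noteq> 0"
  shows "power_growth K c 0"
  unfolding power_growth_def
proof (intro exI[of _ C] conjI assms(2) Lim_transform_eventually[OF assms(1)])
  \<comment> \<open>True from N = 1 on; at N = 0 the value of \<open>0 powr 0\<close> is 0.\<close>
  show "eventually (\<lambda>N. colored_jones_exp N K (c / of_nat N) =
    colored_jones_exp N K (c / of_nat N) / of_real (real N powr 0)) sequentially"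
    using eventually_gt_at_top[of 0] by eventually_elim simp
qed

lemma power_growth_Connected_Sum:
  assumes "power_growth K c \<alpha>" "power_growth L c \<beta>"
  shows "power_growth (Connected_Sum K L) c (\<alpha> + \<beta>)"
proof -
  obtain C D where C: "C \<noteq> 0" "(\<lambda>N. colored_jones_exp N K (c / of_nat N) / of_real (real N powr \<alpha>)) \<longlonglongrightarrow> C"
    and D: "D \<noteq> 0" "(\<lambda>N. colored_jones_exp N L (c / of_nat N) / of_real (real N powr \<beta>)) \<longlonglongrightarrow> D"
    using assms unfolding power_growth_def by blast
  have "(\<lambda>N. colored_jones_exp N (Connected_Sum K L) (c / of_nat N) / of_real (real N powr (\<alpha> + \<beta>))) \<longlonglongrightarrow> C * D"
    using tendsto_mult[OF C(2) D(2)] by (simp add: powr_add)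
  then show ?thesis unfolding power_growth_def using C(1) D(1) by (intro exI[of _ "C * D"]) simp
qed

lemma fig8_cosh_less:
  assumes "norm z < fig8_root"
  shows "cosh (norm z) < 3 / 2"
proof -
  have "cosh (norm z) < cosh fig8_root" using assms fig8_root_gt by (subst cosh_real_nonneg_less_iff) auto
  then show ?thesis by (simp add: cosh_fig8_root)
qed

lemma fig8_summand:
  assumes c: "minimal_root c" "norm c \<le> fig8_root"
  shows "\<exists>\<alpha>\<ge>0. power_growth Figure_Eight c \<alpha> \<and> (c \<in> Lambda_set Figure_Eight \<longrightarrow> \<alpha> > 0)"
    and "0 \<le> t \<Longrightarrow> t < 1 \<Longrightarrow> (\<lambda>N. colored_jones_exp N Figure_Eight (of_real t * c / of_nat N)) \<longlonglongrightarrow>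
      1 / alexander_exp Figure_Eight (of_real t * c)"
proof -
  show "\<exists>\<alpha>\<ge>0. power_growth Figure_Eight c \<alpha> \<and> (c \<in> Lambda_set Figure_Eight \<longrightarrow> \<alpha> > 0)"
  proof (cases "c = of_real fig8_root \<or> c = - of_real fig8_root")
    case True
    obtain C where "C \<noteq> 0" "(\<lambda>N. fig8_jones N (c / of_nat N) / of_real (real N powr (2 / 3))) \<longlonglongrightarrow> C"
      by (rule fig8_jones_growth[OF True])
    then have "power_growth Figure_Eight c (2 / 3)"
      unfolding power_growth_def by (intro exI[of _ C]) simp
    then show ?thesis by (intro exI[of _ "2 / 3"]) simp
  next
    case False
    then obtain a b \<theta> where "a > 1" "b > 1" "coprime a b" "c = \<i> * of_real \<theta>" "\<bar>\<theta>\<bar> = 2 * pi / (real a * real b)"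
      using c(1) unfolding minimal_root_def by blast
    then have "norm c \<noteq> fig8_root" using imaginary_root_ne_fig8_root[of a b] by (simp add: norm_mult)
    then have "cosh (norm c) < 3 / 2" using c(2) by (intro fig8_cosh_less) simp
    note lim = fig8_jones_tendsto[OF this]
    have "power_growth Figure_Eight c 0"
      by (rule power_growth_0[where C = "1 / alexander_exp Figure_Eight c"])
         (use lim in \<open>simp_all only: colored_jones_exp.simps(1), simp\<close>)
    moreover have "c \<notin> Lambda_set Figure_Eight" using lim(2) by (simp only: Lambda_set_def mem_Collect_eq) simp
    ultimately show ?thesis by (intro exI[of _ 0]) simp
  qed
  assume t: "0 \<le> t" "t < 1"
  have "norm (of_real t * c) < fig8_root"
  proof -
    have "t * norm c \<le> t * fig8_root" using c(2) t by (intro mult_left_mono) auto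
    also have "\<dots> < 1 * fig8_root" using t fig8_root_gt by (intro mult_strict_right_mono) auto
    finally show ?thesis using t by (simp add: norm_mult)
  qed
  from fig8_jones_tendsto(1)[OF fig8_cosh_less[OF this]]
  show "(\<lambda>N. colored_jones_exp N Figure_Eight (of_real t * c / of_nat N)) \<longlonglongrightarrow>
      1 / alexander_exp Figure_Eight (of_real t * c)"
    by (simp only: colored_jones_exp.simps(1))
qed

lemma torus_summand:
  assumes ab: "a > 1" "b > 1" "coprime a b" and c: "minimal_root c" "norm c \<le> 2 * pi / (real a * real b)"
  shows "\<exists>\<alpha>\<ge>0. power_growth (Torus a b) c \<alpha> \<and> (c \<in> Lambda_set (Torus a b) \<longrightarrow> \<alpha> > 0)"
    and "0 \<le> t \<Longrightarrow> t < 1 \<Longrightarrow> (\<lambda>N. colored_jones_exp N (Torus a b) (of_real t * c / of_nat N)) \<longlonglongrightarrow>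
      1 / alexander_exp (Torus a b) (of_real t * c)"
proof -
  from tame_minimal_root(1)[OF ab c]
  show "\<exists>\<alpha>\<ge>0. power_growth (Torus a b) c \<alpha> \<and> (c \<in> Lambda_set (Torus a b) \<longrightarrow> \<alpha> > 0)"
  proof
    assume "tame a b c"
    note lim = torus_jones_tendsto[OF ab(1,2) this]
    have "power_growth (Torus a b) c 0"
      by (rule power_growth_0[where C = "1 / torus_alexander a b c"]) (use lim in simp_all)
    moreover have "c \<notin> Lambda_set (Torus a b)" using lim(2) by (simp add: Lambda_set_def)
    ultimately show ?thesis by (intro exI[of _ 0]) simp
  next
    assume "\<exists>\<theta>. c = \<i> * of_real \<theta> \<and> \<bar>\<theta>\<bar> = 2 * pi / (real a * real b)"
    then have "power_growth (Torus a b) c (1 / 2)"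
      using torus_jones_growth[OF ab(1,2)] unfolding power_growth_def by auto
    then show ?thesis by (intro exI[of _ "1 / 2"]) simp
  qed
  assume "0 \<le> t" "t < 1"
  from torus_jones_tendsto(1)[OF ab(1,2) tame_minimal_root(2)[OF ab c this]]
  show "(\<lambda>N. colored_jones_exp N (Torus a b) (of_real t * c / of_nat N)) \<longlonglongrightarrow>
      1 / alexander_exp (Torus a b) (of_real t * c)"
    by simp
qed

text \<open>The mirror image evaluates the Jones polynomial at - c, which is again a candidate,
  whereas Delta is taken at c; its evenness on the disc reconciles the two.\<close>

lemma mirror_torus_summand:
  assumes ab: "a > 1" "b > 1" "coprime a b" and c: "minimal_root c" "norm c \<le> 2 * pi / (real a * real b)"
  shows "\<exists>\<alpha>\<ge>0. power_growth (Mirror (Torus a b)) c \<alpha> \<and> (c \<in> Lambda_set (Mirror (Torus a b)) \<longrightarrow> \<alpha> > 0)"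
    and "0 \<le> t \<Longrightarrow> t < 1 \<Longrightarrow> (\<lambda>N. colored_jones_exp N (Mirror (Torus a b)) (of_real t * c / of_nat N)) \<longlonglongrightarrow>
      1 / alexander_exp (Mirror (Torus a b)) (of_real t * c)"
proof -
  have c': "minimal_root (- c)" "norm (- c) \<le> 2 * pi / (real a * real b)"
    using c by (auto intro: minimal_root_minus)
  have "power_growth (Mirror (Torus a b)) c = power_growth (Torus a b) (- c)"
    by (simp add: power_growth_def fun_eq_iff)
  moreover have "c \<in> Lambda_set (Mirror (Torus a b)) \<longleftrightarrow> - c \<in> Lambda_set (Torus a b)"
    using torus_alexander_minus[OF ab(1,2) c(2)] by (simp add: Lambda_set_def)
  ultimately show "\<exists>\<alpha>\<ge>0. power_growth (Mirror (Torus a b)) c \<alpha> \<and> (c \<in> Lambda_set (Mirror (Torus a b)) \<longrightarrow> \<alpha> > 0)"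
    using torus_summand(1)[OF ab c'] by simp
  assume t: "0 \<le> t" "t < 1"
  have "norm (of_real t * c) \<le> 2 * pi / (real a * real b)"
    by (rule tame_norm_le[OF ab(1,2) tame_minimal_root(2)[OF ab c t]])
  from torus_alexander_minus[OF ab(1,2) this] torus_summand(2)[OF ab c' t]
  show "(\<lambda>N. colored_jones_exp N (Mirror (Torus a b)) (of_real t * c / of_nat N)) \<longlonglongrightarrow>
      1 / alexander_exp (Mirror (Torus a b)) (of_real t * c)"
    by simp
qed

text \<open>Shaped for the induction: in a connected sum c may be a zero of one part only, while its
  minimality passes to both. So each part receives a nonnegative exponent, positive when c is its
  zero, and the sum of the two is positive as soon as one of them is.\<close>

lemma summand_asymptotics:
  assumes "fig8_torus_sum K" "minimal_root c" "\<forall>z\<in>Lambda_set K. norm c \<le> norm z"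
  shows "(\<exists>\<alpha>\<ge>0. power_growth K c \<alpha> \<and> (c \<in> Lambda_set K \<longrightarrow> \<alpha> > 0)) \<and>
    (\<forall>t. 0 \<le> t \<and> t < 1 \<longrightarrow>
      (\<lambda>N. colored_jones_exp N K (of_real t * c / of_nat N)) \<longlonglongrightarrow> 1 / alexander_exp K (of_real t * c))"
  using assms(1,3)
proof (induction rule: fig8_torus_sum.induct)
  case 1
  have "norm c \<le> fig8_root" using 1 by (intro norm_le_fig8_root)
  then show ?case using fig8_summand[OF assms(2)] by blast
next
  case (2 a b)
  then have "norm c \<le> 2 * pi / (real a * real b)"
    by (intro norm_le_torus_root)
  then show ?case using torus_summand[OF 2(1-3) assms(2)] by blast
next
  case (3 a b)
  then have "norm c \<le> 2 * pi / (real a * real b)"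
    unfolding Lambda_set_Mirror by (intro norm_le_torus_root)
  then show ?case using mirror_torus_summand[OF 3(1-3) assms(2)] by blast
next
  case (4 K L)
  have K: "\<forall>z\<in>Lambda_set K. norm c \<le> norm z" and L: "\<forall>z\<in>Lambda_set L. norm c \<le> norm z"
    using 4(5) by (auto simp: Lambda_set_Connected_Sum)
  note IH = 4(3)[OF K] 4(4)[OF L]
  obtain \<alpha> \<beta> where \<alpha>: "\<alpha> \<ge> 0" "power_growth K c \<alpha>" "c \<in> Lambda_set K \<longrightarrow> \<alpha> > 0"
    and \<beta>: "\<beta> \<ge> 0" "power_growth L c \<beta>" "c \<in> Lambda_set L \<longrightarrow> \<beta> > 0"
    using IH by blast
  have "power_growth (Connected_Sum K L) c (\<alpha> + \<beta>)" using \<alpha> \<beta> by (intro power_growth_Connected_Sum)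
  moreover have "c \<in> Lambda_set (Connected_Sum K L) \<longrightarrow> \<alpha> + \<beta> > 0" "\<alpha> + \<beta> \<ge> 0"
    using \<alpha> \<beta> by (auto simp: Lambda_set_Connected_Sum)
  moreover have "(\<lambda>N. colored_jones_exp N (Connected_Sum K L) (of_real t * c / of_nat N)) \<longlonglongrightarrow>
      1 / alexander_exp (Connected_Sum K L) (of_real t * c)" if "0 \<le> t" "t < 1" for t
  proof -
    have "(\<lambda>N. colored_jones_exp N K (of_real t * c / of_nat N) * colored_jones_exp N L (of_real t * c / of_nat N)) \<longlonglongrightarrow>
      1 / alexander_exp K (of_real t * c) * (1 / alexander_exp L (of_real t * c))"
      using IH that by (intro tendsto_mult) auto
    then show ?thesis by simp
  qed
  ultimately show ?case by blast
qed

theorem proposition4p1: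
  fixes K :: knot and c :: complex
  assumes "fig8_torus_sum K"
    and "c \<in> Lambda_set K"
    and "\<forall>z\<in>Lambda_set K. cmod c \<le> cmod z"
  shows "grows_polynomially (\<lambda>N. colored_jones_exp N K (c / of_nat N)) \<and>
    (\<forall>t::real. 0 \<le> t \<and> t < 1 \<longrightarrow>
       (\<lambda>N. colored_jones_exp N K (of_real t * c / of_nat N))
         \<longlonglongrightarrow> 1 / alexander_exp K (of_real t * c))"
proof -
  note asymp = summand_asymptotics[OF assms(1) minimal_in_Lambda_set[OF assms] assms(3)]
  then obtain \<alpha> C where \<alpha>: "\<alpha> > 0" and C: "C \<noteq> 0"
    "(\<lambda>N. colored_jones_exp N K (c / of_nat N) / of_real (real N powr \<alpha>)) \<longlonglongrightarrow> C"
    using assms(2) unfolding power_growth_def by blast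
  have "(\<lambda>N. colored_jones_exp N K (c / of_nat N) / of_real (real N powr \<alpha>) / C) \<longlonglongrightarrow> C / C"
    using C by (intro tendsto_divide tendsto_const) auto
  then have "(\<lambda>N. colored_jones_exp N K (c / of_nat N) / (C * of_real (real N powr \<alpha>))) \<longlonglongrightarrow> 1"
    using C(1) by (simp add: mult.commute)
  then have "grows_polynomially (\<lambda>N. colored_jones_exp N K (c / of_nat N))"
    unfolding grows_polynomially_def using \<alpha> C(1) by blast
  then show ?thesis using asymp by blast
qed

end
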